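(* Let $q$ be a prime power with $q\equiv 5$ or $9\pmod{12}$. Then there exists a Cameron-Liebler line class in $\mathrm{AG}(3,q)$ with parameter $x=\frac{q^2-1}{2}$.
   Context: $\mathrm{AG}(3,q)$ is the 3-dimensional affine space over $\mathbb{F}_q$. A line spread of $\mathrm{AG}(3,q)$ is a set of pairwise disjoint lines of $\mathrm{AG}(3,q)$ that partitions the points of $\mathrm{AG}(3,q)$. A Cameron-Liebler line class of parameter $x$ in $\mathrm{AG}(3,q)$ is a set $\mathcal{L}$ of lines of $\mathrm{AG}(3,q)$ such that $|\mathcal{L}\cap\mathcal{S}|=x$ for every line spread $\mathcal{S}$ of $\mathrm{AG}(3,q)$. *)

theory Defs
  imports
    "HOL-Analysis.Finite_Cartesian_Product"
    "HOL-Analysis.Cartesian_Space"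
    "HOL-Library.Disjoint_Sets"
    "HOL-Number_Theory.Number_Theory"
begin

text \<open>
  The points of $\mathrm{AG}(3,q)$ are the elements of \<open>'a^3\<close>, where \<open>'a\<close> is a finite field
  with \<open>q\<close> elements.
\<close>

definition ag3_lines :: "(('a::field)^3) set set" where
  "ag3_lines = {{p + c *s d | c. True} | p d. d \<noteq> 0}"

definition line_spread :: "(('a::field)^3) set set \<Rightarrow> bool" where
  "line_spread S \<longleftrightarrow> S \<subseteq> ag3_lines \<and> partition_on UNIV S"

definition cameron_liebler_line_class :: "(('a::{field,finite})^3) set set \<Rightarrow> nat \<Rightarrow> bool" where
  "cameron_liebler_line_class L x \<longleftrightarrow>
     L \<subseteq> ag3_lines \<and> (\<forall>S. line_spread S \<longrightarrow> card (L \<inter> S) = x)"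

end

theory Submission
  imports Defs "HOL-Computational_Algebra.Polynomial"
begin

text \<open>
  Since every line spread partitions the points, it suffices to find a weight \<open>g\<close> on the points all
  of whose line sums are 0 or 1 and whose total is \<open>(q\<^sup>2 - 1) / 2\<close>. Identify the space with the cubic
  extension \<open>K\<close> of the field \<open>F\<close> with \<open>q\<close> elements and let \<open>\<psi>\<close> be the quartic character of \<open>K\<close>.
  Lines through 0 have \<open>\<psi>\<close>-sum 0, and the claim is that all the other lines have \<open>\<psi>\<close>-sum \<open>u \<gamma>\<close> with
  \<open>u\<close> a fourth root of unity and \<open>\<gamma>\<close> a fixed Gaussian integer of norm \<open>q\<close>; then
  \<open>g x = 1 / (2 q) + Re ((1 + \<i>) \<psi> x / (2 \<gamma>))\<close> for \<open>x \<noteq> 0\<close> works.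

  For the claim, the squared moduli of these line sums have mean \<open>q\<close> by orthogonality, and the sums
  are nonzero because they consist of an odd number of units. So it is enough that \<open>q\<close> divides every
  product \<open>L * cnj L'\<close> of two of them in the Gaussian integers. If the characteristic \<open>p\<close> is 1 modulo 4,
  a duality between lines gives \<open>q L = E Y\<close>, where \<open>Y\<close> is a Gaussian integer and \<open>E\<close> is the sum of \<open>\<psi>\<close>
  over the elements of trace 1; here \<open>E * cnj E = q\<^sup>2\<close>, and modulo one of the two primes above \<open>p\<close> the
  number \<open>E\<close> is a multinomial coefficient prime to \<open>p\<close>, so that \<open>E + cnj E\<close> is prime to \<open>p\<close>.
  If \<open>p = 3\<close> and \<open>q = 9 ^ k\<close>, the line sums are quartic character sums of cubic polynomials over \<open>F\<close>;
  since cubing is additive they reduce to quadratic Gauss sums and to the exponential sum of a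
  quadratic form, which yields divisibility by \<open>3 ^ k\<close>.
\<close>

subsection \<open>Gaussian integers\<close>

text \<open>Gaussian integers stay inside \<open>complex\<close>, so that they mix freely with
  character values, conjugates and Gauss sums.\<close>

definition gauss_int :: "complex \<Rightarrow> bool" where
  "gauss_int z \<longleftrightarrow> Re z \<in> \<int> \<and> Im z \<in> \<int>"

lemma gauss_int_basic [simp, intro]:
  "gauss_int 0" "gauss_int 1" "gauss_int \<i>" "gauss_int (of_int k)" "gauss_int (of_nat n)"
  by (auto simp: gauss_int_def)

lemma gauss_int_ops [intro]:
  assumes "gauss_int z" "gauss_int w"
  shows "gauss_int (z + w)" "gauss_int (z - w)" "gauss_int (z * w)"
  using assms by (auto simp: gauss_int_def)

lemma gauss_int_unary [intro]:
  assumes "gauss_int z"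
  shows "gauss_int (- z)" "gauss_int (cnj z)"
  using assms by (auto simp: gauss_int_def)

lemma gauss_int_sum [intro]: "(\<And>x. x \<in> A \<Longrightarrow> gauss_int (f x)) \<Longrightarrow> gauss_int (sum f A)"
  by (induction A rule: infinite_finite_induct) auto

lemma gauss_int_iff: "gauss_int z \<longleftrightarrow> (\<exists>a b. z = Complex (of_int a) (of_int b))"
  by (auto simp: gauss_int_def Ints_def complex_eq_iff)

lemma gauss_int_norm_one_cases:
  assumes "gauss_int z" "z * cnj z = 1"
  shows "z \<in> {1, \<i>, -1, -\<i>}"
proof -
  obtain a b where z: "z = Complex (of_int a) (of_int b)" using assms gauss_int_iff by auto
  have "(of_int a)\<^sup>2 + (of_int b)\<^sup>2 = (1::real)"
    using assms(2) unfolding z by (simp add: complex_eq_iff power2_eq_square)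
  hence "a\<^sup>2 + b\<^sup>2 = 1" by (metis of_int_add of_int_eq_1_iff of_int_power)
  moreover have "\<bar>a\<bar> < 2" "\<bar>b\<bar> < 2"
  proof -
    have "a\<^sup>2 < 4" "b\<^sup>2 < 4" using \<open>a\<^sup>2 + b\<^sup>2 = 1\<close> zero_le_power2[of a] zero_le_power2[of b] by linarith+
    thus "\<bar>a\<bar> < 2" "\<bar>b\<bar> < 2"
      using power2_less_imp_less[of "\<bar>a\<bar>" 2] power2_less_imp_less[of "\<bar>b\<bar>" 2] by simp_all
  qed
  ultimately have "(a = 0 \<and> (b = 1 \<or> b = -1)) \<or> (b = 0 \<and> (a = 1 \<or> a = -1))"
  proof -
    have "a \<in> {-1, 0, 1}" "b \<in> {-1, 0, 1}" using \<open>\<bar>a\<bar> < 2\<close> \<open>\<bar>b\<bar> < 2\<close> by auto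
    thus ?thesis using \<open>a\<^sup>2 + b\<^sup>2 = 1\<close> by auto
  qed
  thus ?thesis unfolding z by (auto simp: complex_eq_iff)
qed

subsection \<open>Finite fields\<close>

text \<open>Multiplication by a nonzero \<open>x\<close> permutes the nonzero elements, so the
  product of these can be cancelled.\<close>

lemma finite_field_power_card:
  fixes x :: "'k::{field,finite}"
  shows "x ^ CARD('k) = x"
proof (cases "x = 0")
  case False
  have "x * (\<Prod>y\<in>UNIV-{0}. x * y) = x * x ^ (CARD('k) - 1) * \<Prod>(UNIV-{0})"
    by (simp add: prod.distrib mult_ac)
  also have "x * x ^ (CARD('k) - 1) = x ^ Suc (CARD('k) - 1)"
    by (subst power_Suc) auto
  also have "Suc (CARD('k) - 1) = CARD('k)"
    using finite_UNIV_card_ge_0[where ?'a = 'k] by simp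
  also have "(\<Prod>y\<in>UNIV-{0}. x * y) = (\<Prod>y\<in>UNIV-{0}. y)"
    by (rule prod.reindex_bij_witness[of _ "\<lambda>y. y / x" "\<lambda>y. x * y"]) (use False in auto)
  finally show ?thesis
    by simp
qed (use finite_UNIV_card_ge_0[where ?'a = 'k] in auto)

lemma finite_field_power_card_minus_1:
  fixes x :: "'k::{field,finite}"
  assumes "x \<noteq> 0"
  shows "x ^ (CARD('k) - 1) = 1"
proof -
  have "x * x ^ (CARD('k) - 1) = x * 1"
    using finite_field_power_card[of x] finite_UNIV_card_ge_0[where ?'a = 'k]
    by (metis finite mult.right_neutral power_eq_if gr_implies_not0)
  thus ?thesis using assms by simp
qed

text \<open>Stands in for the cyclicity of the multiplicative group: counting roots of
  \<open>X ^ n - c\<close> forces the existence of elements on which a given power is not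
  trivial.\<close>

lemma card_power_eq_le:
  fixes c :: "'k::{field,finite}"
  assumes "n > 0"
  shows "card {x. x ^ n = c} \<le> n"
proof -
  have "card {x. poly (monom 1 n - [:c:]) x = 0} \<le> degree (monom 1 n - [:c:])"
  proof (rule card_poly_roots_bound)
    show "monom 1 n - [:c:] \<noteq> 0"
    proof
      assume "monom 1 n - [:c:] = 0"
      hence "coeff (monom 1 n - [:c:]) n = 0" by simp
      thus False using assms by (simp add: coeff_pCons split: nat.splits)
    qed
  qed
  also have "degree (monom 1 n - [:c:]) \<le> n"
    by (intro degree_diff_le) (auto simp: degree_monom_le)
  finally show ?thesis by (simp add: poly_monom)
qed

lemma CHAR_finite_field:
  assumes "CARD('k::{field,finite}) = p ^ r" "prime p"
  shows "CHAR('k) = p"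
proof -
  have "prime CHAR('k)"
    by (rule prime_CHAR_semidom) (rule finite_imp_CHAR_pos, simp)
  moreover have "CHAR('k) dvd p ^ r" using CHAR_dvd_CARD[where 'a='k] assms by simp
  ultimately show ?thesis using assms(2) by (metis prime_dvd_power primes_dvd_imp_eq)
qed

text \<open>The sum is invariant under \<open>x \<mapsto> g x\<close>, where \<open>g\<close> is not a root of \<open>X ^ j - 1\<close>.\<close>

lemma sum_power_eq_0:
  assumes "j > 0" "j < CARD('k::{field,finite}) - 1"
  shows "(\<Sum>x\<in>UNIV. (x::'k) ^ j) = 0"
proof -
  have "\<exists>g::'k. g \<noteq> 0 \<and> g ^ j \<noteq> 1"
  proof (rule ccontr)
    assume "\<not> ?thesis"
    hence "UNIV - {0} \<subseteq> {x::'k. x ^ j = 1}" by auto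
    hence "card (UNIV - {0::'k}) \<le> card {x::'k. x ^ j = 1}" by (intro card_mono) auto
    also have "\<dots> \<le> j" using assms by (intro card_power_eq_le) auto
    finally show False using assms by (simp add: card_Diff_singleton)
  qed
  then obtain g :: 'k where g: "g \<noteq> 0" "g ^ j \<noteq> 1" by blast
  have "(\<Sum>x\<in>UNIV. (x::'k) ^ j) = (\<Sum>x\<in>UNIV. (g * x) ^ j)"
    by (rule sum.reindex_bij_witness[of _ "\<lambda>x. g * x" "\<lambda>x. x / g"]) (use g in auto)
  also have "\<dots> = g ^ j * (\<Sum>x\<in>UNIV. x ^ j)" by (simp add: power_mult_distrib sum_distrib_left)
  finally show ?thesis using g by (simp add: algebra_simps)
qed

text \<open>On nonzero elements the exponent matters only modulo \<open>CARD('k) - 1\<close>. If it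
  reduces to 0, the sum counts the nonzero elements, and their number is -1 in the field.\<close>

lemma sum_power_general:
  assumes "j > 0"
  shows "(\<Sum>x\<in>UNIV. (x::'k::{field,finite}) ^ j) = (if (CARD('k) - 1) dvd j then -1 else 0)"
proof -
  let ?N = "CARD('k) - 1"
  have N: "?N > 0" using card_mono[of UNIV "{0::'k, 1}"] by simp
  have *: "x ^ j = (if x = 0 then 0 else x ^ (j mod ?N))" for x :: 'k
  proof (cases "x = 0")
    case False
    have "x ^ j = x ^ (?N * (j div ?N) + j mod ?N)" by simp
    also have "\<dots> = x ^ (j mod ?N)"
      by (simp only: power_add power_mult finite_field_power_card_minus_1[OF False]) simp
    finally show ?thesis using False by simp
  qed (use assms in auto)
  have "(\<Sum>x\<in>UNIV. (x::'k) ^ j) = (\<Sum>x\<in>UNIV-{0}. (x::'k) ^ (j mod ?N))"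
  proof (rule sum.mono_neutral_cong_right)
    show "x ^ j = x ^ (j mod ?N)" if "x \<in> UNIV - {0}" for x :: 'k
      using *[of x] that by simp
  qed (use assms in auto)
  also have "\<dots> = (if ?N dvd j then -1 else 0)"
  proof (cases "?N dvd j")
    case True
    have "(of_nat (CARD('k)) :: 'k) = 0"
      using CHAR_dvd_CARD[where 'a='k] by (simp add: of_nat_eq_0_iff_char_dvd)
    hence "(of_nat ?N :: 'k) = -1" using N by (simp add: of_nat_diff)
    thus ?thesis using True by (simp add: card_Diff_singleton mod_eq_0_iff_dvd)
  next
    case False
    hence "j mod ?N > 0" "j mod ?N < ?N" using N by (auto simp: mod_greater_zero_iff_not_dvd)
    moreover from this have "(\<Sum>x\<in>UNIV-{0}. (x::'k) ^ (j mod ?N)) = (\<Sum>x\<in>UNIV. (x::'k) ^ (j mod ?N))"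
      by (intro sum.mono_neutral_left) auto
    ultimately show ?thesis using False by (simp add: sum_power_eq_0)
  qed
  finally show ?thesis .
qed

subsection \<open>The quartic character\<close>

text \<open>For nonzero \<open>x\<close> the power \<open>y\<close> is a fourth root of unity in the
  field; it is transported to the complex ones by \<open>\<iota> \<mapsto> \<i>\<close>. The final
  default gives the value at 0.\<close>

definition quartic_char :: "'k::{field,finite} \<Rightarrow> 'k \<Rightarrow> complex" where
  "quartic_char \<iota> x = (let y = x ^ ((CARD('k) - 1) div 4) in
     if y = 1 then 1 else if y = \<iota> then \<i> else if y = -1 then -1 else if y = -\<iota> then -\<i> else 0)"

locale quartic_field =
  fixes \<iota> :: "'k::{field,finite}" and m :: nat
  assumes \<iota>_square: "\<iota> * \<iota> = -1"
    and card_field: "CARD('k) = 4 * m + 1"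
begin

abbreviation \<psi> :: "'k \<Rightarrow> complex" where "\<psi> \<equiv> quartic_char \<iota>"

lemma m_pos: "m > 0"
  using card_mono[of UNIV "{0::'k, 1}"] card_field by (cases m) auto

lemma two_nonzero: "(2::'k) \<noteq> 0"
proof
  assume "(2::'k) = 0"
  hence "of_nat 2 = (0::'k)" by simp
  hence "CHAR('k) dvd 2" by (simp only: of_nat_eq_0_iff_char_dvd)
  moreover have "CHAR('k) dvd 4 * m + 1" using CHAR_dvd_CARD[where 'a='k] card_field by simp
  ultimately have "CHAR('k) dvd 1"
    by (metis dvd_add_right_iff dvd_trans even_numeral dvd_triv_left mult_2_right numeral_Bit0 dvd_mult2)
  thus False by simp
qed

lemma one_neq_minus_one: "(1::'k) \<noteq> -1" "(-1::'k) \<noteq> 1"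
  using two_nonzero by (metis add.right_inverse one_add_one)+

lemma \<iota>_simps:
  "\<iota> \<noteq> 0" "\<iota> \<noteq> 1" "\<iota> \<noteq> -1" "\<iota> \<noteq> -\<iota>" "1 \<noteq> \<iota>" "-1 \<noteq> \<iota>" "-\<iota> \<noteq> \<iota>" "-\<iota> \<noteq> 1" "-\<iota> \<noteq> -1"
proof -
  show 0: "\<iota> \<noteq> 0" using \<iota>_square by auto
  show a: "\<iota> \<noteq> 1" using \<iota>_square one_neq_minus_one by auto
  show b: "\<iota> \<noteq> -1" using \<iota>_square one_neq_minus_one by auto
  show c: "\<iota> \<noteq> -\<iota>"
  proof
    assume "\<iota> = -\<iota>"
    hence "2 * \<iota> = 0" by (metis add.right_inverse mult_2)
    thus False using 0 two_nonzero by simp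
  qed
  show "1 \<noteq> \<iota>" "-1 \<noteq> \<iota>" "-\<iota> \<noteq> \<iota>" "-\<iota> \<noteq> 1" "-\<iota> \<noteq> -1"
    using a b c by (auto simp: minus_equation_iff)
qed

lemma power_4m: "x \<noteq> 0 \<Longrightarrow> x ^ (4 * m) = (1::'k)"
  using finite_field_power_card_minus_1[of x] card_field by simp

lemma power_m_cases:
  assumes "x \<noteq> 0"
  shows "x ^ m \<in> {1, \<iota>, -1, -\<iota>}"
proof -
  let ?y = "x ^ m"
  have "?y ^ 4 = 1" using power_4m[OF assms] by (simp add: power_mult[symmetric] mult.commute)
  hence "(?y - 1) * (?y + 1) * ((?y - \<iota>) * (?y + \<iota>)) = 0"
  proof -
    have "(?y - 1) * (?y + 1) * ((?y - \<iota>) * (?y + \<iota>)) = (?y * ?y - 1) * (?y * ?y - \<iota> * \<iota>)"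
      by (simp add: algebra_simps)
    also have "\<dots> = ?y ^ 4 - 1" by (simp add: \<iota>_square algebra_simps power4_eq_xxxx)
    finally show ?thesis using \<open>?y ^ 4 = 1\<close> by simp
  qed
  thus ?thesis by (auto simp: eq_neg_iff_add_eq_0)
qed

lemma \<psi>_unfold: "\<psi> x = (if x ^ m = 1 then 1 else if x ^ m = \<iota> then \<i> else if x ^ m = -1 then -1
    else if x ^ m = -\<iota> then -\<i> else 0)"
  by (simp add: quartic_char_def card_field)

lemma \<psi>_0 [simp]: "\<psi> 0 = 0"
  using m_pos \<iota>_simps by (auto simp: \<psi>_unfold zero_power)

lemma \<psi>_1 [simp]: "\<psi> 1 = 1"
  by (simp add: \<psi>_unfold)

lemma \<psi>_cases:
  assumes "x \<noteq> 0"
  obtains "x ^ m = 1" "\<psi> x = 1" | "x ^ m = \<iota>" "\<psi> x = \<i>" | "x ^ m = -1" "\<psi> x = -1"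
    | "x ^ m = -\<iota>" "\<psi> x = -\<i>"
  using power_m_cases[OF assms] by (auto simp: \<psi>_unfold \<iota>_simps one_neq_minus_one)

lemma \<psi>_eq_iff:
  assumes "x \<noteq> 0"
  shows "\<psi> x = 1 \<longleftrightarrow> x ^ m = 1"
  using assms by (cases rule: \<psi>_cases) (auto simp: complex_eq_iff \<iota>_simps one_neq_minus_one)

lemma \<psi>_mult: "\<psi> (x * y) = \<psi> x * \<psi> y"
proof (cases "x = 0 \<or> y = 0")
  case False
  hence "x \<noteq> 0" "y \<noteq> 0" "x * y \<noteq> 0" by auto
  note [simp] = \<psi>_unfold[of "x * y"] power_mult_distrib \<iota>_simps one_neq_minus_one \<iota>_square
  show ?thesis
    by (rule \<psi>_cases[OF \<open>x \<noteq> 0\<close>]; rule \<psi>_cases[OF \<open>y \<noteq> 0\<close>]) simp_all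
qed auto

lemma \<psi>_power: "\<psi> (x ^ n) = \<psi> x ^ n"
  by (induction n) (auto simp: \<psi>_mult)

lemma \<psi>_cnj: "x \<noteq> 0 \<Longrightarrow> \<psi> x * cnj (\<psi> x) = 1"
  by (erule \<psi>_cases) auto

lemma \<psi>_cnj': "x \<noteq> 0 \<Longrightarrow> cnj (\<psi> x) * \<psi> x = 1"
  by (erule \<psi>_cases) auto

lemma \<psi>_nonzero: "x \<noteq> 0 \<Longrightarrow> \<psi> x \<noteq> 0"
  by (erule \<psi>_cases) auto

lemma \<psi>_inverse: "\<psi> (inverse x) = cnj (\<psi> x)"
proof (cases "x = 0")
  case False
  have "\<psi> (inverse x) * \<psi> x = cnj (\<psi> x) * \<psi> x"
    using \<psi>_cnj'[OF False] False by (simp flip: \<psi>_mult)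
  thus ?thesis using \<psi>_nonzero[OF False] by simp
qed auto

lemma \<psi>_divide: "\<psi> (x / y) = \<psi> x * cnj (\<psi> y)"
  by (simp add: divide_inverse \<psi>_mult \<psi>_inverse)

lemma \<psi>_cube: "\<psi> x ^ 3 = cnj (\<psi> x)"
  by (cases "x = 0"; (erule \<psi>_cases)?) (auto simp: power3_eq_cube)

lemma gauss_int_\<psi> [intro, simp]: "gauss_int (\<psi> x)"
  by (cases "x = 0"; (erule \<psi>_cases)?) auto

text \<open>Scaling by \<open>c\<close> permutes \<open>A\<close> and multiplies the sum by
  \<open>\<psi> c\<close>.\<close>

lemma sum_\<psi>_eq_0:
  assumes "c \<noteq> 0" "\<psi> c \<noteq> 1" "\<And>x. x \<in> A \<longleftrightarrow> c * x \<in> A"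
  shows "(\<Sum>x\<in>A. \<psi> x) = 0"
proof -
  have "(\<Sum>x\<in>A. \<psi> x) = (\<Sum>x\<in>A. \<psi> (c * x))"
    by (rule sum.reindex_bij_witness[of _ "\<lambda>x. c * x" "\<lambda>x. x / c"])
       (use assms(1) assms(3) in \<open>auto simp: assms(3)[of "_ / c"]\<close>)
  also have "\<dots> = \<psi> c * (\<Sum>x\<in>A. \<psi> x)" by (simp add: \<psi>_mult sum_distrib_left)
  finally show ?thesis using assms(2) by (metis mult_cancel_right1)
qed

lemma floor_minus_one: "\<lfloor>- 1 :: real\<rfloor> = -1"
  by (metis floor_of_int of_int_1 of_int_minus)

text \<open>Reducing Gaussian integers by \<open>\<i> \<mapsto> - \<iota>\<close> turns character
  values into powers in the field, because \<open>- \<iota>\<close> is the cube of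
  \<open>\<iota>\<close>. The floors only read off integer coordinates.\<close>

lemma \<psi>_gauss:
  "of_int \<lfloor>Re (\<psi> x)\<rfloor> - \<iota> * of_int \<lfloor>Im (\<psi> x)\<rfloor> = x ^ (3 * m)"
proof (cases "x = 0")
  case False
  have "x ^ (3 * m) = (x ^ m) ^ 3" by (simp add: power_mult[symmetric] mult.commute)
  thus ?thesis
    by (cases rule: \<psi>_cases[OF False]) (simp_all add: power3_eq_cube \<iota>_square floor_minus_one)
qed (use m_pos in auto)

end

text \<open>If \<open>g ^ (2 * m)\<close> is not 1, it is the other square root of 1, so
  \<open>g ^ m\<close> squares to -1.\<close>

lemma exists_quartic_field:
  assumes "CARD('k::{field,finite}) = 4 * m + 1"
  shows "\<exists>\<iota>::'k. quartic_field \<iota> m"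
proof -
  have m: "m > 0" using card_mono[of UNIV "{0::'k, 1}"] assms by (cases m) auto
  have "\<exists>g::'k. g \<noteq> 0 \<and> g ^ (2 * m) \<noteq> 1"
  proof (rule ccontr)
    assume "\<not> ?thesis"
    hence "UNIV - {0} \<subseteq> {x::'k. x ^ (2 * m) = 1}" by auto
    hence "card (UNIV - {0::'k}) \<le> card {x::'k. x ^ (2 * m) = 1}" by (intro card_mono) auto
    also have "\<dots> \<le> 2 * m" using m by (intro card_power_eq_le) auto
    finally show False using assms m by (simp add: card_Diff_singleton)
  qed
  then obtain g :: 'k where g: "g \<noteq> 0" "g ^ (2 * m) \<noteq> 1" by blast
  have "g ^ (4 * m) = 1" using finite_field_power_card_minus_1[OF g(1)] assms by simp
  moreover have "g ^ (4 * m) = (g ^ (2 * m))\<^sup>2" by (simp add: power_mult[symmetric] mult.commute)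
  ultimately have "g ^ (2 * m) = -1" using g(2) by (simp add: power2_eq_1_iff)
  hence "quartic_field (g ^ m) m"
    using assms by (unfold_locales) (simp_all add: power_add[symmetric] mult_2[symmetric])
  thus ?thesis by blast
qed

subsection \<open>Cubic character sums in characteristic three\<close>

lemma (in quartic_field) exists_not_square: "\<exists>c. c \<noteq> 0 \<and> \<psi> c * \<psi> c \<noteq> 1"
proof (rule ccontr)
  assume a: "\<not> ?thesis"
  have "UNIV - {0} \<subseteq> {x::'k. x ^ (2 * m) = 1}"
  proof
    fix x :: 'k assume "x \<in> UNIV - {0}"
    hence x: "x \<noteq> 0" by simp
    have "\<psi> x * \<psi> x = 1" using a x by blast
    hence "(x ^ m) * (x ^ m) = 1"
      by (cases rule: \<psi>_cases[OF x]) (auto simp: complex_eq_iff \<iota>_square)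
    thus "x \<in> {x. x ^ (2 * m) = 1}" by (simp add: mult_2 power_add)
  qed
  hence "card (UNIV - {0::'k}) \<le> card {x::'k. x ^ (2 * m) = 1}" by (intro card_mono) auto
  also have "\<dots> \<le> 2 * m" using m_pos by (intro card_power_eq_le) auto
  finally show False using card_field m_pos by (simp add: card_Diff_singleton)
qed

locale char3_field = quartic_field \<iota> m for \<iota> :: "'k::{field,finite}" and m +
  fixes k :: nat
  assumes card_9: "CARD('k) = 9 ^ k"
begin

lemma three: "(3::'k) = 0"
proof -
  have "CHAR('k) = 3"
    by (rule CHAR_finite_field[of 3 "2 * k"]) (simp_all add: card_9 power_mult)
  thus ?thesis using of_nat_CHAR[where 'a='k] by simp
qed

lemma char3_simps: "(2::'k) = -1" "(4::'k) = 1" "(6::'k) = 0"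
proof -
  have "(2::'k) = 3 - 1" "(4::'k) = 3 + 1" "(6::'k) = 3 * 2" by simp_all
  thus "(2::'k) = -1" "(4::'k) = 1" "(6::'k) = 0" unfolding three by simp_all
qed

lemma cube_add: "(x + y) ^ 3 = x ^ 3 + (y ^ 3 :: 'k)"
proof -
  have "(x + y) ^ 3 = x ^ 3 + y ^ 3 + 3 * (x * x * y + x * y * y)"
    by (simp add: power3_eq_cube algebra_simps)
  thus ?thesis by (simp add: three)
qed

lemma cube_minus: "(- x) ^ 3 = - (x ^ 3 :: 'k)"
  by (simp add: power3_eq_cube)

lemma bij_cube: "bij (\<lambda>x::'k. x ^ 3)"
proof -
  have "inj (\<lambda>x::'k. x ^ 3)"
  proof (rule injI)
    fix x y :: 'k assume "x ^ 3 = y ^ 3"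
    hence "(x + - y) ^ 3 = 0" by (simp only: cube_add cube_minus) simp
    thus "x = y" by simp
  qed
  thus ?thesis by (simp add: bij_def finite_UNIV_inj_surj)
qed

lemma sum_cube: "(\<Sum>x\<in>UNIV. f (x ^ 3)) = (\<Sum>x\<in>(UNIV::'k set). f x)"
  using sum.reindex_bij_betw[OF bij_cube] .

lemma k_pos: "k > 0"
  using card_9 card_field m_pos by (cases k) auto

text \<open>Since \<open>9 ^ k\<close> is 1 modulo 8, the exponent \<open>m\<close> is even.\<close>

lemma \<psi>_minus_1: "\<psi> (-1) = 1"
proof -
  have "\<exists>j. (9::nat) ^ k = 8 * j + 1" for k
  proof (induction k)
    case (Suc k)
    then obtain j where "(9::nat) ^ k = 8 * j + 1" by blast
    thus ?case by (intro exI[of _ "9 * j + 1"]) simp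
  qed simp
  then obtain j where "(9::nat) ^ k = 8 * j + 1" by blast
  hence "m = 2 * j" using card_9 card_field by simp
  thus ?thesis by (simp add: \<psi>_unfold)
qed

lemma \<psi>_minus: "\<psi> (- x) = \<psi> x"
  using \<psi>_mult[of "-1" x] by (simp add: \<psi>_minus_1)

section \<open>The quadratic character and the number of square roots\<close>

definition \<eta> :: "'k \<Rightarrow> complex" where "\<eta> x = \<psi> x * \<psi> x"

lemma \<eta>_simps [simp]: "\<eta> 0 = 0" "\<eta> 1 = 1" "\<eta> (-1) = 1"
  by (simp_all add: \<eta>_def \<psi>_minus_1)

lemma \<eta>_mult: "\<eta> (x * y) = \<eta> x * \<eta> y"
  by (simp add: \<eta>_def \<psi>_mult mult_ac)

lemma \<eta>_minus: "\<eta> (- x) = \<eta> x"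
  by (simp add: \<eta>_def \<psi>_minus)

lemma \<eta>_cases: "x \<noteq> 0 \<Longrightarrow> \<eta> x = 1 \<or> \<eta> x = -1"
  unfolding \<eta>_def by (erule \<psi>_cases) auto

lemma \<eta>_square: "x \<noteq> 0 \<Longrightarrow> \<eta> (x * x) = 1"
  using \<eta>_cases[of x] by (auto simp: \<eta>_mult)

lemma \<eta>_cnj: "cnj (\<eta> x) = \<eta> x"
  using \<eta>_cases[of x] by (cases "x = 0") auto

lemma \<eta>_inverse: "\<eta> (inverse x) = \<eta> x"
  by (simp add: \<eta>_def \<psi>_inverse flip: complex_cnj_mult) (simp add: \<eta>_cnj flip: \<eta>_def)

lemma \<eta>_cube: "\<eta> (x ^ 3) = \<eta> x"
  using \<eta>_cases[of x] by (cases "x = 0") (auto simp: power3_eq_cube \<eta>_mult)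

lemma sum_\<eta>: "(\<Sum>x\<in>UNIV. \<eta> x) = 0"
proof -
  obtain c where c: "c \<noteq> 0" "\<eta> c \<noteq> 1" using exists_not_square by (auto simp: \<eta>_def)
  have "(\<Sum>x\<in>UNIV. \<eta> x) = (\<Sum>x\<in>UNIV. \<eta> (c * x))"
    by (rule sum.reindex_bij_witness[of _ "\<lambda>x. c * x" "\<lambda>x. x / c"]) (use c in auto)
  also have "\<dots> = \<eta> c * (\<Sum>x\<in>UNIV. \<eta> x)" by (simp add: \<eta>_mult sum_distrib_left)
  finally show ?thesis using c(2) by (metis mult_cancel_right1)
qed

lemma sum_\<psi>: "(\<Sum>x\<in>UNIV. \<psi> x) = 0"
proof -
  obtain c where c: "c \<noteq> 0" "\<psi> c * \<psi> c \<noteq> 1" using exists_not_square by blast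
  hence "\<psi> c \<noteq> 1" by auto
  thus ?thesis using sum_\<psi>_eq_0[OF c(1), of UNIV] by simp
qed

lemma square_roots: "{z. z * z = y * y} = {y, - (y::'k)}"
  by (auto simp: square_eq_iff)

lemma neq_minus: "y \<noteq> 0 \<Longrightarrow> y \<noteq> - (y::'k)"
proof
  assume "y \<noteq> 0" "y = - y"
  hence "2 * y = 0" by (metis add.right_inverse mult_2)
  thus False using \<open>y \<noteq> 0\<close> two_nonzero by simp
qed

text \<open>The difference of the two sides is zero at squares and nonnegative at nonsquares, where
  the count is 0. Its total is 0, because \<open>\<eta>\<close> sums to 0 and every \<open>z\<close>
  is a square root of exactly one \<open>y\<close>; hence it vanishes everywhere.\<close>

lemma card_square_roots: "of_nat (card {z. z * z = y}) = 1 + \<eta> y"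
proof -
  let ?r = "\<lambda>y::'k. real (card {z. z * z = y})"
  have le: "0 \<le> 1 + Re (\<eta> y) - ?r y \<and> (\<forall>x. y = x * x \<longrightarrow> 1 + Re (\<eta> y) - ?r y = 0)" for y
  proof (cases "\<exists>x. y = x * x")
    case True
    then obtain x where x: "y = x * x" by blast
    have "1 + Re (\<eta> y) - ?r y = 0"
      using neq_minus[of x] \<eta>_square[of x] unfolding x square_roots by (cases "x = 0") auto
    thus ?thesis by (metis order_refl)
  next
    case False
    hence "{z. z * z = y} = {}" by auto
    thus ?thesis using False \<eta>_cases[of y] by (cases "y = 0") auto
  qed
  have "(\<Sum>y\<in>UNIV. ?r y) = real (\<Sum>y\<in>(UNIV::'k set). card {z. z * z = y})" by simp
  also have "(\<Sum>y\<in>(UNIV::'k set). card {z. z * z = y}) = card (\<Union>y\<in>UNIV. {z::'k. z * z = y})"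
    by (rule card_UN_disjoint[symmetric]) auto
  also have "(\<Union>y\<in>UNIV. {z::'k. z * z = y}) = UNIV" by auto
  finally have "(\<Sum>y\<in>UNIV. 1 + Re (\<eta> y) - ?r y) = Re (\<Sum>y\<in>UNIV. \<eta> y)"
    by (simp add: sum.distrib sum_subtractf)
  hence "(\<Sum>y\<in>UNIV. 1 + Re (\<eta> y) - ?r y) = 0" by (simp only: sum_\<eta>) simp
  hence "1 + Re (\<eta> y) - ?r y = 0" using le by (subst (asm) sum_nonneg_eq_0_iff) auto
  moreover have "Im (\<eta> y) = 0" using \<eta>_cases[of y] by (cases "y = 0") auto
  ultimately show ?thesis by (simp add: complex_eq_iff)
qed

lemma sum_by_square:
  fixes f :: "'k \<Rightarrow> complex"
  shows "(\<Sum>z\<in>UNIV. f z * h (z * z)) = (\<Sum>y\<in>UNIV. (\<Sum>z | z * z = y. f z) * (h y :: complex))"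
proof -
  have "(\<Sum>y\<in>UNIV. (\<Sum>z | z * z = y. f z) * h y) = (\<Sum>y\<in>UNIV. \<Sum>z | z \<in> UNIV \<and> z * z = y. f z * h (z * z))"
    unfolding sum_distrib_right by (intro sum.cong) auto
  also have "\<dots> = (\<Sum>z\<in>UNIV. f z * h (z * z))"
    by (rule sum.group) auto
  finally show ?thesis by simp
qed

lemma sum_square: "(\<Sum>z\<in>UNIV. h (z * z)) = (\<Sum>y\<in>UNIV. (h y :: complex)) + (\<Sum>y\<in>UNIV. \<eta> y * h y)"
  using sum_by_square[of "\<lambda>_. 1" h] by (simp add: card_square_roots distrib_right sum.distrib)

lemma nonsquare_\<eta>:
  assumes "\<nexists>z. z * z = y"
  shows "\<eta> y = -1"
proof -
  have "{z. z * z = y} = {}" using assms by auto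
  thus ?thesis using card_square_roots[of y] by (simp add: eq_neg_iff_add_eq_0 add.commute)
qed

subsection \<open>Additive characters and Gauss sums in characteristic three\<close>

text \<open>The trace to the prime field with three elements; \<open>2 * k\<close> is the degree
  over it.\<close>

definition abs_tr :: "'k \<Rightarrow> 'k" where
  "abs_tr x = (\<Sum>j<2*k. x ^ (3 ^ j))"

lemma power_3_add: "(x + y) ^ (3 ^ j) = x ^ (3 ^ j) + (y ^ (3 ^ j) :: 'k)"
  by (induction j) (simp_all only: power_Suc2 power_mult cube_add power_0 power_one_right)

lemma abs_tr_add: "abs_tr (x + y) = abs_tr x + abs_tr y"
  by (simp add: abs_tr_def power_3_add sum.distrib)

lemma cube_sum: "finite A \<Longrightarrow> (\<Sum>i\<in>A. f i) ^ 3 = (\<Sum>i\<in>A. (f i ^ 3 :: 'k))"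
  by (induction A rule: finite_induct) (auto simp: cube_add)

text \<open>Cubing shifts the summands cyclically, since
  \<open>x ^ (3 ^ (2 * k)) = x\<close>.\<close>

lemma abs_tr_cube: "abs_tr (x ^ 3) = abs_tr x" and abs_tr_cube': "abs_tr x ^ 3 = abs_tr x"
proof -
  have "x ^ (3 ^ (2 * k)) = x" using finite_field_power_card[of x] card_9 by (simp add: power_mult)
  have "(\<Sum>j<2*k. x ^ (3 ^ Suc j)) + x ^ (3 ^ 0) = (\<Sum>j<Suc (2*k). x ^ (3 ^ j))"
    by (subst sum.lessThan_Suc_shift) simp
  also have "\<dots> = abs_tr x + x" by (simp add: abs_tr_def \<open>x ^ (3 ^ (2 * k)) = x\<close>)
  finally have *: "(\<Sum>j<2*k. x ^ (3 ^ Suc j)) = abs_tr x" by simp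
  have "abs_tr (x ^ 3) = (\<Sum>j<2*k. x ^ (3 ^ Suc j))" by (simp add: abs_tr_def power_mult)
  thus "abs_tr (x ^ 3) = abs_tr x" by (simp only: *)
  have "abs_tr x ^ 3 = (\<Sum>j<2*k. (x ^ (3 ^ j)) ^ 3)" by (simp add: abs_tr_def cube_sum)
  also have "\<dots> = (\<Sum>j<2*k. x ^ (3 ^ Suc j))" by (simp add: power_mult[symmetric] mult.commute)
  finally show "abs_tr x ^ 3 = abs_tr x" by (simp only: *)
qed

lemma abs_tr_cases: "abs_tr x = 0 \<or> abs_tr x = 1 \<or> abs_tr x = -1"
proof -
  have "abs_tr x * (abs_tr x - 1) * (abs_tr x + 1) = abs_tr x ^ 3 - abs_tr x"
    by (simp add: power3_eq_cube algebra_simps)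
  thus ?thesis using abs_tr_cube'[of x] by (auto simp: eq_neg_iff_add_eq_0)
qed

definition \<omega> :: complex where "\<omega> = Complex (-1/2) (sqrt 3 / 2)"

lemma \<omega>_simps: "\<omega> * \<omega> = cnj \<omega>" "cnj \<omega> * cnj \<omega> = \<omega>" "\<omega> * cnj \<omega> = 1" "cnj \<omega> * \<omega> = 1"
  "\<omega> \<noteq> 1" "cnj \<omega> \<noteq> 1" "\<omega> + cnj \<omega> = -1"
  by (simp_all add: \<omega>_def complex_eq_iff)

text \<open>The canonical additive character, \<open>\<omega>\<close> to the power of the trace; the
  trace lives in \<open>'k\<close>, so its three possible values are listed.\<close>

definition e :: "'k \<Rightarrow> complex" where
  "e x = (if abs_tr x = 0 then 1 else if abs_tr x = 1 then \<omega> else cnj \<omega>)"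

lemma e_add: "e (x + y) = e x * e y"
proof -
  have "(1::'k) + 1 = -1" "-1 + -1 = (1::'k)" using char3_simps by (simp_all add: minus_equation_iff)
  thus ?thesis
    using abs_tr_cases[of x] abs_tr_cases[of y] one_neq_minus_one \<omega>_simps
    by (auto simp: e_def abs_tr_add)
qed

lemma e_0 [simp]: "e 0 = 1"
proof -
  have "abs_tr 0 = 0"
    using abs_tr_add[of 0 0] by (simp only: add_0 add_cancel_right_right simp_thms)
  thus ?thesis by (simp add: e_def)
qed

lemma e_cnj: "e x * cnj (e x) = 1"
  by (auto simp: e_def \<omega>_simps)

lemma e_minus: "e (- x) = cnj (e x)"
proof -
  have "e (- x) * e x = cnj (e x) * e x" using e_add[of "- x" x] e_cnj[of x] by (simp add: mult.commute)
  moreover have "e x \<noteq> 0" using e_cnj[of x] by auto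
  ultimately show ?thesis by simp
qed

lemma e_diff: "e (x - y) = e x * cnj (e y)"
  using e_add[of x "- y"] by (simp add: e_minus)

lemma e_cube: "e (x ^ 3) = e x"
  by (simp add: e_def abs_tr_cube)

lemma e_plus_cnj: "e x + cnj (e x) = 2 \<or> e x + cnj (e x) = -1"
  using \<omega>_simps by (auto simp: e_def add.commute)

text \<open>The trace is a nonzero polynomial function of degree below the size of the
  field.\<close>

lemma e_nontrivial: "\<exists>x. e x \<noteq> 1"
proof -
  let ?P = "(\<Sum>j<2*k. monom 1 (3 ^ j)) :: 'k poly"
  have deg: "degree ?P \<le> 3 ^ (2 * k - 1)"
    by (intro degree_sum_le) (auto intro!: order.trans[OF degree_monom_le] power_increasing)
  have "coeff ?P 1 = (\<Sum>j<2*k. if j = 0 then 1 else 0)"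
    unfolding coeff_sum by (intro sum.cong refl) simp
  hence "coeff ?P 1 = 1" using k_pos by simp
  hence "?P \<noteq> 0" by (metis coeff_0 zero_neq_one)
  hence "card {x. poly ?P x = 0} \<le> 3 ^ (2 * k - 1)"
    using deg card_poly_roots_bound[of ?P] by linarith
  moreover have "(3::nat) ^ (2 * k - 1) < 3 ^ (2 * k)" using k_pos by (intro power_strict_increasing) auto
  moreover have "CARD('k) = 3 ^ (2 * k)" by (simp add: card_9 power_mult)
  moreover have "poly ?P x = abs_tr x" for x by (simp add: abs_tr_def poly_sum poly_monom)
  ultimately have "card {x. abs_tr x = 0} < CARD('k)" by (simp only:)
  hence "\<exists>x. abs_tr x \<noteq> 0" by (auto intro: ccontr)
  thus ?thesis using \<omega>_simps by (auto simp: e_def)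
qed

text \<open>Orthogonality: a translation by \<open>y\<close> multiplies the sum by
  \<open>e (h y)\<close>.\<close>

lemma sum_e_additive:
  assumes "\<And>x y. h (x + y) = h x + h (y::'k)"
  shows "(\<Sum>x\<in>UNIV. e (h x)) = (if \<forall>x. e (h x) = 1 then of_nat (9 ^ k) else 0)"
proof (cases "\<forall>x. e (h x) = 1")
  case True
  thus ?thesis using card_9 by simp
next
  case False
  then obtain y where y: "e (h y) \<noteq> 1" by blast
  have "(\<Sum>x\<in>UNIV. e (h x)) = (\<Sum>x\<in>UNIV. e (h (x + y)))"
    by (rule sum.reindex_bij_witness[of _ "\<lambda>x. x + y" "\<lambda>x. x - y"]) auto
  also have "\<dots> = (\<Sum>x\<in>UNIV. e (h x)) * e (h y)" by (simp add: assms e_add sum_distrib_right)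
  finally show ?thesis using y False by auto
qed

lemma sum_e_linear: "(\<Sum>x\<in>UNIV. e (a * x)) = (if a = 0 then of_nat (9 ^ k) else 0)"
proof -
  have "(\<forall>x. e (a * x) = 1) \<longleftrightarrow> a = 0"
  proof
    assume *: "\<forall>x. e (a * x) = 1"
    show "a = 0"
    proof (rule ccontr)
      assume "a \<noteq> 0"
      obtain y where "e y \<noteq> 1" using e_nontrivial by blast
      moreover have "e (a * (y / a)) = 1" using * by blast
      ultimately show False using \<open>a \<noteq> 0\<close> by simp
    qed
  qed simp
  thus ?thesis using sum_e_additive[of "\<lambda>x. a * x"] by (simp add: distrib_left)
qed

definition G :: "('k \<Rightarrow> complex) \<Rightarrow> complex" where
  "G f = (\<Sum>x\<in>UNIV. f x * e x)"

text \<open>For nonzero \<open>a\<close> this is the substitution of \<open>a * x\<close> for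
  \<open>x\<close>; for \<open>a = 0\<close> it is the vanishing of the sum of \<open>f\<close>. The
  hypotheses describe a nontrivial multiplicative character, so that both \<open>\<psi>\<close> and
  \<open>\<eta>\<close> are covered.\<close>

lemma gauss_sum_twist:
  assumes "\<And>x y. f (x * y) = f x * f y" "\<And>x. x \<noteq> 0 \<Longrightarrow> f x * cnj (f x) = 1" "f 0 = 0" "(\<Sum>x\<in>UNIV. f x) = 0"
  shows "(\<Sum>x\<in>UNIV. f x * e (a * x)) = cnj (f a) * G f"
proof (cases "a = 0")
  case True
  thus ?thesis by (simp add: assms)
next
  case False
  have "(\<Sum>x\<in>UNIV. f x * e (a * x)) = (f a * cnj (f a)) * (\<Sum>x\<in>UNIV. f x * e (a * x))"
    using assms(2)[OF False] by simp
  also have "\<dots> = cnj (f a) * (\<Sum>x\<in>UNIV. f (a * x) * e (a * x))"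
    by (simp add: assms(1) sum_distrib_left mult_ac)
  also have "(\<Sum>x\<in>UNIV. f (a * x) * e (a * x)) = G f"
    unfolding G_def
    by (rule sum.reindex_bij_witness[of _ "\<lambda>x. x / a" "\<lambda>x. a * x"]) (use False in auto)
  finally show ?thesis .
qed

text \<open>The squared moduli of all twists by \<open>a\<close> are added up in two ways: by the
  twisting formula, and by orthogonality of the additive characters.\<close>

lemma gauss_sum_norm:
  assumes "\<And>x y. f (x * y) = f x * f y" "\<And>x. x \<noteq> 0 \<Longrightarrow> f x * cnj (f x) = 1" "f 0 = 0" "(\<Sum>x\<in>UNIV. f x) = 0"
  shows "G f * cnj (G f) = of_nat (9 ^ k)"
proof -
  have tw: "(\<Sum>x\<in>UNIV. f x * e (a * x)) = cnj (f a) * G f" for a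
    by (rule gauss_sum_twist[OF assms])
  have one: "(\<Sum>x\<in>UNIV. f x * cnj (f x)) = of_nat (9 ^ k - 1)"
  proof -
    have "(\<Sum>x\<in>UNIV. f x * cnj (f x)) = (\<Sum>x\<in>UNIV-{0::'k}. 1)"
      by (rule sum.mono_neutral_cong_right) (auto simp: assms)
    thus ?thesis by (simp add: card_Diff_singleton card_9)
  qed
  have "(\<Sum>a\<in>UNIV. (cnj (f a) * G f) * cnj (cnj (f a) * G f)) = (\<Sum>a\<in>UNIV. f a * cnj (f a)) * (G f * cnj (G f))"
    unfolding sum_distrib_right by (intro sum.cong refl) (simp add: mult_ac)
  hence "of_nat (9 ^ k - 1) * (G f * cnj (G f)) = (\<Sum>a\<in>UNIV. (\<Sum>x\<in>UNIV. f x * e (a * x)) * cnj (\<Sum>y\<in>UNIV. f y * e (a * y)))"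
    by (simp only: tw one)
  also have "\<dots> = (\<Sum>a\<in>UNIV. \<Sum>x\<in>UNIV. \<Sum>y\<in>UNIV. f x * cnj (f y) * e ((x - y) * a))"
    by (simp add: sum_product left_diff_distrib right_diff_distrib e_diff mult_ac)
  also have "\<dots> = (\<Sum>x\<in>UNIV. \<Sum>a\<in>UNIV. \<Sum>y\<in>UNIV. f x * cnj (f y) * e ((x - y) * a))"
    by (rule sum.swap)
  also have "\<dots> = (\<Sum>x\<in>UNIV. \<Sum>y\<in>UNIV. \<Sum>a\<in>UNIV. f x * cnj (f y) * e ((x - y) * a))"
    by (intro sum.cong refl sum.swap)
  also have "\<dots> = (\<Sum>x\<in>UNIV. \<Sum>y\<in>UNIV. if y = x then f x * cnj (f x) * of_nat (9 ^ k) else 0)"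
    by (intro sum.cong refl) (simp add: sum_distrib_left[symmetric] sum_e_linear)
  also have "\<dots> = (\<Sum>x\<in>UNIV. f x * cnj (f x)) * of_nat (9 ^ k)" by (simp add: sum_distrib_right)
  finally have "of_nat (9 ^ k - 1) * (G f * cnj (G f)) = of_nat (9 ^ k - 1) * of_nat (9 ^ k)"
    by (simp only: one)
  moreover have "(of_nat (9 ^ k - 1) :: complex) \<noteq> 0"
    using k_pos one_less_power[of "9::nat" k] by (simp only: of_nat_eq_0_iff) simp
  ultimately show ?thesis by (simp only: mult_cancel_left) simp
qed

text \<open>The Gauss sum is real because \<open>x \<mapsto> x ^ 3\<close> conjugates the character and preserves \<open>e\<close>.\<close>

lemma gauss_sum_pure:
  assumes "\<And>x y. f (x * y) = f x * f y" "\<And>x. x \<noteq> 0 \<Longrightarrow> f x * cnj (f x) = 1" "f 0 = 0" "(\<Sum>x\<in>UNIV. f x) = 0"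
    and "\<And>x. f (- x) = f x" "\<And>x. f (x ^ 3) = cnj (f x)"
  shows "\<exists>\<epsilon>\<in>{1, -1}. G f = \<epsilon> * 3 ^ k"
proof -
  have "cnj (G f) = (\<Sum>x\<in>UNIV. cnj (f x) * e (- x))" by (simp add: G_def e_minus)
  also have "\<dots> = (\<Sum>x\<in>UNIV. cnj (f x) * e x)"
    by (rule sum.reindex_bij_witness[of _ uminus uminus]) (auto simp: assms(5))
  also have "\<dots> = (\<Sum>x\<in>UNIV. f (x ^ 3) * e (x ^ 3))" by (simp add: assms(6) e_cube)
  also have "\<dots> = G f" unfolding G_def by (rule sum_cube)
  finally have "G f * G f = of_nat (9 ^ k)" using gauss_sum_norm[of f, OF assms(1-4)] by simp
  also have "\<dots> = 3 ^ k * 3 ^ k" by (simp add: power_mult_distrib[symmetric])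
  finally have "G f = 3 ^ k \<or> G f = - (3 ^ k)" by (simp only: square_eq_iff)
  thus ?thesis by auto
qed

lemma gauss_sum_\<psi>: "\<exists>\<epsilon>\<in>{1, -1}. G \<psi> = \<epsilon> * 3 ^ k"
  by (rule gauss_sum_pure) (auto simp: \<psi>_mult \<psi>_cnj sum_\<psi> \<psi>_minus \<psi>_power \<psi>_cube)

lemma \<eta>_cnj1: "x \<noteq> 0 \<Longrightarrow> \<eta> x * cnj (\<eta> x) = 1"
  using \<eta>_cases[of x] by auto

lemma \<eta>_idem: "x \<noteq> 0 \<Longrightarrow> \<eta> x * \<eta> x = 1"
  using \<eta>_cases[of x] by auto

lemma gauss_sum_\<eta>: "\<exists>\<epsilon>\<in>{1, -1}. G \<eta> = \<epsilon> * 3 ^ k"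
  by (rule gauss_sum_pure) (auto simp: \<eta>_mult \<eta>_idem sum_\<eta> \<eta>_minus \<eta>_cube \<eta>_cnj)

text \<open>Fourier expansion of \<open>\<psi>\<close>, reindexed along the bijection
  \<open>x \<mapsto> x ^ 3\<close>. The cube in the exponent later allows
  \<open>e ((x * t) ^ 3)\<close> to be replaced by \<open>e (x * t)\<close>.\<close>

lemma \<psi>_expand: "\<psi> a * G \<psi> = (\<Sum>x\<in>UNIV. \<psi> x * e (a * x ^ 3))"
proof -
  have G: "cnj (G \<psi>) = G \<psi>" using gauss_sum_\<psi> by auto
  have "\<psi> a * G \<psi> = cnj (cnj (\<psi> a) * G \<psi>)" by (simp add: G)
  also have "cnj (\<psi> a) * G \<psi> = (\<Sum>x\<in>UNIV. \<psi> x * e (a * x))"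
    by (rule gauss_sum_twist[symmetric]) (auto simp: \<psi>_mult \<psi>_cnj sum_\<psi>)
  also have "cnj \<dots> = (\<Sum>x\<in>UNIV. cnj (\<psi> x) * e (a * (- x)))" by (simp add: e_minus)
  also have "\<dots> = (\<Sum>x\<in>UNIV. cnj (\<psi> x) * e (a * x))"
    by (rule sum.reindex_bij_witness[of _ uminus uminus]) (auto simp: \<psi>_minus)
  also have "\<dots> = (\<Sum>x\<in>UNIV. cnj (\<psi> (x ^ 3)) * e (a * x ^ 3))" by (rule sum_cube[symmetric])
  finally show ?thesis by (simp add: \<psi>_power \<psi>_cube)
qed

lemma sum_e_square:
  assumes "d \<noteq> 0"
  shows "(\<Sum>t\<in>UNIV. e (d * (t * t))) = \<eta> d * G \<eta>"
proof -
  have "(\<Sum>t\<in>UNIV. e (d * (t * t))) = (\<Sum>y\<in>UNIV. e (d * y)) + (\<Sum>y\<in>UNIV. \<eta> y * e (d * y))"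
    by (rule sum_square)
  also have "(\<Sum>y\<in>UNIV. \<eta> y * e (d * y)) = cnj (\<eta> d) * G \<eta>"
    by (rule gauss_sum_twist) (auto simp: \<eta>_mult \<eta>_cnj1 sum_\<eta>)
  finally show ?thesis using assms by (simp add: sum_e_linear \<eta>_cnj)
qed

end

text \<open>Completing the square shows that the square of \<open>s\<close> divides that of
  \<open>2 * x + c * s\<close>.\<close>

lemma power_dvd_of_quadratic:
  fixes x s c d :: int
  assumes "x\<^sup>2 + c * s * x = s\<^sup>2 * d" "odd s"
  shows "s dvd x"
proof -
  have "(2 * x + c * s)\<^sup>2 = 4 * (x\<^sup>2 + c * s * x) + s\<^sup>2 * c\<^sup>2"
    by (simp add: power2_eq_square algebra_simps)
  also have "\<dots> = s\<^sup>2 * (4 * d + c\<^sup>2)" unfolding assms(1) by (simp add: algebra_simps)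
  finally have "s\<^sup>2 dvd (2 * x + c * s)\<^sup>2" by simp
  hence "s dvd 2 * x + c * s" by (simp add: pow_divides_pow_iff)
  hence "s dvd 2 * x" by (simp add: dvd_add_left_iff)
  thus ?thesis using assms(2) by (simp add: coprime_dvd_mult_right_iff)
qed

section \<open>Divisibility of cubic character sums by \<open>3 ^ k\<close>\<close>

context char3_field
begin

definition cubic_sum :: "'k \<Rightarrow> 'k \<Rightarrow> 'k \<Rightarrow> complex" where
  "cubic_sum a b c = (\<Sum>t\<in>UNIV. \<psi> (t ^ 3 + a * t * t + b * t + c))"

text \<open>The leading term contributes \<open>(x * t) ^ 3\<close>, which \<open>e\<close> does not
  distinguish from \<open>x * t\<close>. So the exponent is only quadratic in
  \<open>t\<close>.\<close>

lemma cubic_sum_expand: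
  "G \<psi> * cubic_sum a b c
     = (\<Sum>x\<in>UNIV. \<psi> x * (\<Sum>t\<in>UNIV. e (x ^ 3 * a * (t * t) + (x ^ 3 * b + x) * t + x ^ 3 * c)))"
proof -
  have e: "e ((t ^ 3 + a * t * t + b * t + c) * x ^ 3) = e (x ^ 3 * a * (t * t) + (x ^ 3 * b + x) * t + x ^ 3 * c)" for t x
  proof -
    have "e ((t ^ 3 + a * t * t + b * t + c) * x ^ 3) = e ((x * t) ^ 3) * e (x ^ 3 * a * (t * t) + x ^ 3 * b * t + x ^ 3 * c)"
      unfolding e_add[symmetric] by (rule arg_cong[of _ _ e]) (simp add: power_mult_distrib algebra_simps)
    also have "\<dots> = e (x ^ 3 * a * (t * t) + (x ^ 3 * b + x) * t + x ^ 3 * c)"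
      unfolding e_cube e_add[symmetric] by (rule arg_cong[of _ _ e]) (simp add: algebra_simps)
    finally show ?thesis .
  qed
  have "G \<psi> * cubic_sum a b c = (\<Sum>t\<in>UNIV. \<psi> (t ^ 3 + a * t * t + b * t + c) * G \<psi>)"
    by (simp add: cubic_sum_def sum_distrib_left mult.commute)
  also have "\<dots> = (\<Sum>t\<in>UNIV. \<Sum>x\<in>UNIV. \<psi> x * e (x ^ 3 * a * (t * t) + (x ^ 3 * b + x) * t + x ^ 3 * c))"
    by (simp only: \<psi>_expand e)
  also have "\<dots> = (\<Sum>x\<in>UNIV. \<Sum>t\<in>UNIV. \<psi> x * e (x ^ 3 * a * (t * t) + (x ^ 3 * b + x) * t + x ^ 3 * c))"
    by (rule sum.swap)
  finally show ?thesis by (simp only: sum_distrib_left)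
qed

text \<open>For \<open>a = 0\<close> the exponent is affine in \<open>t\<close>, so only the roots
  of \<open>x ^ 3 * b + x\<close> survive, each with weight \<open>9 ^ k\<close>; the Gauss sum
  cancels one factor \<open>3 ^ k\<close>. The nonzero roots come as a pair \<open>y\<close>,
  \<open>- y\<close>, whose \<open>e\<close>-values are conjugate and add up to an integer.\<close>

lemma cubic_sum_divisible_linear: "\<exists>z. gauss_int z \<and> cubic_sum 0 b c = 3 ^ k * z"
proof -
  define Z where "Z = {x. x ^ 3 * b + x = 0}"
  define X where "X = (\<Sum>x\<in>Z. \<psi> x * e (x ^ 3 * c))"
  have "G \<psi> * cubic_sum 0 b c = (\<Sum>x\<in>UNIV. \<psi> x * ((\<Sum>t\<in>UNIV. e ((x ^ 3 * b + x) * t)) * e (x ^ 3 * c)))"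
    by (simp add: cubic_sum_expand e_add sum_distrib_right)
  also have "\<dots> = (\<Sum>x\<in>UNIV. if x \<in> Z then of_nat (9 ^ k) * (\<psi> x * e (x ^ 3 * c)) else 0)"
    by (intro sum.cong refl) (simp add: sum_e_linear Z_def)
  also have "\<dots> = 9 ^ k * X" by (simp add: sum.If_cases X_def sum_distrib_left)
  also have "(9::complex) ^ k = 3 ^ k * 3 ^ k" by (simp add: power_mult_distrib[symmetric])
  finally have GX: "G \<psi> * cubic_sum 0 b c = 3 ^ k * 3 ^ k * X" .
  obtain \<epsilon> where \<epsilon>: "\<epsilon> \<in> {1, -1}" "G \<psi> = \<epsilon> * 3 ^ k" using gauss_sum_\<psi> by blast
  have "cubic_sum 0 b c = 3 ^ k * (\<epsilon> * X)" using GX \<epsilon> by (auto simp: minus_equation_iff[of "cubic_sum 0 b c"])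
  moreover have "gauss_int X"
  proof (cases "\<exists>y. y \<noteq> 0 \<and> y \<in> Z")
    case False
    have "X = 0" unfolding X_def using False by (intro sum.neutral ballI) (metis \<psi>_0 mult_zero_left)
    thus ?thesis by simp
  next
    case True
    then obtain y where y: "y \<noteq> 0" "y ^ 3 * b + y = 0" by (auto simp: Z_def)
    hence "y * (y * y * b + 1) = 0" by (simp add: power3_eq_cube algebra_simps)
    hence yb: "y * y * b = -1" using y(1) by (simp add: eq_neg_iff_add_eq_0)
    hence b: "b \<noteq> 0" by auto
    have "Z = {0, y, - y}"
    proof -
      have "x \<in> Z \<longleftrightarrow> x = 0 \<or> x = y \<or> x = - y" for x
      proof -
        have "x ^ 3 * b + x = x * (b * (x * x - y * y))" using yb by (simp add: power3_eq_cube algebra_simps)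
        thus ?thesis using b by (auto simp: Z_def square_eq_iff)
      qed
      thus ?thesis by auto
    qed
    hence "X = \<psi> y * e (y ^ 3 * c) + \<psi> (- y) * e ((- y) ^ 3 * c)"
      using y(1) neq_minus[OF y(1)] by (simp add: X_def)
    also have "\<dots> = \<psi> y * (e (y ^ 3 * c) + cnj (e (y ^ 3 * c)))"
      by (simp add: \<psi>_minus cube_minus e_minus algebra_simps)
    finally have X: "X = \<psi> y * (e (y ^ 3 * c) + cnj (e (y ^ 3 * c)))" .
    have "gauss_int (e (y ^ 3 * c) + cnj (e (y ^ 3 * c)))"
      using e_plus_cnj[of "y ^ 3 * c"] gauss_int_basic(4)[of 2] gauss_int_basic(4)[of "-1"] by auto
    thus ?thesis unfolding X by (rule gauss_int_ops(3)[OF gauss_int_\<psi>])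
  qed
  moreover have "gauss_int \<epsilon>" using \<epsilon> by auto
  ultimately show ?thesis using gauss_int_ops(3)[of \<epsilon> X] by blast
qed

text \<open>Completing the square, where \<open>2 = -1\<close> turns the usual shift
  \<open>f / (2 * d)\<close> into \<open>- f / d\<close>.\<close>

lemma sum_e_quadratic:
  assumes "d \<noteq> 0"
  shows "(\<Sum>t\<in>UNIV. e (d * (t * t) + f * t + g)) = \<eta> d * G \<eta> * e (g - f * f / d)"
proof -
  have "(\<Sum>t\<in>UNIV. e (d * (t * t) + f * t + g)) = (\<Sum>t\<in>UNIV. e (d * (t * t)) * e (g - f * f / d))"
  proof (rule sum.reindex_bij_witness[of _ "\<lambda>t. t + f / d" "\<lambda>t. t - f / d"])
    fix t
    have "d * ((t - f / d) * (t - f / d)) + (g - f * f / d) = d * (t * t) - 2 * f * t + g"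
      using assms by (simp add: field_simps)
    also have "\<dots> = d * (t * t) + f * t + g" by (simp add: char3_simps)
    finally show "e (d * ((t - f / d) * (t - f / d))) * e (g - f * f / d) = e (d * (t * t) + f * t + g)"
      by (simp only: e_add[symmetric])
  qed auto
  thus ?thesis using assms by (simp add: sum_distrib_right[symmetric] sum_e_square)
qed

text \<open>A Kloosterman sum twisted by the quartic character; the term with
  \<open>inverse 0 = 0\<close> drops out because \<open>\<psi> 0 = 0\<close>.\<close>

definition kloosterman :: "'k \<Rightarrow> 'k \<Rightarrow> complex" where
  "kloosterman c d = (\<Sum>x\<in>UNIV. \<psi> x * e (c * x + d * inverse x))"

text \<open>Evaluating the quadratic sum over \<open>t\<close> leaves \<open>inverse (x * a)\<close>
  in the exponent. Cubing that term under \<open>e\<close> makes the summand a function of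
  \<open>x ^ 3\<close>, and cubing is a bijection.\<close>

lemma cubic_sum_kloosterman:
  assumes "a \<noteq> 0"
  shows "G \<psi> * cubic_sum a 0 c = \<eta> a * G \<eta> * kloosterman c (- inverse (a ^ 3))"
proof -
  have "G \<psi> * cubic_sum a 0 c = (\<Sum>x\<in>UNIV. \<psi> x * (\<Sum>t\<in>UNIV. e (x ^ 3 * a * (t * t) + x * t + x ^ 3 * c)))"
    by (simp add: cubic_sum_expand)
  also have "\<dots> = (\<Sum>x\<in>UNIV. \<eta> a * G \<eta> * (\<psi> (x ^ 3) * e (c * x ^ 3 + (- inverse (a ^ 3)) * inverse (x ^ 3))))"
  proof (intro sum.cong refl)
    fix x
    show "\<psi> x * (\<Sum>t\<in>UNIV. e (x ^ 3 * a * (t * t) + x * t + x ^ 3 * c))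
       = \<eta> a * G \<eta> * (\<psi> (x ^ 3) * e (c * x ^ 3 + (- inverse (a ^ 3)) * inverse (x ^ 3)))"
    proof (cases "x = 0")
      case False
      hence "(\<Sum>t\<in>UNIV. e (x ^ 3 * a * (t * t) + x * t + x ^ 3 * c))
         = \<eta> (x ^ 3 * a) * G \<eta> * e (x ^ 3 * c - x * x / (x ^ 3 * a))"
        using assms by (intro sum_e_quadratic) auto
      also have "x * x / (x ^ 3 * a) = inverse (x * a)"
        using False assms by (simp add: field_simps power3_eq_cube)
      also have "e (x ^ 3 * c - inverse (x * a)) = e (c * x ^ 3 + (- inverse (a ^ 3)) * inverse (x ^ 3))"
        using e_cube[of "inverse (x * a)"]
        by (simp add: e_add e_minus e_diff power_inverse power_mult_distrib mult_ac)
      also have "\<eta> (x ^ 3 * a) = \<eta> x * \<eta> a" by (simp add: \<eta>_mult \<eta>_cube)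
      also have "\<psi> x * (\<eta> x * \<eta> a * G \<eta> * e (c * x ^ 3 + (- inverse (a ^ 3)) * inverse (x ^ 3)))
        = \<eta> a * G \<eta> * ((\<psi> x * \<eta> x) * e (c * x ^ 3 + (- inverse (a ^ 3)) * inverse (x ^ 3)))"
        by (simp add: mult_ac)
      also have "\<psi> x * \<eta> x = \<psi> (x ^ 3)" by (simp only: \<eta>_def \<psi>_power) (simp add: power3_eq_cube)
      finally show ?thesis .
    qed simp
  qed
  also have "\<dots> = \<eta> a * G \<eta> * (\<Sum>x\<in>UNIV. \<psi> (x ^ 3) * e (c * x ^ 3 + (- inverse (a ^ 3)) * inverse (x ^ 3)))"
    by (simp add: sum_distrib_left)
  also have "(\<Sum>x\<in>UNIV. \<psi> (x ^ 3) * e (c * x ^ 3 + (- inverse (a ^ 3)) * inverse (x ^ 3))) = kloosterman c (- inverse (a ^ 3))"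
    unfolding kloosterman_def by (rule sum_cube)
  finally show ?thesis .
qed

text \<open>The substitution of \<open>y * x\<close> for \<open>x\<close> equalizes the two
  coefficients.\<close>

lemma kloosterman_scale:
  assumes "y \<noteq> 0" "d = c * (y * y)"
  shows "kloosterman c d = \<psi> y * kloosterman (c * y) (c * y)"
proof -
  have "kloosterman c d = (\<Sum>x\<in>UNIV. \<psi> (y * x) * e (c * (y * x) + d * inverse (y * x)))"
    unfolding kloosterman_def
    by (rule sum.reindex_bij_witness[of _ "\<lambda>x. y * x" "\<lambda>x. x / y"]) (use assms in auto)
  also have "\<dots> = (\<Sum>x\<in>UNIV. \<psi> y * (\<psi> x * e (c * y * x + c * y * inverse x)))"
    using assms by (intro sum.cong refl) (simp add: \<psi>_mult mult_ac)
  finally show ?thesis by (simp add: kloosterman_def sum_distrib_left)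
qed

text \<open>Inverting \<open>x\<close> conjugates \<open>\<psi>\<close> and keeps
  \<open>x + inverse x\<close>; negating \<open>x\<close> keeps \<open>\<psi>\<close> and conjugates
  \<open>e\<close>.\<close>

lemma kloosterman_real: "cnj (kloosterman n n) = kloosterman n n"
  and kloosterman_cnj: "kloosterman n n = (\<Sum>x\<in>UNIV. cnj (\<psi> x) * e (n * (x + inverse x)))"
proof -
  show 1: "kloosterman n n = (\<Sum>x\<in>UNIV. cnj (\<psi> x) * e (n * (x + inverse x)))"
    unfolding kloosterman_def
    by (rule sum.reindex_bij_witness[of _ inverse inverse]) (auto simp: \<psi>_inverse algebra_simps)
  have "cnj (kloosterman n n) = (\<Sum>x\<in>UNIV. cnj (\<psi> x) * e (n * (- x + inverse (- x))))"
    by (simp add: kloosterman_def e_minus[symmetric] algebra_simps)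
  also have "\<dots> = (\<Sum>x\<in>UNIV. cnj (\<psi> x) * e (n * (x + inverse x)))"
    by (rule sum.reindex_bij_witness[of _ uminus uminus]) (auto simp: \<psi>_minus)
  finally show "cnj (kloosterman n n) = kloosterman n n" using 1 by simp
qed

text \<open>At a nonzero square \<open>z * z\<close> both sides are \<open>2 * \<eta> z\<close>; at
  a nonsquare \<open>\<psi>\<close> is purely imaginary.\<close>

lemma \<psi>_plus_cnj: "\<psi> x + cnj (\<psi> x) = (\<Sum>z | z * z = x. \<eta> z)"
proof (cases "x = 0")
  case False
  show ?thesis
  proof (cases "\<exists>z. z * z = x")
    case True
    then obtain z where z: "x = z * z" by blast
    with False have z0: "z \<noteq> 0" by auto
    have "(\<Sum>z | z * z = x. \<eta> z) = \<eta> z + \<eta> (- z)"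
      unfolding z square_roots using neq_minus[OF z0] by simp
    moreover have "\<psi> x = \<eta> z" by (simp add: z \<psi>_mult \<eta>_def)
    ultimately show ?thesis by (simp add: \<eta>_cnj \<eta>_minus)
  next
    case nosq: False
    hence "{z. z * z = x} = {}" by auto
    moreover have "\<psi> x * \<psi> x = -1" using nonsquare_\<eta>[of x] nosq by (auto simp: \<eta>_def)
    hence "\<psi> x + cnj (\<psi> x) = 0" by (cases rule: \<psi>_cases[OF False]) (auto simp: complex_eq_iff)
    ultimately show ?thesis by simp
  qed
next
  case True
  have "(\<Sum>z | z * z = x. \<eta> z) = 0" using True by (intro sum.neutral) auto
  thus ?thesis using True by simp
qed

text \<open>Because \<open>2 = -1\<close>, a solution \<open>y\<close> makes \<open>x + 1\<close>
  and \<open>x - 1\<close> equal to the squares of \<open>y - 1\<close> and \<open>y + 1\<close>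
  divided by \<open>y\<close>. Without a solution the discriminant \<open>(x + 1) * (x - 1)\<close>
  is not a square, so the two terms on the right cancel.\<close>

lemma sum_\<eta>_trace:
  "(\<Sum>y | y \<noteq> 0 \<and> y + inverse y = x. \<eta> y) = \<eta> (x + 1) + \<eta> (x - 1)"
proof -
  let ?W = "{y. y \<noteq> 0 \<and> y + inverse y = x}"
  show ?thesis
  proof (cases "?W = {}")
    case True
    have "\<nexists>z. z * z = (x + 1) * (x - 1)"
    proof
      assume "\<exists>z. z * z = (x + 1) * (x - 1)"
      then obtain z where "z * z = (x + 1) * (x - 1)" by blast
      \<comment> \<open>These are the roots of \<open>Y * Y - x * Y + 1\<close> given by the
        quadratic formula with \<open>2 = -1\<close>.\<close>
      hence "(- (x + z)) * (- (x - z)) = 1" by (simp add: algebra_simps)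
      moreover from this have "inverse (- (x + z)) = - (x - z)" by (intro inverse_unique)
      moreover have "- (x + z) + - (x - z) = - 2 * x" by (simp add: algebra_simps)
      ultimately have "- (x + z) \<noteq> 0" "- (x + z) + inverse (- (x + z)) = x" by (auto simp: char3_simps)
      thus False using True by blast
    qed
    hence "\<eta> ((x + 1) * (x - 1)) = -1" by (rule nonsquare_\<eta>)
    hence "\<eta> (x + 1) * \<eta> (x - 1) = -1" by (simp only: \<eta>_mult)
    hence "\<eta> (x + 1) + \<eta> (x - 1) = 0"
      using \<eta>_cases[of "x + 1"] \<eta>_cases[of "x - 1"] by (cases "x + 1 = 0"; cases "x - 1 = 0") auto
    thus ?thesis unfolding True by simp
  next
    case False
    then obtain y where y: "y \<noteq> 0" "y + inverse y = x" by blast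
    have W: "?W = {y, inverse y}"
    proof -
      have "z = y \<or> z = inverse y" if "z \<noteq> 0" "z + inverse z = y + inverse y" for z
      proof -
        have "(z - y) * (z * y - 1) = z * y * (z + inverse z) - z * y * (y + inverse y)"
          using that(1) y(1) by (simp add: field_simps)
        hence "(z - y) * (z * y - 1) = 0" unfolding that(2) by simp
        hence "z = y \<or> y * z = 1" by (auto simp: mult.commute)
        thus ?thesis using inverse_unique[of y z] by auto
      qed
      thus ?thesis using y by (auto simp: add.commute)
    qed
    have 1: "x + 1 = inverse y * ((y - 1) * (y - 1))"
    proof -
      have "inverse y * ((y - 1) * (y - 1)) = y + inverse y - 2" using y(1) by (simp add: field_simps)
      thus ?thesis by (simp add: y(2) char3_simps)
    qed
    have 2: "x - 1 = inverse y * ((y + 1) * (y + 1))"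
    proof -
      have "inverse y * ((y + 1) * (y + 1)) = y + inverse y + 2" using y(1) by (simp add: field_simps)
      thus ?thesis by (simp add: y(2) char3_simps)
    qed
    have 3: "\<eta> (x + 1) = (if y = 1 then 0 else \<eta> y)" "\<eta> (x - 1) = (if y = -1 then 0 else \<eta> y)"
      unfolding 1 2 using \<eta>_square[of "y - 1"] \<eta>_square[of "y + 1"]
      by (auto simp: \<eta>_mult[of "inverse y"] \<eta>_inverse eq_neg_iff_add_eq_0)
    show ?thesis
    proof (cases "y = 1 \<or> y = -1")
      case True
      thus ?thesis unfolding W 3 using one_neq_minus_one by auto
    next
      case False
      have "y \<noteq> inverse y"
      proof
        assume "y = inverse y"
        hence "y * y = 1 * 1" using y(1) by (metis mult.right_neutral right_inverse)
        thus False using False by (simp only: square_eq_iff)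
      qed
      thus ?thesis unfolding W 3 using False by (simp add: \<eta>_inverse)
    qed
  qed
qed

text \<open>Adding the form with \<open>cnj (\<psi> x)\<close> allows a passage to square roots
  \<open>z\<close> of \<open>x\<close>. As \<open>-2 = 1\<close>, the exponent
  \<open>z * z + inverse (z * z)\<close> depends only on \<open>z + inverse z\<close>, by which the
  sum is grouped; the two resulting sums agree under \<open>x \<mapsto> - x\<close>.\<close>

lemma kloosterman_eq_quadratic:
  "kloosterman n n = (\<Sum>y\<in>UNIV. \<eta> y * e (n * ((y - 1) * (y - 1) + 1)))"
proof -
  define H where "H x = e (n * (x * x + 1))" for x
  have H_minus: "H (- x) = H x" for x by (simp add: H_def)
  have HH: "e (n * (y * y + inverse (y * y))) = H (y + inverse y)" if "y \<noteq> 0" for y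
  proof -
    have "(y + inverse y) * (y + inverse y) + 1 = y * y + inverse (y * y) + 3"
      using that by (simp add: field_simps)
    thus ?thesis by (simp add: H_def three)
  qed
  have "2 * kloosterman n n = kloosterman n n + kloosterman n n" by simp
  also have "\<dots> = (\<Sum>x\<in>UNIV. \<psi> x * e (n * (x + inverse x))) + (\<Sum>x\<in>UNIV. cnj (\<psi> x) * e (n * (x + inverse x)))"
    by (subst (2) kloosterman_cnj) (simp add: kloosterman_def distrib_left)
  also have "\<dots> = (\<Sum>x\<in>UNIV. (\<Sum>z | z * z = x. \<eta> z) * e (n * (x + inverse x)))"
    by (simp add: \<psi>_plus_cnj[symmetric] distrib_right sum.distrib)
  also have "\<dots> = (\<Sum>z\<in>UNIV. \<eta> z * e (n * (z * z + inverse (z * z))))"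
    by (rule sum_by_square[symmetric])
  also have "\<dots> = (\<Sum>z\<in>UNIV-{0}. \<eta> z * H (z + inverse z))"
    by (rule sum.mono_neutral_cong_right) (auto simp: HH[symmetric])
  also have "\<dots> = (\<Sum>x\<in>UNIV. \<Sum>z\<in>{z. z \<in> UNIV-{0} \<and> z + inverse z = x}. \<eta> z * H (z + inverse z))"
    by (rule sum.group[symmetric]) auto
  also have "\<dots> = (\<Sum>x\<in>UNIV. (\<Sum>z | z \<noteq> 0 \<and> z + inverse z = x. \<eta> z) * H x)"
    unfolding sum_distrib_right by (intro sum.cong refl) auto
  also have "\<dots> = (\<Sum>x\<in>UNIV. \<eta> (x + 1) * H x) + (\<Sum>x\<in>UNIV. \<eta> (x - 1) * H x)"
    unfolding sum_\<eta>_trace by (simp add: distrib_right sum.distrib)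
  also have "(\<Sum>x\<in>UNIV. \<eta> (x - 1) * H x) = (\<Sum>x\<in>UNIV. \<eta> (- (x + 1)) * H (- x))"
    by (rule sum.reindex_bij_witness[of _ uminus uminus]) auto
  also have "\<dots> = (\<Sum>x\<in>UNIV. \<eta> (x + 1) * H x)" by (simp only: H_minus \<eta>_minus)
  also have "(\<Sum>x\<in>UNIV. \<eta> (x + 1) * H x) = (\<Sum>y\<in>UNIV. \<eta> y * H (y - 1))"
    by (rule sum.reindex_bij_witness[of _ "\<lambda>y. y - 1" "\<lambda>x. x + 1"]) auto
  finally show ?thesis by (simp add: H_def)
qed

definition quartic_sum :: "'k \<Rightarrow> complex" where
  "quartic_sum n = (\<Sum>z\<in>UNIV. e (n * (z ^ 4 + z * z)))"

text \<open>\<open>1 + \<eta> y\<close> counts the square roots of \<open>y\<close>: adding the sum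
  without \<open>\<eta>\<close>, a quadratic Gauss sum, allows the substitution
  \<open>y = z * z\<close>.\<close>

lemma kloosterman_quartic_sum:
  assumes "n \<noteq> 0"
  shows "kloosterman n n = cnj (e n) * quartic_sum n - e n * \<eta> n * G \<eta>"
proof -
  define h where "h y = e (n * ((y - 1) * (y - 1) + 1))" for y
  have "(\<Sum>z\<in>UNIV. h (z * z)) = (\<Sum>y\<in>UNIV. h y) + kloosterman n n"
    unfolding kloosterman_eq_quadratic h_def[symmetric] by (rule sum_square)
  moreover have "(\<Sum>y\<in>UNIV. h y) = (\<Sum>y\<in>UNIV. e n * e (n * (y * y)))"
    unfolding h_def
    by (rule sum.reindex_bij_witness[of _ "\<lambda>y. y + 1" "\<lambda>y. y - 1"]) (auto simp: distrib_left e_add mult.commute)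
  moreover have "(\<Sum>y\<in>UNIV. e n * e (n * (y * y))) = e n * (\<eta> n * G \<eta>)"
    by (simp add: sum_distrib_left[symmetric] sum_e_square assms)
  moreover have "h (z * z) = cnj (e n) * e (n * (z ^ 4 + z * z))" for z
  proof -
    have "(z * z - 1) * (z * z - 1) + 1 = z ^ 4 + z * z - 1 - 3 * (z * z - 1)"
      by (simp add: power4_eq_xxxx algebra_simps)
    also have "\<dots> = - 1 + (z ^ 4 + z * z)" by (simp add: three)
    finally have "h (z * z) = e (n * (- 1 + (z ^ 4 + z * z)))" by (simp only: h_def)
    also have "\<dots> = e (- n + n * (z ^ 4 + z * z))"
      by (rule arg_cong[of _ _ e]) (simp add: algebra_simps)
    finally have "h (z * z) = e (- n + n * (z ^ 4 + z * z))" .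
    thus ?thesis by (simp only: e_add e_minus)
  qed
  ultimately show ?thesis by (simp add: quartic_sum_def sum_distrib_left)
qed

text \<open>In characteristic three \<open>z ^ 4 + z\<^sup>2 = z ^ 3 z + z z\<close> is a quadratic form over the prime field;
  its radical has \<open>r\<close> elements.\<close>

lemma quartic_sum_norm: "\<exists>r::nat. quartic_sum n * cnj (quartic_sum n) = of_nat (9 ^ k * r)"
proof -
  define Q where "Q z = n * (z ^ 4 + z * z)" for z
  define B where "B v w = n * (v ^ 3 * w + v * w ^ 3 - v * w)" for v w
  have Q_add: "Q (w + v) = Q w + (Q v + B v w)" for v w
  proof -
    have "(w + v) ^ 4 = w ^ 4 + v ^ 4 + 4 * (v ^ 3 * w + v * w ^ 3) + 6 * (v * v * w * w)"
      by (simp add: power4_eq_xxxx power3_eq_cube algebra_simps)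
    moreover have "(w + v) * (w + v) = w * w + v * v + 2 * (v * w)" by (simp add: algebra_simps)
    ultimately show ?thesis unfolding Q_def B_def by (simp add: char3_simps algebra_simps)
  qed
  have B_add: "B v (x + y) = B v x + B v y" for v x y
    unfolding B_def by (simp add: cube_add algebra_simps)
  have B_diag: "B v v = - Q v" for v
  proof -
    have "B v v + Q v = 3 * (n * v ^ 4)" by (simp add: B_def Q_def power4_eq_xxxx power3_eq_cube algebra_simps)
    thus ?thesis by (simp add: three eq_neg_iff_add_eq_0)
  qed
  let ?rad = "{v. \<forall>w. e (B v w) = 1}"
  have "quartic_sum n * cnj (quartic_sum n) = (\<Sum>w\<in>UNIV. \<Sum>z\<in>UNIV. e (Q z) * cnj (e (Q w)))"
    unfolding quartic_sum_def Q_def[symmetric] by (simp add: sum_product) (rule sum.swap)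
  also have "\<dots> = (\<Sum>w\<in>UNIV. \<Sum>v\<in>UNIV. e (Q v) * e (B v w))"
  proof (rule sum.cong[OF refl])
    fix w
    show "(\<Sum>z\<in>UNIV. e (Q z) * cnj (e (Q w))) = (\<Sum>v\<in>UNIV. e (Q v) * e (B v w))"
    proof (rule sum.reindex_bij_witness[of _ "\<lambda>v. w + v" "\<lambda>z. z - w"])
      fix z
      have "e (Q z) = e (Q (w + (z - w)))" by simp
      hence "e (Q z) = e (Q w) * (e (Q (z - w)) * e (B (z - w) w))" by (simp only: Q_add e_add)
      thus "e (Q (z - w)) * e (B (z - w) w) = e (Q z) * cnj (e (Q w))"
        using e_cnj[of "Q w"] by (simp add: mult_ac)
    qed auto
  qed
  also have "\<dots> = (\<Sum>v\<in>UNIV. e (Q v) * (\<Sum>w\<in>UNIV. e (B v w)))"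
    by (subst sum.swap) (simp add: sum_distrib_left)
  also have "\<dots> = (\<Sum>v\<in>UNIV. if v \<in> ?rad then of_nat (9 ^ k) else 0)"
  proof (rule sum.cong[OF refl])
    fix v
    have "(\<Sum>w\<in>UNIV. e (B v w)) = (if v \<in> ?rad then of_nat (9 ^ k) else 0)"
      using sum_e_additive[of "B v"] B_add by simp
    \<comment> \<open>On the radical the diagonal values \<open>B v v = - Q v\<close> are trivial
      under \<open>e\<close>, so each radical element contributes exactly
      \<open>9 ^ k\<close>.\<close>
    moreover have "e (Q v) = 1" if "v \<in> ?rad"
    proof -
      have "e (B v v) = 1" using that by blast
      thus ?thesis by (simp add: B_diag e_minus)
    qed
    ultimately show "e (Q v) * (\<Sum>w\<in>UNIV. e (B v w)) = (if v \<in> ?rad then of_nat (9 ^ k) else 0)" by simp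
  qed
  also have "\<dots> = of_nat (9 ^ k * card ?rad)" by (simp add: sum.If_cases mult.commute)
  finally show ?thesis by blast
qed

text \<open>A real Gaussian integer is an integer \<open>x\<close>. The squared modulus of the
  quartic sum is a multiple of \<open>9 ^ k\<close>, which becomes a quadratic equation for
  \<open>x\<close> that forces the divisibility.\<close>

lemma kloosterman_divisible:
  assumes "n \<noteq> 0" and gauss: "gauss_int (kloosterman n n)"
  shows "\<exists>j. kloosterman n n = of_int (3 ^ k * j)"
proof -
  obtain x y where xy: "kloosterman n n = Complex (of_int x) (of_int y)" using gauss gauss_int_iff by auto
  hence "y = 0" using kloosterman_real[of n] by (simp add: complex_eq_iff)
  hence x: "kloosterman n n = of_int x" by (simp add: xy complex_eq_iff)
  obtain \<epsilon> where "\<epsilon> \<in> {1, -1}" "G \<eta> = \<epsilon> * 3 ^ k" using gauss_sum_\<eta> by blast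
  hence "\<exists>\<sigma>\<in>{1, -1::int}. \<eta> n * G \<eta> = of_int (\<sigma> * 3 ^ k)" using \<eta>_cases[OF assms(1)] by auto
  then obtain \<sigma> where \<sigma>: "\<sigma> \<in> {1, -1::int}" "\<eta> n * G \<eta> = of_int (\<sigma> * 3 ^ k)" by blast
  obtain r where r: "quartic_sum n * cnj (quartic_sum n) = of_nat (9 ^ k * r)" using quartic_sum_norm by blast
  have "of_int x = cnj (e n) * quartic_sum n - e n * of_int (\<sigma> * 3 ^ k)"
    using kloosterman_quartic_sum[OF assms(1)] unfolding x mult.assoc \<sigma>(2) .
  hence "cnj (e n) * quartic_sum n = of_int x + e n * of_int (\<sigma> * 3 ^ k)" by simp
  hence "(cnj (e n) * quartic_sum n) * cnj (cnj (e n) * quartic_sum n)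
     = (of_int x + e n * of_int (\<sigma> * 3 ^ k)) * (of_int x + cnj (e n) * of_int (\<sigma> * 3 ^ k))" by simp
  moreover have "(cnj (e n) * quartic_sum n) * cnj (cnj (e n) * quartic_sum n) = (e n * cnj (e n)) * (quartic_sum n * cnj (quartic_sum n))"
    by (simp add: mult_ac)
  moreover have "(of_int x + e n * of_int (\<sigma> * 3 ^ k)) * (of_int x + cnj (e n) * of_int (\<sigma> * 3 ^ k))
    = of_int (x\<^sup>2) + (e n + cnj (e n)) * of_int (\<sigma> * 3 ^ k * x) + (e n * cnj (e n)) * of_int ((\<sigma> * 3 ^ k)\<^sup>2)"
    by (simp add: power2_eq_square algebra_simps)
  ultimately have "of_nat (9 ^ k * r) = of_int (x\<^sup>2) + (e n + cnj (e n)) * of_int (\<sigma> * 3 ^ k * x) + of_int ((\<sigma> * 3 ^ k)\<^sup>2)"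
    by (simp only: e_cnj r mult_1)
  moreover obtain c :: int where "e n + cnj (e n) = of_int c"
    using e_plus_cnj[of n] by (metis of_int_numeral of_int_minus of_int_1)
  ultimately have "complex_of_int (int (9 ^ k * r)) = of_int (x\<^sup>2 + c * (\<sigma> * 3 ^ k * x) + (\<sigma> * 3 ^ k)\<^sup>2)" by simp
  hence "int (9 ^ k * r) = x\<^sup>2 + c * (\<sigma> * 3 ^ k * x) + (\<sigma> * 3 ^ k)\<^sup>2" by (simp only: of_int_eq_iff)
  moreover have "\<sigma>\<^sup>2 = 1" using \<sigma> by auto
  moreover have "(9::int) ^ k = (3 ^ k)\<^sup>2" by (simp add: power2_eq_square power_mult_distrib[symmetric])
  ultimately have "x\<^sup>2 + (c * \<sigma>) * 3 ^ k * x = (3 ^ k)\<^sup>2 * (int r - 1)"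
    by (simp add: power_mult_distrib algebra_simps)
  hence "3 ^ k dvd x" by (rule power_dvd_of_quadratic) simp
  thus ?thesis unfolding x by auto
qed

text \<open>If \<open>- (a / c)\<close> were not a square, the additive map
  \<open>s \<mapsto> s ^ 3 + (a / c) * s\<close> would be injective, hence surjective, and the
  inverse of a preimage of \<open>- (1 / c)\<close> would be a root. So a square root exists, and it
  rescales the Kloosterman sum to equal coefficients.\<close>

lemma cubic_sum_divisible_depressed:
  assumes "a \<noteq> 0" and no_root: "\<And>t. t ^ 3 + a * t * t + c \<noteq> 0"
  shows "\<exists>z. gauss_int z \<and> cubic_sum a 0 c = 3 ^ k * z"
proof -
  have c: "c \<noteq> 0" using no_root[of 0] by auto
  have "\<exists>y. y * y = - (a / c)"
  proof (rule ccontr)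
    assume n: "\<not> ?thesis"
    have "inj (\<lambda>s. s ^ 3 + (a / c) * s)"
    proof (rule injI)
      fix s t assume st: "s ^ 3 + (a / c) * s = t ^ 3 + (a / c) * t"
      have fac: "(s - t) * ((s - t) * (s - t) + v) = (s + - t) ^ 3 + v * s - v * t" for v
        by (simp add: power3_eq_cube algebra_simps)
      have "(s - t) * ((s - t) * (s - t) + a / c) = (s ^ 3 + (a / c) * s) - (t ^ 3 + (a / c) * t)"
      proof -
        have "p + - u + v - w = (p + v) - (u + w)" for p u v w :: 'k by simp
        thus ?thesis by (simp only: fac cube_add cube_minus)
      qed
      also have "\<dots> = 0" using st by simp
      finally show "s = t" using n by (auto simp: eq_neg_iff_add_eq_0)
    qed
    hence "surj (\<lambda>s. s ^ 3 + (a / c) * s)" by (simp add: finite_UNIV_inj_surj)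
    from surjD[OF this, of "- (1 / c)"] obtain s where s: "s ^ 3 + (a / c) * s = - (1 / c)" by auto
    hence s0: "s \<noteq> 0" using c by auto
    have "c * s ^ 3 + a * s + 1 = 0"
    proof -
      have "c * (s ^ 3 + (a / c) * s) = c * (- (1 / c))" using s by simp
      thus ?thesis using c by (simp add: algebra_simps)
    qed
    moreover have "(inverse s) ^ 3 * (c * s ^ 3 + a * s + 1) = (inverse s) ^ 3 + a * inverse s * inverse s + c"
      using s0 by (simp add: power3_eq_cube field_simps)
    ultimately show False using no_root[of "inverse s"] by simp
  qed
  then obtain y where y: "y * y = - (a / c)" by blast
  define v where "v = y / (a * a)"
  have v: "v \<noteq> 0" "- inverse (a ^ 3) = c * (v * v)"
    using y assms(1) c by (auto simp: v_def power3_eq_cube field_simps)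
  define n where "n = c * v"
  have n: "n \<noteq> 0" using c v by (simp add: n_def)
  obtain \<epsilon> \<delta> where ed: "\<epsilon> \<in> {1, -1}" "G \<psi> = \<epsilon> * 3 ^ k" "\<delta> \<in> {1, -1}" "G \<eta> = \<delta> * 3 ^ k"
    using gauss_sum_\<psi> gauss_sum_\<eta> by blast
  have "\<epsilon> * 3 ^ k * cubic_sum a 0 c = \<eta> a * (\<delta> * 3 ^ k) * (\<psi> v * kloosterman n n)"
    using cubic_sum_kloosterman[OF assms(1), of c] kloosterman_scale[OF v]
    by (simp only: ed n_def)
  hence "3 ^ k * (\<epsilon> * cubic_sum a 0 c) = 3 ^ k * (\<eta> a * \<delta> * \<psi> v * kloosterman n n)"
    by (simp only: mult_ac)
  hence 1: "\<epsilon> * cubic_sum a 0 c = \<eta> a * \<delta> * \<psi> v * kloosterman n n" by simp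
  have 2: "cubic_sum a 0 c = (\<epsilon> * \<eta> a * \<delta> * \<psi> v) * kloosterman n n"
  proof -
    have "cubic_sum a 0 c = \<epsilon> * (\<epsilon> * cubic_sum a 0 c)" using ed by auto
    thus ?thesis unfolding 1 by (simp add: mult_ac)
  qed
  let ?u = "\<epsilon> * \<eta> a * \<delta> * \<psi> v"
  have u: "gauss_int ?u" "?u * cnj ?u = 1"
  proof -
    have "gauss_int \<epsilon>" "gauss_int \<delta>" "gauss_int (\<eta> a)" using ed by (auto simp: \<eta>_def)
    thus "gauss_int ?u" by (intro gauss_int_ops) auto
    have "\<epsilon> * cnj \<epsilon> = 1" "\<delta> * cnj \<delta> = 1" using ed by auto
    moreover have "?u * cnj ?u = (\<epsilon> * cnj \<epsilon>) * (\<eta> a * cnj (\<eta> a)) * (\<delta> * cnj \<delta>) * (\<psi> v * cnj (\<psi> v))"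
      by (simp add: mult_ac)
    ultimately show "?u * cnj ?u = 1" by (simp only: \<eta>_cnj1[OF assms(1)] \<psi>_cnj[OF v(1)]) simp
  qed
  \<comment> \<open>The factor is a unit of the Gaussian integers, so integrality passes from the
    cubic sum to the Kloosterman sum.\<close>
  have "kloosterman n n = (?u * cnj ?u) * kloosterman n n" unfolding u by simp
  also have "\<dots> = cnj ?u * cubic_sum a 0 c" unfolding 2 by (simp only: mult_ac)
  finally have "kloosterman n n = cnj ?u * cubic_sum a 0 c" .
  moreover have "gauss_int (cubic_sum a 0 c)" unfolding cubic_sum_def by auto
  ultimately have "gauss_int (kloosterman n n)"
    using gauss_int_ops(3)[OF gauss_int_unary(2)[OF u(1)]] by (simp only:)
  then obtain j where j: "kloosterman n n = of_int (3 ^ k * j)" using kloosterman_divisible[OF n] by blast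
  have "cubic_sum a 0 c = 3 ^ k * (?u * of_int j)" unfolding 2 j by (simp add: mult_ac)
  moreover have "gauss_int (?u * of_int j)" by (rule gauss_int_ops(3)[OF u(1) gauss_int_basic(4)])
  ultimately show ?thesis by blast
qed

text \<open>For nonzero \<open>a\<close>, the shift by \<open>b / a\<close> changes the linear
  coefficient to \<open>2 * b + b = 0\<close>.\<close>

lemma cubic_sum_divisible:
  assumes no_root: "\<And>t. t ^ 3 + a * t * t + b * t + c \<noteq> 0"
  shows "\<exists>z. gauss_int z \<and> cubic_sum a b c = 3 ^ k * z"
proof (cases "a = 0")
  case True
  thus ?thesis using cubic_sum_divisible_linear by simp
next
  case False
  define u where "u = b / a"
  define c' where "c' = u ^ 3 + a * u * u + b * u + c"
  have shift: "(t + u) ^ 3 + a * (t + u) * (t + u) + b * (t + u) + c = t ^ 3 + a * t * t + c'" for t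
  proof -
    have "a * u = b" using False by (simp add: u_def)
    have "(t + u) ^ 3 + a * (t + u) * (t + u) + b * (t + u) + c
       = t ^ 3 + a * t * t + c' + (2 * (a * u) + b) * t"
      by (simp add: cube_add c'_def algebra_simps)
    also have "2 * (a * u) + b = 3 * b" using \<open>a * u = b\<close> by simp
    finally show ?thesis by (simp add: three)
  qed
  have "cubic_sum a b c = (\<Sum>t\<in>UNIV. \<psi> ((t + u) ^ 3 + a * (t + u) * (t + u) + b * (t + u) + c))"
    unfolding cubic_sum_def
    by (rule sum.reindex_bij_witness[of _ "\<lambda>t. t + u" "\<lambda>t. t - u"]) auto
  also have "\<dots> = cubic_sum a 0 c'" by (simp only: shift cubic_sum_def) simp
  finally have sum_eq: "cubic_sum a b c = cubic_sum a 0 c'" .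
  have "t ^ 3 + a * t * t + c' \<noteq> 0" for t using no_root[of "t + u"] unfolding shift .
  from cubic_sum_divisible_depressed[OF False this] show ?thesis unfolding sum_eq .
qed

end

subsection \<open>Line sums of the quartic character in a cubic extension\<close>

text \<open>\<open>'k\<close> is the field \<open>K\<close> and the fixed points of
  \<open>x \<mapsto> x ^ q\<close> form \<open>F\<close>; \<open>\<mu>\<close> and \<open>n\<close>
  are a quarter of \<open>q ^ 3 - 1\<close> and of \<open>q - 1\<close>.\<close>

locale cubic_extension = quartic_field \<iota> \<mu> for \<iota> :: "'k::{field,finite}" and \<mu> +
  fixes p r q n :: nat
  assumes prime_p: "prime p" and q_eq: "q = p ^ r" and q_mod: "q = 4 * n + 1"
    and card_ext: "CARD('k) = q ^ 3"
    and card_fixed: "card {x::'k. x ^ q = x} = q"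
begin

definition F :: "'k set" where "F = {x. x ^ q = x}"

definition line_sum :: "'k \<Rightarrow> 'k \<Rightarrow> complex" where
  "line_sum a d = (\<Sum>t\<in>F. \<psi> (a + t * d))"

text \<open>Encodes that \<open>a + F d\<close> is a line missing the origin.\<close>

definition indep :: "'k \<Rightarrow> 'k \<Rightarrow> bool" where
  "indep a d \<longleftrightarrow> d \<noteq> 0 \<and> a \<notin> (\<lambda>t. t * d) ` F"

lemma n_pos: "n > 0"
proof (rule ccontr)
  assume "\<not> n > 0"
  hence "q ^ 3 = 1" using q_mod by simp
  thus False using card_ext card_field m_pos by simp
qed

lemma q_gt_1: "q > 1" and q_odd: "odd q"
  using q_mod n_pos by auto

lemma \<mu>_eq: "\<mu> = n * (1 + q + q\<^sup>2)"
proof -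
  have "4 * \<mu> + 1 = (4 * n + 1) ^ 3" using card_field card_ext q_mod by simp
  thus ?thesis unfolding q_mod by (simp add: power3_eq_cube power2_eq_square algebra_simps)
qed

lemma char_p: "CHAR('k) = p"
  by (rule CHAR_finite_field[of p "r * 3"]) (simp_all add: card_ext q_eq prime_p power_mult)

lemma frobenius_add: "(x + y) ^ q = x ^ q + (y ^ q :: 'k)"
  unfolding q_eq char_p[symmetric]
  by (rule freshmans_dream') (use prime_p char_p in auto)

lemma frobenius_minus: "(- x) ^ q = - (x ^ q :: 'k)"
  using q_odd by simp

lemma frobenius_diff: "(x - y) ^ q = x ^ q - (y ^ q :: 'k)"
  using frobenius_add[of x "- y"] by (simp add: frobenius_minus)

lemma F_closed [simp, intro]:
  "0 \<in> F" "1 \<in> F"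
  "x \<in> F \<Longrightarrow> y \<in> F \<Longrightarrow> x + y \<in> F"
  "x \<in> F \<Longrightarrow> y \<in> F \<Longrightarrow> x - y \<in> F"
  "x \<in> F \<Longrightarrow> y \<in> F \<Longrightarrow> x * y \<in> F"
  "x \<in> F \<Longrightarrow> y \<in> F \<Longrightarrow> x / y \<in> F"
  "x \<in> F \<Longrightarrow> - x \<in> F"
  "x \<in> F \<Longrightarrow> inverse x \<in> F"
  using q_gt_1
  by (auto simp: F_def frobenius_add frobenius_diff power_mult_distrib power_divide power_inverse
      q_odd)

lemma card_F: "card F = q"
  using card_fixed by (simp add: F_def)

lemma F_power_q1: "x \<in> F \<Longrightarrow> x \<noteq> 0 \<Longrightarrow> x ^ (4 * n) = 1"
proof -
  assume x: "x \<in> F" "x \<noteq> 0"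
  hence "x ^ q = x" by (simp add: F_def)
  hence "x * x ^ (4 * n) = x * 1" by (simp add: q_mod)
  thus ?thesis using x by simp
qed

text \<open>\<open>1 + q + q ^ 2\<close> is 3 modulo 4, so \<open>\<mu>\<close> is
  \<open>- n\<close> modulo \<open>4 * n\<close>. If \<open>\<psi>\<close> were trivial on
  \<open>F\<close>, all \<open>4 * n\<close> nonzero elements would satisfy
  \<open>x ^ n = 1\<close>.\<close>

lemma exists_F_char: "\<exists>c\<in>F. c \<noteq> 0 \<and> \<psi> c \<noteq> 1"
proof (rule ccontr)
  assume a: "\<not> ?thesis"
  have "F - {0} \<subseteq> {x. x ^ n = 1}"
  proof
    fix x assume x: "x \<in> F - {0}"
    hence 4: "x ^ (4 * n) = 1" using F_power_q1 by auto
    have "x ^ \<mu> = 1" using a x \<psi>_eq_iff by auto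
    moreover have "\<mu> = 4 * n * (2 * n + n * q + 1) - n"
    proof -
      have "\<mu> + n = 4 * n * (2 * n + n * q + 1)"
        unfolding \<mu>_eq by (simp add: q_mod power2_eq_square algebra_simps)
      thus ?thesis by simp
    qed
    moreover have "n \<le> 4 * n * (2 * n + n * q + 1)" by simp
    ultimately have xn: "x ^ (4 * n * (2 * n + n * q + 1)) = x ^ n"
      by (metis le_add_diff_inverse2 mult_1 power_add)
    have "x ^ (4 * n * (2 * n + n * q + 1)) = 1" by (metis 4 power_mult power_one)
    with xn show "x \<in> {x. x ^ n = 1}" by simp
  qed
  hence "card (F - {0}) \<le> card {x::'k. x ^ n = 1}" by (intro card_mono) auto
  also have "\<dots> \<le> n" by (intro card_power_eq_le n_pos)
  finally have "card (F - {0}) \<le> n" .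
  moreover have "card (F - {0}) = q - 1" using card_F by (simp add: card_Diff_singleton)
  ultimately show False using q_mod n_pos by linarith
qed

lemma sum_\<psi>_F_invariant:
  assumes "\<And>x c. c \<in> F \<Longrightarrow> c \<noteq> 0 \<Longrightarrow> x \<in> A \<Longrightarrow> c * x \<in> A"
  shows "(\<Sum>x\<in>A. \<psi> x) = 0"
proof -
  obtain c where c: "c \<in> F" "c \<noteq> 0" "\<psi> c \<noteq> 1" using exists_F_char by blast
  show ?thesis
  proof (rule sum_\<psi>_eq_0[OF c(2,3)])
    fix x show "x \<in> A \<longleftrightarrow> c * x \<in> A"
      using assms[of c x] assms[of "inverse c" "c * x"] c by (auto simp: mult.assoc[symmetric])
  qed
qed

lemma sum_\<psi>_UNIV: "(\<Sum>x\<in>UNIV. \<psi> x) = 0" and sum_\<psi>_F: "(\<Sum>x\<in>F. \<psi> x) = 0"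
  by (rule sum_\<psi>_F_invariant; simp)+

lemma line_sum_dependent:
  assumes "s \<in> F"
  shows "line_sum (s * d) d = 0"
proof -
  have "line_sum (s * d) d = (\<Sum>t\<in>F. \<psi> (t * d))"
    unfolding line_sum_def
    by (rule sum.reindex_bij_witness[of _ "\<lambda>t. t - s" "\<lambda>t. s + t"]) (use assms in \<open>auto simp: algebra_simps\<close>)
  also have "\<dots> = (\<Sum>t\<in>F. \<psi> t) * \<psi> d" by (simp add: \<psi>_mult sum_distrib_right)
  finally show ?thesis by (simp add: sum_\<psi>_F)
qed

lemma indep_nonzero:
  assumes "indep a d" "t \<in> F"
  shows "a + t * d \<noteq> 0"
proof
  assume "a + t * d = 0"
  hence "a = (- t) * d" by (simp add: eq_neg_iff_add_eq_0)
  moreover have "- t \<in> F" using assms by auto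
  ultimately show False using assms(1) unfolding indep_def by blast
qed

lemma gauss_int_line_sum [intro]: "gauss_int (line_sum a d)"
  unfolding line_sum_def by auto

text \<open>The coordinate sum of each fourth root of unity is odd, and coordinate sums are
  additive.\<close>

lemma sum_units_parity:
  assumes "finite A" "\<And>x. x \<in> A \<Longrightarrow> f x \<noteq> 0"
  shows "\<exists>a b. (\<Sum>x\<in>A. \<psi> (f x)) = Complex (of_int a) (of_int b) \<and> (even (a + b) \<longleftrightarrow> even (card A))"
  using assms
proof (induction A rule: finite_induct)
  case empty
  show ?case by (rule exI[of _ 0], rule exI[of _ 0]) (auto simp: complex_eq_iff)
next
  case (insert x A)
  then obtain a b where ab: "(\<Sum>x\<in>A. \<psi> (f x)) = Complex (of_int a) (of_int b)"
    "even (a + b) \<longleftrightarrow> even (card A)" by auto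
  have "\<exists>c e. \<psi> (f x) = Complex (of_int c) (of_int e) \<and> odd (c + e)"
  proof (rule \<psi>_cases[of "f x"])
    show "f x \<noteq> 0" using insert by auto
  next
    assume "\<psi> (f x) = 1" thus ?thesis by (intro exI[of _ 1] exI[of _ 0]) (auto simp: complex_eq_iff)
  next
    assume "\<psi> (f x) = \<i>" thus ?thesis by (intro exI[of _ 0] exI[of _ 1]) (auto simp: complex_eq_iff)
  next
    assume "\<psi> (f x) = -1" thus ?thesis by (intro exI[of _ "-1"] exI[of _ 0]) (auto simp: complex_eq_iff)
  next
    assume "\<psi> (f x) = -\<i>" thus ?thesis by (intro exI[of _ 0] exI[of _ "-1"]) (auto simp: complex_eq_iff)
  qed
  then obtain c e where "\<psi> (f x) = Complex (of_int c) (of_int e)" "odd (c + e)" by blast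
  thus ?case using insert ab
    by (intro exI[of _ "a + c"] exI[of _ "b + e"]) (auto simp: complex_eq_iff)
qed

text \<open>An odd number of fourth roots of unity cannot add up to zero.\<close>

lemma line_sum_nonzero:
  assumes "indep a d"
  shows "line_sum a d \<noteq> 0"
proof
  assume 0: "line_sum a d = 0"
  have "finite F" by simp
  then obtain x y where "line_sum a d = Complex (of_int x) (of_int y)" "even (x + y) \<longleftrightarrow> even (card F)"
    using sum_units_parity[of F "\<lambda>t. a + t * d"] indep_nonzero[OF assms] unfolding line_sum_def by blast
  thus False using 0 q_odd card_F by (auto simp: complex_eq_iff)
qed

text \<open>After expansion and translation of \<open>a\<close>, only \<open>u - t\<close> matters.
  If it is nonzero, \<open>a + (u - t) * d\<close> runs over everything except \<open>a\<close>,
  leaving \<open>- cnj (\<psi> a)\<close>; the diagonal terms give the factor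
  \<open>q ^ 3 - 1\<close>.\<close>

lemma sum_line_sum_square:
  "(\<Sum>d\<in>UNIV-{0}. \<Sum>a\<in>UNIV. line_sum a d * cnj (line_sum a d)) = of_nat (q * (q ^ 3 - 1) * (q ^ 3 - q))"
proof -
  have shift: "(\<Sum>a\<in>UNIV. \<psi> (a + t * d) * cnj (\<psi> (a + u * d))) = (\<Sum>a\<in>UNIV. \<psi> a * cnj (\<psi> (a + (u - t) * d)))"
    for t u d
    by (rule sum.reindex_bij_witness[of _ "\<lambda>a. a - t * d" "\<lambda>a. a + t * d"]) (auto simp: algebra_simps)
  have inner: "(\<Sum>d\<in>UNIV-{0}. cnj (\<psi> (a + s * d))) = (if s = 0 then of_nat (q ^ 3 - 1) else -1) * cnj (\<psi> a)" for a s
  proof (cases "s = 0")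
    case True thus ?thesis by (simp add: card_Diff_singleton card_ext)
  next
    case False
    have "(\<Sum>d\<in>UNIV. cnj (\<psi> (a + s * d))) = (\<Sum>x\<in>UNIV. cnj (\<psi> x))"
      by (rule sum.reindex_bij_witness[of _ "\<lambda>x. (x - a) / s" "\<lambda>d. a + s * d"]) (use False in auto)
    also have "\<dots> = cnj (\<Sum>x\<in>UNIV. \<psi> x)" by simp
    finally have "(\<Sum>d\<in>UNIV. cnj (\<psi> (a + s * d))) = 0" by (simp only: sum_\<psi>_UNIV) simp
    thus ?thesis using False by (simp add: sum_diff1)
  qed
  have "(\<Sum>d\<in>UNIV-{0}. \<Sum>a\<in>UNIV. line_sum a d * cnj (line_sum a d))
      = (\<Sum>d\<in>UNIV-{0}. \<Sum>a\<in>UNIV. \<Sum>t\<in>F. \<Sum>u\<in>F. \<psi> (a + t * d) * cnj (\<psi> (a + u * d)))"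
    by (simp add: line_sum_def sum_product)
  also have "\<dots> = (\<Sum>d\<in>UNIV-{0}. \<Sum>t\<in>F. \<Sum>a\<in>UNIV. \<Sum>u\<in>F. \<psi> (a + t * d) * cnj (\<psi> (a + u * d)))"
    by (intro sum.cong refl sum.swap)
  also have "\<dots> = (\<Sum>d\<in>UNIV-{0}. \<Sum>t\<in>F. \<Sum>u\<in>F. \<Sum>a\<in>UNIV. \<psi> (a + t * d) * cnj (\<psi> (a + u * d)))"
    by (intro sum.cong refl sum.swap)
  also have "\<dots> = (\<Sum>d\<in>UNIV-{0}. \<Sum>t\<in>F. \<Sum>u\<in>F. \<Sum>a\<in>UNIV. \<psi> a * cnj (\<psi> (a + (u - t) * d)))"
    by (simp only: shift)
  also have "\<dots> = (\<Sum>t\<in>F. \<Sum>u\<in>F. \<Sum>d\<in>UNIV-{0}. \<Sum>a\<in>UNIV. \<psi> a * cnj (\<psi> (a + (u - t) * d)))"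
    by (subst sum.swap, rule sum.cong[OF refl], rule sum.swap)
  also have "\<dots> = (\<Sum>t\<in>F. \<Sum>u\<in>F. \<Sum>a\<in>UNIV. \<Sum>d\<in>UNIV-{0}. \<psi> a * cnj (\<psi> (a + (u - t) * d)))"
    by (intro sum.cong refl sum.swap)
  also have "\<dots> = (\<Sum>t\<in>F. \<Sum>u\<in>F. \<Sum>a\<in>UNIV. \<psi> a * ((if u - t = 0 then of_nat (q ^ 3 - 1) else -1) * cnj (\<psi> a)))"
    by (simp only: sum_distrib_left[symmetric] inner)
  also have "\<dots> = (\<Sum>t\<in>F. \<Sum>u\<in>F. (if u = t then of_nat (q ^ 3 - 1) else -1) * (\<Sum>a\<in>UNIV. \<psi> a * cnj (\<psi> a)))"
    by (intro sum.cong refl) (simp add: sum_distrib_left mult_ac)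
  also have "(\<Sum>a\<in>UNIV. \<psi> a * cnj (\<psi> a)) = (\<Sum>a\<in>UNIV-{0::'k}. 1)"
    by (rule sum.mono_neutral_cong_right) (auto simp: \<psi>_cnj)
  also have "\<dots> = (of_nat (q ^ 3 - 1) :: complex)" by (simp add: card_Diff_singleton card_ext)
  also have "(\<Sum>t\<in>F. \<Sum>u\<in>F. (if u = t then of_nat (q ^ 3 - 1) else -1) * of_nat (q ^ 3 - 1))
     = (\<Sum>t\<in>F. (of_nat (q ^ 3 - 1) - (of_nat q - 1)) * (of_nat (q ^ 3 - 1) :: complex))"
  proof (rule sum.cong[OF refl])
    fix t assume t: "t \<in> F"
    have "(\<Sum>u\<in>F. (if u = t then of_nat (q ^ 3 - 1) else -1) * (of_nat (q ^ 3 - 1) :: complex))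
       = (\<Sum>u\<in>F. (if u = t then of_nat (q ^ 3 - 1) + 1 else 0) - 1) * of_nat (q ^ 3 - 1)"
      by (simp only: sum_distrib_right) (auto intro!: sum.cong)
    also have "(\<Sum>u\<in>F. (if u = t then of_nat (q ^ 3 - 1) + 1 else 0) - 1) = of_nat (q ^ 3 - 1) - (of_nat q - (1::complex))"
      using t by (simp add: sum_subtractf card_F)
    finally show "(\<Sum>u\<in>F. (if u = t then of_nat (q ^ 3 - 1) else -1) * (of_nat (q ^ 3 - 1) :: complex))
       = (of_nat (q ^ 3 - 1) - (of_nat q - 1)) * of_nat (q ^ 3 - 1)" .
  qed
  also have "\<dots> = of_nat (q * (q ^ 3 - 1) * (q ^ 3 - q))"
  proof -
    have "q \<le> q ^ 3" "1 \<le> q ^ 3" using q_gt_1 by (simp_all add: power3_eq_cube)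
    thus ?thesis by (simp only: of_nat_mult of_nat_diff of_nat_1 sum_constant card_F) (simp add: algebra_simps)
  qed
  finally show ?thesis .
qed

lemma card_indep: "card {a. indep a d} = (if d = 0 then 0 else q ^ 3 - q)"
proof (cases "d = 0")
  case False
  have "{a. indep a d} = UNIV - (\<lambda>t. t * d) ` F" using False by (auto simp: indep_def)
  moreover have "card ((\<lambda>t. t * d) ` F) = q"
    using False card_F by (subst card_image) (auto simp: inj_on_def)
  ultimately show ?thesis using False by (simp add: card_Diff_subset card_ext)
qed (auto simp: indep_def)

text \<open>Lines through 0 contribute nothing to the second moment, so the mean over the remaining
  ones is exactly \<open>q\<close>. A nonzero multiple of \<open>q\<close> is at least
  \<open>q\<close>, hence no value can exceed the mean.\<close>

lemma norm_line_sum_if_divisible: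
  assumes div: "\<And>a d. indep a d \<Longrightarrow> \<exists>k. (cmod (line_sum a d))\<^sup>2 = of_int (int q * k)"
    and "indep a d"
  shows "(cmod (line_sum a d))\<^sup>2 = q"
proof -
  let ?I = "Sigma (UNIV - {0}) (\<lambda>d. {a. indep a d})"
  let ?f = "\<lambda>(d, a). (cmod (line_sum a d))\<^sup>2 - real q"
  have nonneg: "?f x \<ge> 0" if "x \<in> ?I" for x
  proof -
    obtain d a where "x = (d, a)" by (cases x)
    with that have x: "x = (d, a)" "indep a d" by auto
    obtain k where k: "(cmod (line_sum a d))\<^sup>2 = of_int (int q * k)" using div x by blast
    have "(cmod (line_sum a d))\<^sup>2 > 0" using line_sum_nonzero[OF x(2)] by simp
    hence "int q * k > 0" unfolding k by linarith
    hence "k \<ge> 1" by (simp add: zero_less_mult_iff)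
    hence "int q * k \<ge> int q * 1" by (intro mult_left_mono) auto
    hence "real_of_int (int q * k) \<ge> real_of_int (int q)" by linarith
    thus ?thesis unfolding x using k by simp
  qed
  have "complex_of_real (\<Sum>d\<in>UNIV-{0}. \<Sum>a\<in>UNIV. (cmod (line_sum a d))\<^sup>2)
     = of_real (real (q * (q ^ 3 - 1) * (q ^ 3 - q)))"
    using sum_line_sum_square by (simp only: complex_norm_square[symmetric] of_real_sum of_real_of_nat_eq)
  hence tot: "(\<Sum>d\<in>UNIV-{0}. \<Sum>a\<in>UNIV. (cmod (line_sum a d))\<^sup>2) = real (q * (q ^ 3 - 1) * (q ^ 3 - q))"
    by (simp only: of_real_eq_iff)
  have "(\<Sum>x\<in>?I. ?f x) = (\<Sum>d\<in>UNIV-{0}. \<Sum>a\<in>{a. indep a d}. (cmod (line_sum a d))\<^sup>2 - real q)"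
    by (subst sum.Sigma) auto
  also have "\<dots> = (\<Sum>d\<in>UNIV-{0}. \<Sum>a\<in>{a. indep a d}. (cmod (line_sum a d))\<^sup>2) - (\<Sum>d\<in>UNIV-{0::'k}. real (q ^ 3 - q) * real q)"
    unfolding sum_subtractf[symmetric]
    by (intro sum.cong refl) (simp add: sum_subtractf card_indep)
  also have "(\<Sum>d\<in>UNIV-{0}. \<Sum>a\<in>{a. indep a d}. (cmod (line_sum a d))\<^sup>2) = (\<Sum>d\<in>UNIV-{0}. \<Sum>a\<in>UNIV. (cmod (line_sum a d))\<^sup>2)"
    by (intro sum.cong refl sum.mono_neutral_left) (auto simp: indep_def line_sum_dependent)
  also have "\<dots> = real (q * (q ^ 3 - 1) * (q ^ 3 - q))" by (rule tot)
  also have "(\<Sum>d\<in>UNIV-{0::'k}. real (q ^ 3 - q) * real q) = real (q * (q ^ 3 - 1) * (q ^ 3 - q))"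
    by (simp add: card_Diff_singleton card_ext)
  finally have "(\<Sum>x\<in>?I. ?f x) = 0" by simp
  hence "\<forall>x\<in>?I. ?f x = 0" using nonneg by (subst (asm) sum_nonneg_eq_0_iff) auto
  moreover have "(d, a) \<in> ?I" using assms(2) by (auto simp: indep_def)
  ultimately show ?thesis by fastforce
qed

text \<open>With \<open>\<gamma>\<close> the sum over a fixed line \<open>a0 + F\<close>, the
  quotient \<open>line_sum a d * cnj \<gamma> / q\<close> is a Gaussian integer of norm 1.\<close>

lemma line_sum_constant_up_to_units:
  assumes div: "\<And>a d a' d'. indep a d \<Longrightarrow> indep a' d' \<Longrightarrow>
      \<exists>z. gauss_int z \<and> line_sum a d * cnj (line_sum a' d') = of_nat q * z"
  obtains \<gamma> where "\<gamma> * cnj \<gamma> = of_nat q" "gauss_int \<gamma>"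
    "\<And>a d. indep a d \<Longrightarrow> \<exists>u\<in>{1, \<i>, -1, -\<i>}. line_sum a d = u * \<gamma>"
proof -
  have norm: "line_sum a d * cnj (line_sum a d) = of_nat q" if "indep a d" for a d
  proof -
    have "\<exists>k. (cmod (line_sum a d))\<^sup>2 = of_int (int q * k)" if ad: "indep a d" for a d
    proof -
      obtain z where z: "gauss_int z" "line_sum a d * cnj (line_sum a d) = of_nat q * z"
        using div[OF ad ad] by blast
      obtain x y where "z = Complex (of_int x) (of_int y)" using z gauss_int_iff by auto
      with z have "complex_of_real ((cmod (line_sum a d))\<^sup>2) = of_nat q * Complex (of_int x) (of_int y)"
        by (simp only: complex_norm_square)
      thus ?thesis by (intro exI[of _ x]) (simp add: complex_eq_iff)
    qed
    from norm_line_sum_if_divisible[OF this that] show ?thesis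
      by (metis complex_norm_square of_real_of_nat_eq)
  qed
  have "\<not> UNIV \<subseteq> F"
  proof
    assume "(UNIV::'k set) \<subseteq> F"
    hence "CARD('k) \<le> card F" by (intro card_mono) auto
    hence "q ^ 3 \<le> q ^ 1" using card_F card_ext by simp
    thus False using q_gt_1 power_increasing_iff[of q 3 1] by simp
  qed
  then obtain a0 where "a0 \<notin> F" by auto
  hence a0: "indep a0 1" by (auto simp: indep_def)
  show ?thesis
  proof (rule that)
    show "line_sum a0 1 * cnj (line_sum a0 1) = of_nat q" using norm[OF a0] .
    fix a d assume ad: "indep a d"
    obtain z where z: "gauss_int z" "line_sum a d * cnj (line_sum a0 1) = of_nat q * z"
      using div[OF ad a0] by blast
    have q0: "(of_nat q :: complex) \<noteq> 0" using q_gt_1 by simp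
    have "(of_nat q * z) * cnj (of_nat q * z) = (line_sum a d * cnj (line_sum a d)) * (line_sum a0 1 * cnj (line_sum a0 1))"
      unfolding z(2)[symmetric] by simp
    also have "\<dots> = of_nat q * of_nat q" using norm[OF a0] norm[OF ad] by simp
    finally have "z * cnj z = 1" using q0 by simp
    hence "z \<in> {1, \<i>, -1, -\<i>}" using gauss_int_norm_one_cases z(1) by blast
    moreover have "line_sum a d = z * line_sum a0 1"
    proof -
      have "line_sum a d * of_nat q = line_sum a d * cnj (line_sum a0 1) * line_sum a0 1"
        using norm[OF a0] by (simp add: mult_ac)
      also have "\<dots> = z * line_sum a0 1 * of_nat q" unfolding z(2) by (simp add: mult_ac)
      finally show ?thesis using q0 by simp
    qed
    ultimately show "\<exists>u\<in>{1, \<i>, -1, -\<i>}. line_sum a d = u * line_sum a0 1" by blast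
  qed auto
qed

end

subsection \<open>A multinomial coefficient modulo \<open>p\<close>\<close>

lemma fact_add_less_prime:
  fixes p :: nat
  assumes "prime p" "b < p"
  shows "\<exists>v. \<not> p dvd v \<and> fact (p * a + b) = fact (p * a) * v"
  using assms(2)
proof (induction b)
  case 0
  show ?case using assms(1) by (intro exI[of _ 1]) (auto simp: prime_nat_iff)
next
  case (Suc b)
  then obtain v where v: "\<not> p dvd v" "fact (p * a + b) = fact (p * a) * v" by auto
  have "\<not> p dvd p * a + Suc b"
    using Suc.prems by (auto dest: dvd_imp_le simp: dvd_add_right_iff simp del: add_Suc_right)
  hence "\<not> p dvd v * (p * a + Suc b)" using v(1) assms(1) by (simp only: prime_dvd_mult_iff) simp
  moreover have "fact (p * a + Suc b) = (p * a + Suc b) * fact (p * a + b)"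
    by (simp only: add_Suc_right fact_Suc of_nat_id)
  hence "fact (p * a + Suc b) = fact (p * a) * (v * (p * a + Suc b))"
    unfolding v(2) by (simp only: mult_ac)
  ultimately show ?case by blast
qed

lemma fact_mult_prime:
  fixes p :: nat
  assumes "prime p"
  shows "\<exists>v. \<not> p dvd v \<and> fact (p * a) = p ^ a * fact a * v"
proof (induction a)
  case 0
  show ?case using assms by (intro exI[of _ 1]) (auto simp: prime_nat_iff)
next
  case (Suc a)
  then obtain v where v: "\<not> p dvd v" "fact (p * a) = p ^ a * fact a * v" by auto
  have "p > 0" using assms prime_gt_0_nat by blast
  then obtain w where w: "\<not> p dvd w" "fact (p * a + (p - 1)) = fact (p * a) * w"
    using fact_add_less_prime[OF assms, of "p - 1" a] by auto
  have "p * Suc a = Suc (p * a + (p - 1))" using \<open>p > 0\<close> by simp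
  hence "fact (p * Suc a) = (p * Suc a) * fact (p * a + (p - 1))" by (metis fact_Suc of_nat_id)
  also have "\<dots> = p ^ Suc a * fact (Suc a) * (v * w)" 
    unfolding w(2) v(2) by (simp only: power_Suc fact_Suc of_nat_id mult_ac)
  finally show ?case using v(1) w(1) assms by (intro exI[of _ "v * w"]) (simp add: prime_dvd_mult_iff)
qed

text \<open>One digit of Legendre's formula: the multiples of \<open>p\<close> among the factors
  give \<open>p ^ a * fact a\<close>, and the others are prime to \<open>p\<close>.\<close>

lemma fact_digit:
  fixes p :: nat
  assumes "prime p" "b < p"
  shows "\<exists>v. \<not> p dvd v \<and> fact (p * a + b) = p ^ a * fact a * v"
proof -
  obtain v where "\<not> p dvd v" "fact (p * a + b) = fact (p * a) * v"
    using fact_add_less_prime[OF assms] by blast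
  moreover obtain w where "\<not> p dvd w" "fact (p * a) = p ^ a * fact a * w"
    using fact_mult_prime[OF assms(1)] by blast
  ultimately show ?thesis using assms by (intro exI[of _ "w * v"]) (simp add: prime_dvd_mult_iff)
qed

text \<open>All base \<open>p\<close> digits of \<open>n = (p ^ r - 1) / 4\<close> are \<open>(p - 1) / 4\<close>, so there is no carry
  in \<open>n + n + n + n\<close>.\<close>

lemma fact_quarter:
  fixes p :: nat
  assumes "prime p" "p = 4 * c + 1"
  shows "p ^ r = 4 * n + 1 \<Longrightarrow>
    \<exists>e u v. \<not> p dvd u \<and> \<not> p dvd v \<and> fact (4 * n) = p ^ e * u \<and> (fact n) ^ 4 = p ^ e * v"
proof (induction r arbitrary: n)
  case 0
  thus ?case using assms(1) by (intro exI[of _ 0] exI[of _ 1]) (auto simp: prime_nat_iff)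
next
  case (Suc r)
  have "p mod 4 = 1" using assms(2) by presburger
  hence "p ^ r mod 4 = 1" by (metis power_mod power_one mod_less one_less_numeral_iff semiring_norm(76))
  then obtain k where k: "p ^ r = 4 * k + 1" by (metis mod_mult_div_eq add.commute mult.commute)
  obtain e u v where IH: "\<not> p dvd u" "\<not> p dvd v" "fact (4 * k) = p ^ e * u" "(fact k) ^ 4 = p ^ e * v"
    using Suc.IH[OF k] by blast
  have "4 * n + 1 = p * (4 * k + 1)" using Suc.prems k by simp
  hence "4 * n + 1 = 4 * (p * k + c) + 1" using assms(2) by (simp add: algebra_simps)
  hence n: "n = p * k + c" "4 * n = p * (4 * k) + (p - 1)" using assms(2) by (auto simp: algebra_simps)
  obtain u' where u': "\<not> p dvd u'" "fact (4 * n) = p ^ (4 * k) * fact (4 * k) * u'"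
    using fact_digit[OF assms(1), of "p - 1" "4 * k"] n(2) assms(2) by auto
  obtain v' where v': "\<not> p dvd v'" "fact n = p ^ k * fact k * v'"
    using fact_digit[OF assms(1), of c k] n(1) assms(2) by auto
  have "fact (4 * n) = p ^ (4 * k + e) * (u * u')" by (simp add: u' IH power_add)
  moreover have "(fact n) ^ 4 = p ^ (4 * k + e) * (v * v' ^ 4)"
    by (simp add: v' IH power_add power_mult_distrib power_mult[symmetric] mult_ac)
  moreover have "\<not> p dvd u * u'" "\<not> p dvd v * v' ^ 4"
    using IH u' v' assms(1) by (auto simp: prime_dvd_mult_iff dest: prime_dvd_power)
  ultimately show ?case by blast
qed

text \<open>The product telescopes to \<open>fact (4 * n)\<close> divided by
  \<open>(fact n) ^ 4\<close>, and both contain the same power of \<open>p\<close>.\<close>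

lemma multinomial_quarter_not_dvd:
  fixes p :: nat
  assumes "prime p" "p = 4 * c + 1" "p ^ r = 4 * n + 1"
  shows "\<not> p dvd (4 * n choose n) * (3 * n choose n) * (2 * n choose n)"
proof
  let ?C = "(4 * n choose n) * (3 * n choose n) * (2 * n choose n)"
  assume "p dvd ?C"
  obtain e u v where uv: "\<not> p dvd u" "\<not> p dvd v" "fact (4 * n) = p ^ e * u" "(fact n) ^ 4 = p ^ e * v"
    using fact_quarter[OF assms] by blast
  have "fact n * fact (3 * n) * (4 * n choose n) = (fact (4 * n) :: nat)"
    using binomial_fact_lemma[of n "4 * n"] by simp
  moreover have "fact n * fact (2 * n) * (3 * n choose n) = (fact (3 * n) :: nat)"
    using binomial_fact_lemma[of n "3 * n"] by simp
  moreover have "fact n * fact n * (2 * n choose n) = (fact (2 * n) :: nat)"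
    using binomial_fact_lemma[of n "2 * n"] by simp
  moreover have "x = f ^ 4 * (A * B * C)" if "f * y * A = x" "f * z * B = y" "f * f * C = z" for x y z f A B C :: nat
    unfolding that(1)[symmetric] that(2)[symmetric] that(3)[symmetric] by (simp add: power4_eq_xxxx mult_ac)
  ultimately have "(fact (4 * n) :: nat) = (fact n) ^ 4 * ?C" by blast
  hence "p ^ e * u = p ^ e * (v * ?C)" unfolding uv(3,4) by (simp only: mult.assoc)
  moreover have "p ^ e \<noteq> 0" using assms(1) by (simp add: prime_gt_0_nat)
  ultimately have "u = v * ?C" by (metis mult_left_cancel)
  with \<open>p dvd ?C\<close> have "p dvd u" by simp
  thus False using uv by simp
qed

context cubic_extension
begin

subsection \<open>The trace form\<close>

definition tr :: "'k \<Rightarrow> 'k" where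
  "tr x = x + x ^ q + x ^ (q\<^sup>2)"

lemma power_q3: "(x::'k) ^ (q ^ 3) = x"
  using finite_field_power_card[of x] card_ext by simp

lemma power_q2: "(x::'k) ^ (q\<^sup>2) = (x ^ q) ^ q"
  by (simp add: power2_eq_square power_mult)

lemma tr_in_F [simp, intro]: "tr x \<in> F"
proof -
  have "((x ^ q) ^ q) ^ q = x"
    using power_q3[of x] by (simp add: power_mult[symmetric] power3_eq_cube)
  thus ?thesis by (simp add: F_def tr_def frobenius_add power_q2 add_ac)
qed

lemma tr_add: "tr (x + y) = tr x + tr y"
  by (simp add: tr_def frobenius_add power_q2)

lemma tr_diff: "tr (x - y) = tr x - tr y"
  by (simp add: tr_def frobenius_diff power_q2)

lemma tr_0 [simp]: "tr 0 = 0"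
  using tr_diff[of 0 0] by simp

lemma tr_scale: "c \<in> F \<Longrightarrow> tr (c * x) = c * tr x"
  by (simp add: tr_def F_def power_q2 power_mult_distrib algebra_simps)

lemma tr_not_zero: "\<exists>x. tr x \<noteq> 0"
proof (rule ccontr)
  assume a: "\<not> ?thesis"
  let ?P = "monom 1 1 + monom 1 q + monom 1 (q\<^sup>2) :: 'k poly"
  have lt: "q < q\<^sup>2" "1 < q\<^sup>2" "q\<^sup>2 < q ^ 3" 
    using q_gt_1 power_strict_increasing[of 1 2 q] power_strict_increasing[of 0 2 q] power_strict_increasing[of 2 3 q]
    by simp_all
  have "coeff ?P (q\<^sup>2) = 1" using lt by simp
  hence "?P \<noteq> 0" by (metis coeff_0 zero_neq_one)
  moreover have "degree ?P \<le> q\<^sup>2"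
    using lt by (intro degree_add_le) (auto intro: order.trans[OF degree_monom_le])
  ultimately have "card {x. poly ?P x = 0} \<le> q\<^sup>2"
    using card_poly_roots_bound[of ?P] by linarith
  moreover have "poly ?P x = tr x" for x by (simp add: tr_def poly_monom)
  ultimately have "CARD('k) \<le> q\<^sup>2" using a by simp
  thus False using lt card_ext by simp
qed

lemma tr_nondegenerate: "(\<And>x. tr (x * y) = 0) \<Longrightarrow> y = 0"
proof (rule ccontr)
  assume a: "\<And>x. tr (x * y) = 0" and "y \<noteq> 0"
  obtain x where "tr x \<noteq> 0" using tr_not_zero by blast
  moreover have "tr (x / y * y) = 0" using a .
  ultimately show False using \<open>y \<noteq> 0\<close> by simp
qed

text \<open>Translation by multiples of \<open>h1\<close>, on which the functional is 1, identifies
  all fibres of the functional on the subspace \<open>H\<close>.\<close>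

lemma card_fiber:
  assumes "\<And>x y. x \<in> H \<Longrightarrow> y \<in> H \<Longrightarrow> x + y \<in> H"
    and "\<And>c x. c \<in> F \<Longrightarrow> x \<in> H \<Longrightarrow> c * x \<in> H"
    and "h \<in> H" "tr (h * y) \<noteq> 0" and "a \<in> F"
  shows "q * card {x \<in> H. tr (x * y) = a} = card H"
proof -
  define h1 where "h1 = inverse (tr (h * y)) * h"
  have h1: "h1 \<in> H" "tr (h1 * y) = 1"
    using assms(3,4) by (auto simp: h1_def assms(2) mult.assoc tr_scale)
  have *: "x + c * h1 \<in> H" "x - c * h1 \<in> H" if "x \<in> H" "c \<in> F" for x c
    using assms(1)[OF that(1) assms(2)[OF that(2) h1(1)]]
      assms(1)[OF that(1) assms(2)[of "- c" h1]] that h1 by auto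
  have fib: "card {x \<in> H. tr (x * y) = b} = card {x \<in> H. tr (x * y) = 0}" if "b \<in> F" for b
    by (rule bij_betw_same_card, rule bij_betwI[of "\<lambda>x. x - b * h1" _ _ "\<lambda>x. x + b * h1"])
       (use that * in \<open>auto simp: left_diff_distrib distrib_right mult.assoc tr_add tr_diff tr_scale h1\<close>)
  have "card H = (\<Sum>b\<in>F. card {x \<in> H. tr (x * y) = b})"
    by (subst card_UN_disjoint[symmetric]) (auto intro!: arg_cong[of _ _ card])
  also have "\<dots> = (\<Sum>b\<in>F. card {x \<in> H. tr (x * y) = 0})"
    by (rule sum.cong[OF refl fib])
  also have "\<dots> = q * card {x \<in> H. tr (x * y) = 0}" by (simp add: card_F)
  finally show ?thesis using fib[OF assms(5)] by simp
qed

lemma card_tr1: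
  assumes "d \<noteq> 0" "a \<in> F"
  shows "card {x. tr (x * d) = a} = q\<^sup>2"
proof -
  obtain h where "tr (h * d) \<noteq> 0" using tr_nondegenerate assms(1) by blast
  hence "q * card {x \<in> UNIV. tr (x * d) = a} = q ^ 3"
    using card_fiber[of UNIV h d a] assms card_ext by simp
  also have "\<dots> = q * q\<^sup>2" by (simp add: power3_eq_cube power2_eq_square)
  finally show ?thesis using q_gt_1 by simp
qed

text \<open>Otherwise, for \<open>k\<close> with \<open>tr (k * d) = 1\<close>, each
  \<open>x - tr (x * d) * k\<close> would be orthogonal to \<open>a\<close>, so that nondegeneracy
  would give \<open>a = tr (k * a) * d\<close>.\<close>

lemma indep_tr:
  assumes "indep a d"
  shows "\<exists>h. tr (h * d) = 0 \<and> tr (h * a) \<noteq> 0"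
proof (rule ccontr)
  assume n: "\<not> ?thesis"
  have d: "d \<noteq> 0" using assms by (simp add: indep_def)
  have "card {x. tr (x * d) = 1} > 0" using card_tr1[OF d, of 1] q_gt_1 by simp
  then obtain k where k: "tr (k * d) = 1" by (auto simp: card_gt_0_iff)
  let ?c = "tr (k * a)"
  have "a - ?c * d = 0"
  proof (rule tr_nondegenerate)
    fix x
    have "tr ((x - tr (x * d) * k) * d) = 0" by (simp add: left_diff_distrib tr_diff tr_scale k mult.assoc)
    hence "tr ((x - tr (x * d) * k) * a) = 0" using n by blast
    hence "tr (x * a) = tr (x * d) * ?c" by (simp add: left_diff_distrib tr_diff tr_scale mult.assoc)
    moreover have "tr (x * (a - ?c * d)) = tr (x * a) - tr (?c * (x * d))"
      by (simp add: right_diff_distrib tr_diff mult_ac)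
    ultimately show "tr (x * (a - ?c * d)) = 0" by (simp add: tr_scale)
  qed
  hence "a = ?c * d" by simp
  thus False using assms by (auto simp: indep_def)
qed

lemma card_tr2:
  assumes "indep a d" "s \<in> F" "t \<in> F"
  shows "card {x. tr (x * d) = s \<and> tr (x * a) = t} = q"
proof -
  have d: "d \<noteq> 0" using assms by (simp add: indep_def)
  obtain h where h: "tr (h * d) = 0" "tr (h * a) \<noteq> 0" using indep_tr[OF assms(1)] by blast
  have "card {x. tr (x * d) = s} > 0" using card_tr1[OF d assms(2)] q_gt_1 by simp
  then obtain k where k: "tr (k * d) = s" by (auto simp: card_gt_0_iff)
  have "card {x. tr (x * d) = s \<and> tr (x * a) = t} = card {x \<in> {x. tr (x * d) = 0}. tr (x * a) = t - tr (k * a)}"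
    by (rule bij_betw_same_card, rule bij_betwI[of "\<lambda>x. x - k" _ _ "\<lambda>x. x + k"])
       (auto simp: left_diff_distrib distrib_right tr_add tr_diff k eq_diff_eq diff_eq_eq)
  moreover have "q * card {x \<in> {x. tr (x * d) = 0}. tr (x * a) = t - tr (k * a)} = card {x. tr (x * d) = 0}"
    by (rule card_fiber[of _ h]) (use h assms in \<open>auto simp: distrib_right tr_add tr_scale mult.assoc\<close>)
  moreover have "card {x. tr (x * d) = 0} = q * q" using card_tr1[OF d, of 0] by (simp add: power2_eq_square)
  ultimately show ?thesis using q_gt_1 by simp
qed

definition span2 :: "'k \<Rightarrow> 'k \<Rightarrow> 'k set" where
  "span2 a d = {s * a + t * d | s t. s \<in> F \<and> t \<in> F}"

text \<open>Let \<open>k1\<close>, \<open>k2\<close> be dual to \<open>d\<close>, \<open>a\<close>.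
  If \<open>z\<close> were orthogonal to the common kernel of \<open>d\<close> and \<open>a\<close>,
  removing the \<open>k1\<close> and \<open>k2\<close> components of every \<open>x\<close> would
  place \<open>z\<close> in the span.\<close>

lemma card_tr3:
  assumes "indep a d" "z \<notin> span2 a d" "s \<in> F" "t \<in> F" "u \<in> F"
  shows "card {x. tr (x * d) = s \<and> tr (x * a) = t \<and> tr (x * z) = u} = 1"
proof -
  let ?H = "{x. tr (x * d) = 0 \<and> tr (x * a) = 0}"
  have ex: "\<exists>k. tr (k * d) = s' \<and> tr (k * a) = t'" if "s' \<in> F" "t' \<in> F" for s' t'
  proof -
    have "card {x. tr (x * d) = s' \<and> tr (x * a) = t'} > 0" using card_tr2[OF assms(1) that] q_gt_1 by simp
    thus ?thesis by (auto simp: card_gt_0_iff)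
  qed
  have "\<exists>h\<in>?H. tr (h * z) \<noteq> 0"
  proof (rule ccontr)
    assume n: "\<not> ?thesis"
    obtain k1 where k1: "tr (k1 * d) = 1" "tr (k1 * a) = 0" using ex[of 1 0] by auto
    obtain k2 where k2: "tr (k2 * d) = 0" "tr (k2 * a) = 1" using ex[of 0 1] by auto
    let ?c = "tr (k1 * z)" and ?e = "tr (k2 * z)"
    have "z - (?e * a + ?c * d) = 0"
    proof (rule tr_nondegenerate)
      fix x
      let ?y = "x - tr (x * d) * k1 - tr (x * a) * k2"
      have "?y \<in> ?H" by (simp add: left_diff_distrib tr_diff tr_scale k1 k2 mult.assoc)
      hence "tr (?y * z) = 0" using n by blast
      hence "tr (x * z) = tr (x * d) * ?c + tr (x * a) * ?e"
        by (simp add: left_diff_distrib tr_diff tr_scale mult.assoc diff_eq_eq add.commute)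
      moreover have "tr (x * (z - (?e * a + ?c * d))) = tr (x * z) - (tr (?e * (x * a)) + tr (?c * (x * d)))"
        by (simp add: right_diff_distrib distrib_left tr_diff tr_add mult_ac)
      ultimately show "tr (x * (z - (?e * a + ?c * d))) = 0" by (simp add: tr_scale)
    qed
    hence "z = ?e * a + ?c * d" by simp
    thus False using assms(2) by (auto simp: span2_def)
  qed
  then obtain h where h: "h \<in> ?H" "tr (h * z) \<noteq> 0" by blast
  obtain k where k: "tr (k * d) = s" "tr (k * a) = t" using ex assms by blast
  have "card {x. tr (x * d) = s \<and> tr (x * a) = t \<and> tr (x * z) = u} = card {x \<in> ?H. tr (x * z) = u - tr (k * z)}"
    by (rule bij_betw_same_card, rule bij_betwI[of "\<lambda>x. x - k" _ _ "\<lambda>x. x + k"])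
       (auto simp: left_diff_distrib distrib_right tr_add tr_diff k eq_diff_eq diff_eq_eq)
  moreover have "q * card {x \<in> ?H. tr (x * z) = u - tr (k * z)} = card ?H"
    by (rule card_fiber[OF _ _ h]) (use assms in \<open>auto simp: distrib_right tr_add tr_scale mult.assoc\<close>)
  moreover have "card ?H = q" using card_tr2[OF assms(1)] by auto
  ultimately show ?thesis using q_gt_1 by simp
qed

subsection \<open>The duality between line sums\<close>

definition plane_sum :: complex where
  "plane_sum = (\<Sum>x | tr x = 1. \<psi> x)"

text \<open>The planes avoiding 0 have equations \<open>tr (k * x) = 1\<close>; collected are the
  \<open>k\<close> whose plane contains the line \<open>a + F d\<close>.\<close>

definition dual_line :: "'k \<Rightarrow> 'k \<Rightarrow> 'k set" where
  "dual_line a d = {k. tr (k * d) = 0 \<and> tr (k * a) = 1}"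

definition dual_sum :: "'k \<Rightarrow> 'k \<Rightarrow> complex" where
  "dual_sum a d = (\<Sum>k\<in>dual_line a d. cnj (\<psi> k))"

lemma sum_plane:
  assumes "k \<noteq> 0"
  shows "(\<Sum>x | tr (k * x) = 1. \<psi> x) = plane_sum * cnj (\<psi> k)"
proof -
  have "(\<Sum>x | tr (k * x) = 1. \<psi> x) = (\<Sum>x | tr x = 1. \<psi> (x / k))"
    by (rule sum.reindex_bij_witness[of _ "\<lambda>x. x / k" "\<lambda>x. k * x"]) (use assms in auto)
  thus ?thesis by (simp add: plane_sum_def \<psi>_divide sum_distrib_right)
qed

lemma sum_sum_plane:
  assumes "0 \<notin> D"
  shows "(\<Sum>x\<in>UNIV. \<psi> x * of_nat (card {k \<in> D. tr (k * x) = 1})) = plane_sum * (\<Sum>k\<in>D. cnj (\<psi> k))"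
proof -
  have "(\<Sum>x\<in>UNIV. \<psi> x * of_nat (card {k \<in> D. tr (k * x) = 1}))
      = (\<Sum>x\<in>UNIV. \<Sum>k\<in>D. if tr (k * x) = 1 then \<psi> x else 0)"
    by (rule sum.cong[OF refl]) (simp add: sum.If_cases Int_def)
  also have "\<dots> = (\<Sum>k\<in>D. \<Sum>x\<in>UNIV. if tr (k * x) = 1 then \<psi> x else 0)" by (rule sum.swap)
  also have "\<dots> = (\<Sum>k\<in>D. \<Sum>x | tr (k * x) = 1. \<psi> x)"
    by (rule sum.cong[OF refl]) (simp add: sum.If_cases)
  also have "\<dots> = (\<Sum>k\<in>D. plane_sum * cnj (\<psi> k))"
    using assms by (intro sum.cong[OF refl] sum_plane) auto
  finally show ?thesis by (simp add: sum_distrib_left)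
qed

lemma span2_scale:
  assumes "c \<in> F" "x \<in> span2 a d"
  shows "c * x \<in> span2 a d"
proof -
  obtain s t where "s \<in> F" "t \<in> F" "x = s * a + t * d" using assms by (auto simp: span2_def)
  hence "c * x = (c * s) * a + (c * t) * d" "c * s \<in> F" "c * t \<in> F" using assms by (auto simp: algebra_simps)
  thus ?thesis unfolding span2_def by blast
qed

text \<open>Count, for every point \<open>x\<close>, the planes through the line that contain \<open>x\<close> and avoid the origin.\<close>

lemma line_sum_duality:
  assumes ad: "indep a d"
  shows "of_nat q * line_sum a d = plane_sum * dual_sum a d"
proof -
  let ?l = "(\<lambda>t. a + t * d) ` F" and ?D = "dual_line a d"
  have d: "d \<noteq> 0" using ad by (simp add: indep_def)
  have card_D: "card ?D = q" unfolding dual_line_def using card_tr2[OF ad, of 0 1] by simp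
  have l_span: "?l \<subseteq> span2 a d"
  proof
    fix x assume "x \<in> ?l"
    then obtain t where "t \<in> F" "x = 1 * a + t * d" by auto
    thus "x \<in> span2 a d" unfolding span2_def using F_closed(2) by blast
  qed
  \<comment> \<open>Points of the line lie on all \<open>q\<close> planes, other points of the span
    on none, and points off the span on exactly one.\<close>
  have cnt: "card {k \<in> ?D. tr (k * x) = 1} = (if x \<in> ?l then q else 0) + (if x \<in> - span2 a d then 1 else 0)" for x
  proof (cases "x \<in> span2 a d")
    case True
    then obtain s t where st: "s \<in> F" "t \<in> F" "x = s * a + t * d" by (auto simp: span2_def)
    have *: "tr (k * x) = s" if "k \<in> ?D" for k
    proof -
      have "k * x = s * (k * a) + t * (k * d)" using st by (simp add: algebra_simps)
      thus ?thesis using that st by (simp add: tr_add tr_scale dual_line_def)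
    qed
    show ?thesis
    proof (cases "s = 1")
      case True
      hence "{k \<in> ?D. tr (k * x) = 1} = ?D" using * by auto
      moreover have "x \<in> ?l" using st True by auto
      ultimately show ?thesis using card_D \<open>x \<in> span2 a d\<close> by simp
    next
      case False
      hence "{k \<in> ?D. tr (k * x) = 1} = {}" using * by auto
      moreover have "x \<notin> ?l"
      proof
        assume "x \<in> ?l"
        then obtain t' where t': "t' \<in> F" "x = a + t' * d" by auto
        hence "(1 - s) * a = (t - t') * d" using st by (simp add: algebra_simps)
        hence "a = ((t - t') / (1 - s)) * d" using False by (simp add: field_simps)
        moreover have "(t - t') / (1 - s) \<in> F" using st t' by auto
        ultimately show False using ad unfolding indep_def by blast
      qed
      ultimately show ?thesis using \<open>x \<in> span2 a d\<close> by simp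
    qed
  next
    case False
    have "{k \<in> ?D. tr (k * x) = 1} = {k. tr (k * d) = 0 \<and> tr (k * a) = 1 \<and> tr (k * x) = 1}"
      by (auto simp: dual_line_def)
    thus ?thesis using card_tr3[OF ad False, of 0 1 1] False l_span by auto
  qed
  have "0 \<notin> ?D" by (simp add: dual_line_def)
  hence "plane_sum * dual_sum a d = (\<Sum>x\<in>UNIV. \<psi> x * of_nat (card {k \<in> ?D. tr (k * x) = 1}))"
    unfolding dual_sum_def by (rule sum_sum_plane[symmetric])
  also have "\<dots> = (\<Sum>x\<in>UNIV. (if x \<in> ?l then \<psi> x * of_nat q else 0) + (if x \<in> - span2 a d then \<psi> x else 0))"
    using cnt by (intro sum.cong refl) (simp add: distrib_left)
  also have "\<dots> = (\<Sum>x\<in>?l. \<psi> x * of_nat q) + (\<Sum>x\<in>- span2 a d. \<psi> x)"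
    by (simp add: sum.distrib sum.If_cases Compl_eq)
  also have "(\<Sum>x\<in>- span2 a d. \<psi> x) = 0"
  proof (rule sum_\<psi>_F_invariant)
    fix x c assume "c \<in> F" "c \<noteq> 0" "x \<in> - span2 a d"
    thus "c * x \<in> - span2 a d" using span2_scale[of "inverse c" "c * x" a d] by (auto simp: mult.assoc[symmetric])
  qed
  also have "(\<Sum>x\<in>?l. \<psi> x * of_nat q) = of_nat q * line_sum a d"
    unfolding line_sum_def using d
    by (subst sum.reindex) (auto simp: inj_on_def sum_distrib_left mult_ac)
  finally show ?thesis by simp
qed

text \<open>The same double count for the family of all \<open>k\<close> of trace 1: the point 1
  lies on all these planes, the rest of \<open>F\<close> on none, and every other point on
  \<open>q\<close>. The complement of \<open>F\<close> is invariant under scaling, so its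
  \<open>\<psi>\<close>-sum is 0.\<close>

lemma plane_sum_norm: "plane_sum * cnj plane_sum = of_nat (q\<^sup>2)"
proof -
  let ?D = "{k. tr k = 1}"
  have cnt: "card {k \<in> ?D. tr (k * x) = 1} = (if x = 1 then q\<^sup>2 else 0) + (if x \<in> - F then q else 0)" for x
  proof (cases "x \<in> F")
    case True
    have "tr (k * x) = x" if "k \<in> ?D" for k using that True tr_scale[of x k] by (simp add: mult.commute)
    hence "{k \<in> ?D. tr (k * x) = 1} = (if x = 1 then ?D else {})" by auto
    thus ?thesis using card_tr1[of 1 1] True by simp
  next
    case False
    hence "indep x 1" by (auto simp: indep_def)
    from card_tr2[OF this, of 1 1] have "card {k \<in> ?D. tr (k * x) = 1} = q" by simp
    thus ?thesis using False by auto
  qed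
  have "plane_sum * cnj plane_sum = plane_sum * (\<Sum>k\<in>?D. cnj (\<psi> k))" by (simp add: plane_sum_def)
  also have "\<dots> = (\<Sum>x\<in>UNIV. \<psi> x * of_nat (card {k \<in> ?D. tr (k * x) = 1}))"
    by (rule sum_sum_plane[symmetric]) simp
  also have "\<dots> = (\<Sum>x\<in>UNIV. (if x = 1 then of_nat (q\<^sup>2) else 0) + (if x \<in> - F then \<psi> x * of_nat q else 0))"
    using cnt by (intro sum.cong refl) simp
  also have "\<dots> = of_nat (q\<^sup>2) + (\<Sum>x\<in>- F. \<psi> x) * of_nat q"
    by (simp add: sum.distrib sum.If_cases Compl_eq sum_distrib_right)
  also have "(\<Sum>x\<in>- F. \<psi> x) = 0"
  proof (rule sum_\<psi>_F_invariant)
    fix x c assume "c \<in> F" "c \<noteq> 0" "x \<in> - F"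
    thus "c * x \<in> - F" using F_closed(5)[of "inverse c" "c * x"] by (auto simp: mult.assoc[symmetric])
  qed
  finally show ?thesis by simp
qed

end

context cubic_extension
begin

subsection \<open>The plane sum modulo a prime above \<open>p\<close>\<close>

text \<open>Restricted to Gaussian integers, this is the reduction modulo the prime ideal above \<open>p\<close>
  that takes the imaginary unit to \<open>-\<iota>\<close>.\<close>

definition red :: "complex \<Rightarrow> 'k" where
  "red z = of_int \<lfloor>Re z\<rfloor> - \<iota> * of_int \<lfloor>Im z\<rfloor>"

lemma red_\<psi>: "red (\<psi> x) = x ^ (3 * \<mu>)"
  unfolding red_def by (rule \<psi>_gauss)

lemma red_add:
  assumes "gauss_int z" "gauss_int w"
  shows "red (z + w) = red z + red w"
proof -
  obtain a b c d where "z = Complex (of_int a) (of_int b)" "w = Complex (of_int c) (of_int d)"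
    using assms gauss_int_iff by auto
  hence "\<lfloor>Re z + Re w\<rfloor> = \<lfloor>Re z\<rfloor> + \<lfloor>Re w\<rfloor>" "\<lfloor>Im z + Im w\<rfloor> = \<lfloor>Im z\<rfloor> + \<lfloor>Im w\<rfloor>"
    by simp_all
  thus ?thesis by (simp add: red_def algebra_simps)
qed

lemma red_sum: "(\<And>x. x \<in> A \<Longrightarrow> gauss_int (f x)) \<Longrightarrow> red (sum f A) = (\<Sum>x\<in>A. red (f x))"
proof (induction A rule: infinite_finite_induct)
  case (insert x A)
  have "gauss_int (f x)" "gauss_int (sum f A)" using insert.prems by auto
  thus ?case using insert by (simp add: red_add)
qed (auto simp: red_def)

text \<open>In base \<open>q\<close> all three digits of \<open>\<mu>\<close> are \<open>n\<close>,
  and numbers up to \<open>4 * n = q - 1\<close> are valid digits.\<close>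

lemma digits_unique:
  assumes "i \<le> 4 * n" "j \<le> 4 * n" "k \<le> 4 * n"
  shows "i + q * j + q\<^sup>2 * k = \<mu> \<longleftrightarrow> i = n \<and> j = n \<and> k = n"
proof
  have less: "i < q" "j < q" "n < q" using assms q_mod by auto
  assume "i + q * j + q\<^sup>2 * k = \<mu>"
  hence eq: "i + q * (j + q * k) = n + q * (n + q * n)"
    by (simp add: \<mu>_eq power2_eq_square algebra_simps)
  hence "(i + q * (j + q * k)) mod q = (n + q * (n + q * n)) mod q" by simp
  hence 1: "i = n" using less by simp
  hence 2: "j + q * k = n + q * n" using eq less by simp
  hence "(j + q * k) mod q = (n + q * n) mod q" by simp
  hence 3: "j = n" using less by simp
  hence "k = n" using 2 less by simp
  with 1 3 show "i = n \<and> j = n \<and> k = n" by simp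
qed (simp add: \<mu>_eq power2_eq_square algebra_simps)

text \<open>The power sum survives only if \<open>4 * \<mu>\<close> divides the exponent. The degree
  bound keeps the exponent below \<open>8 * \<mu>\<close>, so it must equal
  \<open>4 * \<mu>\<close>.\<close>

lemma sum_power_digits:
  assumes "i + j + k \<le> 4 * n"
  shows "(\<Sum>x\<in>UNIV. (x::'k) ^ (3 * \<mu> + (i + q * j + q\<^sup>2 * k))) = (if i = n \<and> j = n \<and> k = n then -1 else 0)"
proof -
  let ?e = "i + q * j + q\<^sup>2 * k"
  have "?e \<le> q\<^sup>2 * i + q\<^sup>2 * j + q\<^sup>2 * k"
    using q_gt_1 by (intro add_mono mult_right_mono) (auto simp: power2_eq_square)
  also have "\<dots> = q\<^sup>2 * (i + j + k)" by (simp add: algebra_simps)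
  also have "\<dots> \<le> q\<^sup>2 * (4 * n)" using assms by (intro mult_left_mono) auto
  also have "\<dots> < 5 * \<mu>" using n_pos by (simp add: \<mu>_eq algebra_simps)
  finally have e: "?e < 5 * \<mu>" .
  have "4 * \<mu> dvd 3 * \<mu> + ?e \<longleftrightarrow> ?e = \<mu>"
  proof
    assume "4 * \<mu> dvd 3 * \<mu> + ?e"
    then obtain c where c: "3 * \<mu> + ?e = 4 * \<mu> * c" by blast
    have "c \<noteq> 0" using c m_pos by (intro notI) simp
    moreover have "4 * \<mu> * c < 4 * \<mu> * 2" using c e by linarith
    hence "c < 2" by simp
    ultimately have "c = 1" by simp
    thus "?e = \<mu>" using c by simp
  qed simp
  also have "\<dots> \<longleftrightarrow> i = n \<and> j = n \<and> k = n" using assms by (intro digits_unique) auto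
  finally have "4 * \<mu> dvd 3 * \<mu> + ?e \<longleftrightarrow> i = n \<and> j = n \<and> k = n" .
  moreover have "3 * \<mu> + ?e > 0" using m_pos by simp
  ultimately show ?thesis using sum_power_general[where 'k='k, of "3 * \<mu> + ?e"] card_field by simp
qed

lemma tr_minus_1_power:
  "(tr x - 1) ^ (4 * n) = (\<Sum>i\<le>4*n. \<Sum>j\<le>4*n-i. \<Sum>k\<le>4*n-i-j.
     of_nat ((4*n choose i) * (4*n-i choose j) * (4*n-i-j choose k)) * (-1) ^ (4*n-i-j-k)
       * x ^ (i + q * j + q\<^sup>2 * k))"
proof -
  have mono: "x ^ (i + q * j + q\<^sup>2 * k) = x ^ i * ((x ^ q) ^ j * (x ^ q\<^sup>2) ^ k)" for i j k
    by (simp only: power_add power_mult mult.assoc)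
  have "(tr x - 1) ^ (4 * n) = (x + (x ^ q + (x ^ q\<^sup>2 + (-1)))) ^ (4 * n)"
    by (rule arg_cong[of _ _ "\<lambda>y. y ^ (4 * n)"]) (simp add: tr_def)
  also have "\<dots> = (\<Sum>i\<le>4*n. of_nat (4*n choose i) * x ^ i *
      (\<Sum>j\<le>4*n-i. of_nat (4*n-i choose j) * (x ^ q) ^ j *
        (\<Sum>k\<le>4*n-i-j. of_nat (4*n-i-j choose k) * (x ^ q\<^sup>2) ^ k * (-1) ^ (4*n-i-j-k))))"
    by (simp only: binomial_ring)
  also have "\<dots> = (\<Sum>i\<le>4*n. \<Sum>j\<le>4*n-i. \<Sum>k\<le>4*n-i-j.
     of_nat ((4*n choose i) * (4*n-i choose j) * (4*n-i-j choose k)) * (-1) ^ (4*n-i-j-k)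
       * x ^ (i + q * j + q\<^sup>2 * k))"
    unfolding sum_distrib_left mono by (intro sum.cong refl) (simp only: of_nat_mult mult_ac)
  finally show ?thesis .
qed

lemma sum_delta_constraint:
  fixes f :: "nat \<Rightarrow> nat \<Rightarrow> nat \<Rightarrow> 'k"
  shows "(\<Sum>i\<le>4*n. \<Sum>j\<le>4*n-i. \<Sum>k\<le>4*n-i-j. if i = n \<and> j = n \<and> k = n then f i j k else 0) = f n n n"
proof -
  have 1: "(\<Sum>k\<le>4*n-i-j. if i = n \<and> j = n \<and> k = n then f i j k else 0) = (if j = n then if i = n then f n n n else 0 else 0)" for i j
    by (cases "i = n \<and> j = n") auto
  have 2: "(\<Sum>j\<le>4*n-i. if j = n then if i = n then f n n n else 0 else 0) = (if i = n then f n n n else 0)" for i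
    by (cases "i = n") auto
  show ?thesis unfolding 1 2 by simp
qed

text \<open>The indicator of trace 1 is the polynomial \<open>1 - (tr x - 1) ^ (q - 1)\<close>.
  After multinomial expansion, only the term with \<open>i = j = k = n\<close> has a nonzero power
  sum.\<close>

lemma red_plane_sum:
  "red plane_sum = of_nat ((4 * n choose n) * (3 * n choose n) * (2 * n choose n)) * (-1) ^ n"
proof -
  have ind: "1 - (tr x - 1) ^ (4 * n) = (if tr x = 1 then 1 else 0)" for x
  proof (cases "tr x = 1")
    case False
    hence "(tr x - 1) ^ (4 * n) = 1" by (intro F_power_q1) auto
    thus ?thesis using False by simp
  qed (use n_pos in simp)
  have "red plane_sum = (\<Sum>x | tr x = 1. x ^ (3 * \<mu>))"
    unfolding plane_sum_def by (subst red_sum) (auto simp: red_\<psi>)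
  also have "\<dots> = (\<Sum>x\<in>UNIV. x ^ (3 * \<mu>) * (1 - (tr x - 1) ^ (4 * n)))"
    unfolding ind by (simp add: sum.If_cases if_distrib[of "\<lambda>y. _ * y"] cong: if_cong)
  also have "\<dots> = (\<Sum>x\<in>UNIV. x ^ (3 * \<mu>)) - (\<Sum>x\<in>UNIV. x ^ (3 * \<mu>) * (tr x - 1) ^ (4 * n))"
    by (simp add: right_diff_distrib sum_subtractf)
  also have "(\<Sum>x\<in>UNIV. (x::'k) ^ (3 * \<mu>)) = 0"
    using m_pos card_field by (intro sum_power_eq_0) auto
  also have "(\<Sum>x\<in>UNIV. x ^ (3 * \<mu>) * (tr x - 1) ^ (4 * n))
     = (\<Sum>x\<in>UNIV. \<Sum>i\<le>4*n. \<Sum>j\<le>4*n-i. \<Sum>k\<le>4*n-i-j.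
     of_nat ((4*n choose i) * (4*n-i choose j) * (4*n-i-j choose k)) * (-1) ^ (4*n-i-j-k)
       * x ^ (3 * \<mu> + (i + q * j + q\<^sup>2 * k)))"
    unfolding tr_minus_1_power sum_distrib_left power_add[of _ "3 * \<mu>"]
    by (intro sum.cong refl) (simp only: mult_ac)
  also have "\<dots> = (\<Sum>i\<le>4*n. \<Sum>x\<in>UNIV. \<Sum>j\<le>4*n-i. \<Sum>k\<le>4*n-i-j.
     of_nat ((4*n choose i) * (4*n-i choose j) * (4*n-i-j choose k)) * (-1) ^ (4*n-i-j-k)
       * x ^ (3 * \<mu> + (i + q * j + q\<^sup>2 * k)))"
    by (rule sum.swap)
  also have "\<dots> = (\<Sum>i\<le>4*n. \<Sum>j\<le>4*n-i. \<Sum>x\<in>UNIV. \<Sum>k\<le>4*n-i-j.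
     of_nat ((4*n choose i) * (4*n-i choose j) * (4*n-i-j choose k)) * (-1) ^ (4*n-i-j-k)
       * x ^ (3 * \<mu> + (i + q * j + q\<^sup>2 * k)))"
    by (intro sum.cong refl sum.swap)
  also have "\<dots> = (\<Sum>i\<le>4*n. \<Sum>j\<le>4*n-i. \<Sum>k\<le>4*n-i-j. \<Sum>x\<in>UNIV.
     of_nat ((4*n choose i) * (4*n-i choose j) * (4*n-i-j choose k)) * (-1) ^ (4*n-i-j-k)
       * x ^ (3 * \<mu> + (i + q * j + q\<^sup>2 * k)))"
    by (intro sum.cong refl sum.swap)
  also have "\<dots> = (\<Sum>i\<le>4*n. \<Sum>j\<le>4*n-i. \<Sum>k\<le>4*n-i-j.
     of_nat ((4*n choose i) * (4*n-i choose j) * (4*n-i-j choose k)) * (-1) ^ (4*n-i-j-k)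
       * (if i = n \<and> j = n \<and> k = n then -1 else 0))"
  proof (intro sum.cong refl)
    fix i j k assume "i \<in> {..4*n}" "j \<in> {..4*n-i}" "k \<in> {..4*n-i-j}"
    hence "i + j + k \<le> 4 * n" by auto
    thus "(\<Sum>x\<in>UNIV. of_nat ((4*n choose i) * (4*n-i choose j) * (4*n-i-j choose k)) * (-1) ^ (4*n-i-j-k)
        * x ^ (3 * \<mu> + (i + q * j + q\<^sup>2 * k)))
      = of_nat ((4*n choose i) * (4*n-i choose j) * (4*n-i-j choose k)) * (-1) ^ (4*n-i-j-k)
        * (if i = n \<and> j = n \<and> k = n then -1 else (0::'k))"
      by (simp only: sum_distrib_left[symmetric] sum_power_digits)
  qed
  also have "\<dots> = (\<Sum>i\<le>4*n. \<Sum>j\<le>4*n-i. \<Sum>k\<le>4*n-i-j. if i = n \<and> j = n \<and> k = n then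
     - (of_nat ((4*n choose i) * (4*n-i choose j) * (4*n-i-j choose k)) * (-1) ^ (4*n-i-j-k)) else 0)"
    by (intro sum.cong refl) simp
  also have "\<dots> = - (of_nat ((4*n choose n) * (4*n-n choose n) * (4*n-n-n choose n)) * (-1) ^ (4*n-n-n-n))"
    by (rule sum_delta_constraint)
  finally show ?thesis by simp
qed

text \<open>With \<open>E\<close> the plane sum, \<open>E * cnj E = q\<^sup>2\<close> and \<open>E\<close> does not vanish modulo one of the primes
  above \<open>p\<close>, so \<open>E + cnj E\<close> is prime to \<open>p\<close>; the duality makes \<open>E\<close> and \<open>cnj E\<close> times a product of
  two line sums divisible by \<open>q\<close>.\<close>

lemma line_sums_divisible_1_mod_4:
  assumes p: "p mod 4 = 1" and ad: "indep a d" and ad': "indep a' d'"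
  shows "\<exists>z. gauss_int z \<and> line_sum a d * cnj (line_sum a' d') = of_nat q * z"
proof -
  define L L' Y Y' where defs: "L = line_sum a d" "L' = line_sum a' d'" "Y = dual_sum a d" "Y' = dual_sum a' d'"
  let ?E = plane_sum
  have gauss: "gauss_int L" "gauss_int L'" "gauss_int Y" "gauss_int Y'" "gauss_int ?E"
    unfolding defs dual_sum_def plane_sum_def by auto
  have q0: "(of_nat q :: complex) \<noteq> 0" using q_gt_1 by simp
  obtain e1 e2 where e: "?E = Complex (of_int e1) (of_int e2)" using gauss(5) gauss_int_iff by auto
  have "e1\<^sup>2 + e2\<^sup>2 = int (q\<^sup>2)"
  proof -
    have "complex_of_real (of_int (e1\<^sup>2 + e2\<^sup>2)) = complex_of_real (of_int (int (q\<^sup>2)))"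
      using plane_sum_norm unfolding e by (simp add: complex_eq_iff power2_eq_square)
    thus ?thesis by (simp only: of_real_eq_iff of_int_eq_iff)
  qed
  moreover have "(of_nat q :: 'k) = 0"
    using CHAR_dvd_CARD[where 'a='k] prime_p char_p unfolding of_nat_eq_0_iff_char_dvd card_ext
    by (simp add: prime_dvd_power_iff)
  ultimately have "of_int (e1\<^sup>2 + e2\<^sup>2) = (0::'k)" by simp
  moreover have "of_int (e1\<^sup>2 + e2\<^sup>2) = (of_int e1 + \<iota> * of_int e2) * (of_int e1 - \<iota> * of_int e2 :: 'k)"
  proof -
    have "(of_int e1 + \<iota> * of_int e2) * (of_int e1 - \<iota> * of_int e2)
       = of_int e1 * of_int e1 - (\<iota> * \<iota>) * (of_int e2 * of_int e2)" by (simp add: algebra_simps)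
    thus ?thesis by (simp add: \<iota>_square power2_eq_square)
  qed
  moreover have red: "of_int e1 - \<iota> * of_int e2 \<noteq> 0"
  proof -
    obtain c where "p = 4 * c + 1" using p by (metis mod_mult_div_eq add.commute)
    hence "\<not> p dvd (4 * n choose n) * (3 * n choose n) * (2 * n choose n)"
      using multinomial_quarter_not_dvd[OF prime_p, of c r n] q_eq q_mod by simp
    hence "(of_nat ((4 * n choose n) * (3 * n choose n) * (2 * n choose n)) :: 'k) \<noteq> 0"
      by (simp only: of_nat_eq_0_iff_char_dvd char_p) simp
    hence "red ?E \<noteq> 0" unfolding red_plane_sum by simp
    thus ?thesis by (simp add: red_def e)
  qed
  \<comment> \<open>The norm vanishes in characteristic \<open>p\<close> but the reduction of
    \<open>plane_sum\<close> does not, so the conjugate factor vanishes. Hence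
    \<open>2 * e1\<close>, which is \<open>plane_sum + cnj plane_sum\<close>, is prime to
    \<open>p\<close>.\<close>
  ultimately have "of_int e1 + \<iota> * of_int e2 = 0" by simp
  hence "of_int (2 * e1) = of_int e1 - \<iota> * of_int e2" by (simp add: algebra_simps eq_neg_iff_add_eq_0)
  hence "of_int (2 * e1) \<noteq> (0::'k)" using red by simp
  hence "\<not> int p dvd 2 * e1" by (simp only: of_int_eq_0_iff_char_dvd char_p) simp
  hence "coprime (int p) (2 * e1)"
    by (rule prime_imp_coprime[rotated]) (use prime_p in simp)
  hence "coprime (int q) (2 * e1)" unfolding q_eq of_nat_power by (rule coprime_power_left_iff[THEN iffD2, OF disjI1])
  hence "gcd (2 * e1) (int q) = 1" by (metis coprime_commute coprime_imp_gcd_eq_1)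
  then obtain s t where st: "s * (2 * e1) + t * int q = 1"
    using bezout_int[of "2 * e1" "int q"] by metis
  have 1: "of_nat q * L = ?E * Y" and 2: "of_nat q * cnj L' = cnj ?E * cnj Y'"
    using line_sum_duality[OF ad] arg_cong[OF line_sum_duality[OF ad'], of cnj] by (simp_all add: defs)
  have "of_nat q * (cnj ?E * L) = (?E * cnj ?E) * Y" using 1 by (simp add: mult_ac)
  hence 3: "cnj ?E * L = of_nat q * Y" using q0 by (simp add: plane_sum_norm power2_eq_square)
  have "of_nat q * (?E * cnj L') = (?E * cnj ?E) * cnj Y'" using 2 by (simp add: mult_ac)
  hence 4: "?E * cnj L' = of_nat q * cnj Y'" using q0 by (simp add: plane_sum_norm power2_eq_square)
  define W where "W = L * cnj Y' + Y * cnj L'"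
  have "of_int (2 * e1) = ?E + cnj ?E" by (simp add: e complex_eq_iff)
  hence "of_int (2 * e1) * (L * cnj L') = L * (?E * cnj L') + (cnj ?E * L) * cnj L'" by (simp add: algebra_simps)
  hence 5: "of_int (2 * e1) * (L * cnj L') = of_nat q * W" unfolding 3 4 W_def by (simp add: algebra_simps)
  have "L * cnj L' = of_int (s * (2 * e1) + t * int q) * (L * cnj L')" by (simp add: st)
  also have "\<dots> = of_int s * (of_int (2 * e1) * (L * cnj L')) + of_nat q * (of_int t * (L * cnj L'))"
    by (simp add: algebra_simps)
  also have "\<dots> = of_nat q * (of_int s * W + of_int t * (L * cnj L'))" unfolding 5 by (simp add: algebra_simps)
  finally have "L * cnj L' = of_nat q * (of_int s * W + of_int t * (L * cnj L'))" .
  moreover have "gauss_int (of_int s * W + of_int t * (L * cnj L'))"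
    unfolding W_def by (intro gauss_int_ops gauss_int_unary gauss gauss_int_basic)
  ultimately show ?thesis unfolding defs by blast
qed

end

subsection \<open>A cubic extension of a finite field\<close>

text \<open>Since \<open>t \<mapsto> t ^ 3 - t\<close> takes the value 0 at both 0 and 1, it is not surjective.\<close>

lemma exists_irreducible_cubic: "\<exists>c::'a::{field,finite}. \<forall>t. t ^ 3 - t \<noteq> c"
proof (rule ccontr)
  assume "\<not> ?thesis"
  hence "\<forall>c. \<exists>t::'a. c = t ^ 3 - t" by metis
  hence "surj (\<lambda>t::'a. t ^ 3 - t)" unfolding surj_def .
  hence "inj (\<lambda>t::'a. t ^ 3 - t)" by (simp add: finite_UNIV_surj_inj)
  hence "(0::'a) = 1" by (rule injD) simp
  thus False by simp
qed

definition cubic_const :: "'a::{field,finite}" where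
  "cubic_const = (SOME c. \<forall>t. t ^ 3 - t \<noteq> c)"

lemma cubic_const: "t ^ 3 - t \<noteq> (cubic_const :: 'a::{field,finite})"
  unfolding cubic_const_def using someI_ex[OF exists_irreducible_cubic] by blast

text \<open>\<open>Cubic a b c\<close> stands for \<open>a + b \<tau> + c \<tau>\<^sup>2\<close>, where \<open>\<tau> ^ 3 = \<tau> + cubic_const\<close>.\<close>

datatype 'a cubic = Cubic (c0: 'a) (c1: 'a) (c2: 'a)

lemma cubic_eq_iff: "x = y \<longleftrightarrow> c0 x = c0 y \<and> c1 x = c1 y \<and> c2 x = c2 y"
  by (cases x; cases y) auto

instantiation cubic :: ("{field,finite}") comm_ring_1
begin

definition "0 = Cubic 0 0 0"
definition "1 = Cubic 1 0 0"
definition "x + y = Cubic (c0 x + c0 y) (c1 x + c1 y) (c2 x + c2 y)"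
definition "x - y = Cubic (c0 x - c0 y) (c1 x - c1 y) (c2 x - c2 y)"
definition "- x = Cubic (- c0 x) (- c1 x) (- c2 x)"
definition "x * y = Cubic
  (c0 x * c0 y + cubic_const * (c1 x * c2 y + c2 x * c1 y))
  (c0 x * c1 y + c1 x * c0 y + (c1 x * c2 y + c2 x * c1 y) + cubic_const * (c2 x * c2 y))
  (c0 x * c2 y + c1 x * c1 y + c2 x * c0 y + c2 x * c2 y)"

instance
proof
  fix x y z :: "'a cubic"
  note [simp] = cubic_eq_iff zero_cubic_def one_cubic_def plus_cubic_def minus_cubic_def
      uminus_cubic_def times_cubic_def
  show "x * y * z = x * (y * z)" by (simp add: distrib_left distrib_right add_ac mult_ac)
  show "x * y = y * x" by (simp add: add_ac mult_ac)
  show "(x + y) * z = x * z + y * z" by (simp add: distrib_left distrib_right add_ac mult_ac)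
qed (simp_all add: cubic_eq_iff zero_cubic_def one_cubic_def plus_cubic_def minus_cubic_def
      uminus_cubic_def times_cubic_def add_ac)

end

lemmas cubic_defs = zero_cubic_def one_cubic_def plus_cubic_def minus_cubic_def
  uminus_cubic_def times_cubic_def

text \<open>With \<open>s = - a / b\<close> the root of the linear factor, comparing coefficients
  gives \<open>cubic_const * w = (s ^ 3 - s) * w\<close>, which the choice of
  \<open>cubic_const\<close> allows only for \<open>w = 0\<close>.\<close>

lemma cubic_mult_linear_eq_0:
  fixes y :: "'a::{field,finite} cubic"
  assumes "Cubic a b 0 * y = 0" "a \<noteq> 0 \<or> b \<noteq> 0"
  shows "y = 0"
proof (cases "b = 0")
  case True
  thus ?thesis using assms by (cases y) (auto simp: cubic_defs)
next
  case False
  obtain u v w where y: "y = Cubic u v w" by (cases y)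
  define s where "s = - a / b"
  have a: "a = - s * b" using False by (simp add: s_def)
  have "b * (cubic_const * w - s * u) = 0" "b * (u + w - s * v) = 0" "b * (v - s * w) = 0"
    using assms(1) unfolding y a by (auto simp: cubic_defs algebra_simps)
  hence "cubic_const * w - s * u = 0" "u + w - s * v = 0" "v - s * w = 0"
    using False by (simp_all only: mult_eq_0_iff simp_thms)
  hence *: "cubic_const * w = s * u" "u = s * v - w" "v = s * w" by (auto simp: algebra_simps)
  hence "cubic_const * w = (s ^ 3 - s) * w" by (simp add: power3_eq_cube algebra_simps)
  hence "w = 0" using cubic_const[of s] by auto
  thus ?thesis using * by (simp add: y zero_cubic_def)
qed

text \<open>Multiplying a quadratic \<open>x\<close> by \<open>- b + c \<tau>\<close> removes its
  \<tau>-square term and reduces to a linear factor.\<close>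

lemma cubic_no_zero_divisors:
  fixes x y :: "'a::{field,finite} cubic"
  assumes "x * y = 0" "x \<noteq> 0"
  shows "y = 0"
proof -
  obtain a b c where x: "x = Cubic a b c" by (cases x)
  show ?thesis
  proof (cases "c = 0")
    case True
    thus ?thesis using assms unfolding x by (intro cubic_mult_linear_eq_0[of a b y]) (auto simp: zero_cubic_def)
  next
    case False
    let ?r = "Cubic (- b) c 0"
    have lin: "c2 (?r * x) = 0" by (simp add: x times_cubic_def mult.commute)
    have "?r * x \<noteq> 0" using cubic_mult_linear_eq_0[of "- b" c x] assms(2) False by auto
    moreover have "?r * x = Cubic (c0 (?r * x)) (c1 (?r * x)) 0" using lin by (simp add: cubic_eq_iff)
    moreover have "?r * x * y = 0" using assms(1) by (simp add: mult.assoc)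
    ultimately show ?thesis
      using cubic_mult_linear_eq_0[of "c0 (?r * x)" "c1 (?r * x)" y]
      by (metis zero_cubic_def)
  qed
qed

lemma finite_UNIV_cubic: "finite (UNIV :: 'a::finite cubic set)"
  and card_UNIV_cubic: "CARD('a::finite cubic) = CARD('a) ^ 3"
proof -
  have bij: "bij_betw (\<lambda>(a, b, c). Cubic a b c) UNIV (UNIV :: 'a cubic set)"
    by (rule bij_betwI[of _ _ _ "\<lambda>x. (c0 x, c1 x, c2 x)"]) auto
  show "finite (UNIV :: 'a cubic set)" using bij_betw_finite[OF bij] by simp
  show "CARD('a cubic) = CARD('a) ^ 3"
    using bij_betw_same_card[OF bij] by (simp add: power3_eq_cube flip: UNIV_Times_UNIV)
qed

instance cubic :: (finite) finite
  by standard (rule finite_UNIV_cubic)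

instantiation cubic :: ("{field,finite}") field
begin

definition "inverse x = (if x = 0 then 0 else SOME y. x * y = (1 :: 'a cubic))"
definition "x div y = x * inverse (y :: 'a cubic)"

instance
proof
  fix x :: "'a cubic"
  assume x: "x \<noteq> 0"
  have "inj ((*) x)"
  proof (rule injI)
    fix y z assume "x * y = x * z"
    hence "x * (y - z) = 0" by (simp add: right_diff_distrib)
    thus "y = z" using cubic_no_zero_divisors x by fastforce
  qed
  hence "surj ((*) x)" by (simp add: finite_UNIV_inj_surj)
  hence "\<exists>y. x * y = 1" by (metis surj_def)
  hence "x * inverse x = 1" using x unfolding inverse_cubic_def by (auto intro: someI_ex)
  thus "inverse x * x = 1" by (simp add: mult.commute)
qed (auto simp: inverse_cubic_def divide_cubic_def)

end

definition emb :: "'a::{field,finite} \<Rightarrow> 'a cubic" where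
  "emb a = Cubic a 0 0"

lemma emb_simps [simp]:
  "emb 0 = 0" "emb 1 = 1" "emb (a + b) = emb a + emb b" "emb (a - b) = emb a - emb b"
  "emb (a * b) = emb a * emb b" "emb (- a) = - emb a"
  by (simp_all add: emb_def cubic_defs)

lemma emb_power [simp]: "emb (a ^ n) = emb a ^ n"
  by (induction n) auto

lemma emb_eq_iff [simp]: "emb a = emb b \<longleftrightarrow> a = b"
  by (simp add: emb_def)

lemma emb_eq_1_iff [simp]: "emb a = 1 \<longleftrightarrow> a = 1"
  using emb_eq_iff[of a 1] by (simp del: emb_eq_iff)

lemma inj_emb: "inj emb"
  by (simp add: inj_def)

subsection \<open>The weight function\<close>

context cubic_extension
begin

lemma exists_weight:
  assumes div: "\<And>a d a' d'. indep a d \<Longrightarrow> indep a' d' \<Longrightarrow>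
      \<exists>z. gauss_int z \<and> line_sum a d * cnj (line_sum a' d') = of_nat q * z"
  shows "\<exists>g::'k \<Rightarrow> real. (\<forall>a d. d \<noteq> 0 \<longrightarrow> (\<Sum>t\<in>F. g (a + t * d)) \<in> {0, 1})
    \<and> (\<Sum>x\<in>UNIV. g x) = (real q ^ 2 - 1) / 2"
proof -
  obtain \<gamma> where \<gamma>: "\<gamma> * cnj \<gamma> = of_nat q" "\<And>a d. indep a d \<Longrightarrow> \<exists>u\<in>{1, \<i>, -1, -\<i>}. line_sum a d = u * \<gamma>"
    using line_sum_constant_up_to_units[OF div] by blast
  have \<gamma>0: "\<gamma> \<noteq> 0" using \<gamma>(1) q_gt_1 by auto
  have q0: "real q \<noteq> 0" using q_gt_1 by simp
  \<comment> \<open>For a fourth root of unity \<open>u\<close>,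
    \<open>2 * Re (\<beta> * (u * \<gamma>))\<close> is half of \<open>Re ((1 + \<i>) * u)\<close>,
    so it is 1/2 or -1/2. Together with the constant part 1/2 this gives line sum 1 or 0.\<close>
  define \<beta> where "\<beta> = (1 + \<i>) / (4 * \<gamma>)"
  define h where "h x = 1 / (2 * real q) + 2 * Re (\<beta> * \<psi> x)" for x
  \<comment> \<open>The value at 0 is \<open>h 0 - 1/2\<close>, since lines through 0 have
    \<open>h\<close>-sum 1/2 and are to get weight 0.\<close>
  define g where "g x = (if x = 0 then - (real q - 1) / (2 * real q) else h x)" for x
  have sum_h: "(\<Sum>x\<in>A. h (f x)) = real (card A) / (2 * real q) + 2 * Re (\<beta> * (\<Sum>x\<in>A. \<psi> (f x)))"
    for A and f :: "'k \<Rightarrow> 'k"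
    unfolding h_def sum.distrib by (simp add: sum_distrib_left)
  have g0: "(\<Sum>x\<in>A. g (f x)) = - (real q - 1) / (2 * real q) + (\<Sum>x\<in>A. h (f x)) - 1 / (2 * real q)"
    if "0 \<in> A" "\<And>x. x \<in> A \<Longrightarrow> f x = 0 \<longleftrightarrow> x = 0" for A and f :: "'k \<Rightarrow> 'k"
  proof -
    have "(\<Sum>x\<in>A. g (f x)) = g (f 0) + (\<Sum>x\<in>A-{0}. g (f x))" using that by (intro sum.remove) auto
    also have "(\<Sum>x\<in>A-{0}. g (f x)) = (\<Sum>x\<in>A-{0}. h (f x))" using that by (intro sum.cong) (auto simp: g_def)
    also have "\<dots> = (\<Sum>x\<in>A. h (f x)) - h (f 0)" using that by (simp add: sum_diff1)
    also have "f 0 = 0" using that by blast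
    finally show ?thesis by (simp add: g_def h_def[of 0])
  qed
  have "(\<Sum>t\<in>F. g (a + t * d)) \<in> {0, 1}" if d: "d \<noteq> 0" for a d
  proof (cases "indep a d")
    case True
    have "(\<Sum>t\<in>F. g (a + t * d)) = (\<Sum>t\<in>F. h (a + t * d))"
      using indep_nonzero[OF True] by (intro sum.cong) (auto simp: g_def)
    also have "\<dots> = 1 / 2 + 2 * Re (\<beta> * line_sum a d)"
      using q0 by (simp add: sum_h card_F line_sum_def)
    finally have s: "(\<Sum>t\<in>F. g (a + t * d)) = 1 / 2 + 2 * Re (\<beta> * line_sum a d)" .
    obtain u where u: "u \<in> {1, \<i>, -1, -\<i>}" "line_sum a d = u * \<gamma>" using \<gamma>(2)[OF True] by blast
    have bl: "\<beta> * line_sum a d = (1 + \<i>) * u / 4" using \<gamma>0 by (simp add: \<beta>_def u(2))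
    show ?thesis unfolding s bl using u(1) by auto
  next
    case False
    then obtain s where s: "s \<in> F" "a = s * d" using d by (auto simp: indep_def)
    have "(\<Sum>t\<in>F. g (a + t * d)) = (\<Sum>t\<in>F. g (t * d))"
      by (rule sum.reindex_bij_witness[of _ "\<lambda>t. t - s" "\<lambda>t. s + t"]) (use s in \<open>auto simp: algebra_simps\<close>)
    also have "\<dots> = - (real q - 1) / (2 * real q) + (\<Sum>t\<in>F. h (t * d)) - 1 / (2 * real q)"
      using d by (intro g0) auto
    also have "(\<Sum>t\<in>F. \<psi> (t * d)) = 0"
      using line_sum_dependent[of 0 d] by (simp add: line_sum_def)
    hence "(\<Sum>t\<in>F. h (t * d)) = real q / (2 * real q)" by (simp add: sum_h card_F)
    finally show ?thesis using q0 by (simp add: field_simps)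
  qed
  moreover have "(\<Sum>x\<in>UNIV. g x) = (real q ^ 2 - 1) / 2"
  proof -
    have "(\<Sum>x\<in>UNIV. g x) = - (real q - 1) / (2 * real q) + (\<Sum>x\<in>UNIV. h x) - 1 / (2 * real q)"
      using g0[of UNIV "\<lambda>x. x"] by simp
    also have "(\<Sum>x\<in>UNIV. h x) = real q ^ 3 / (2 * real q)"
      using sum_h[of "\<lambda>x. x" UNIV] by (simp add: card_ext sum_\<psi>_UNIV)
    finally have "(\<Sum>x\<in>UNIV. g x) = - (real q - 1) / (2 * real q) + real q ^ 3 / (2 * real q) - 1 / (2 * real q)" .
    also have "\<dots> = (real q ^ 2 - 1) / 2" using q0 by (simp add: field_simps power3_eq_cube power2_eq_square)
    finally show ?thesis .
  qed
  ultimately show ?thesis by blast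
qed

end

subsection \<open>Descent of line sums to the base field\<close>

text \<open>\<open>X ^ q - X\<close> has at most \<open>q\<close> roots, and the embedded base field
  already supplies that many.\<close>

lemma fixed_field_cubic: "{x::'a::{field,finite} cubic. x ^ CARD('a) = x} = range emb"
proof (rule sym, rule card_seteq)
  let ?q = "CARD('a)"
  have q: "?q > 1" using card_mono[of UNIV "{0::'a, 1}"] by simp
  show "range emb \<subseteq> {x::'a cubic. x ^ ?q = x}"
  proof
    fix x :: "'a cubic" assume "x \<in> range emb"
    then obtain y where "x = emb y" by blast
    thus "x \<in> {x. x ^ ?q = x}" using emb_power[of y ?q] finite_field_power_card[of y] by simp
  qed
  let ?P = "monom 1 ?q - monom 1 1 :: 'a cubic poly"
  have "coeff ?P ?q = 1" using q by simp
  hence "?P \<noteq> 0" by (metis coeff_0 zero_neq_one)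
  moreover have "degree ?P \<le> ?q"
    using q by (intro degree_diff_le) (auto intro: order.trans[OF degree_monom_le])
  ultimately have "card {x. poly ?P x = 0} \<le> ?q" using card_poly_roots_bound[of ?P] by linarith
  thus "card {x::'a cubic. x ^ ?q = x} \<le> card (range (emb :: 'a \<Rightarrow> 'a cubic))"
    using card_image[OF inj_emb[where ?'a = 'a]] by (simp add: poly_monom)
qed simp

context
  fixes \<iota> :: "'a::{field,finite}" and n p r :: nat
  assumes quartic: "quartic_field \<iota> n" and prime: "prime p" and card_a: "CARD('a) = p ^ r"
begin

definition \<mu>3 :: nat where "\<mu>3 = n * (1 + CARD('a) + CARD('a)\<^sup>2)"

lemma cubic_extension_emb: "cubic_extension (emb \<iota>) \<mu>3 p r (CARD('a)) n"
proof -
  interpret a: quartic_field \<iota> n by (rule quartic)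
  have "CARD('a cubic) = 4 * \<mu>3 + 1"
    unfolding card_UNIV_cubic \<mu>3_def a.card_field
    by (simp add: power3_eq_cube power2_eq_square algebra_simps)
  moreover have "emb \<iota> * emb \<iota> = - 1"
    using arg_cong[OF a.\<iota>_square, of emb] by simp
  moreover have "card {x::'a cubic. x ^ CARD('a) = x} = CARD('a)"
    unfolding fixed_field_cubic by (simp add: card_image inj_emb)
  ultimately show ?thesis
    using prime card_a a.card_field by unfold_locales (simp_all add: card_UNIV_cubic)
qed

interpretation a: quartic_field \<iota> n by (rule quartic)
interpretation K: cubic_extension "emb \<iota>" \<mu>3 p r "CARD('a)" n by (rule cubic_extension_emb)

lemma F_eq: "K.F = range emb"
  unfolding K.F_def by (rule fixed_field_cubic)

text \<open>The exponent \<open>\<mu>3\<close> is \<open>n\<close> times the norm exponent, so the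
  quartic character of the extension is that of the base field composed with the norm.\<close>

lemma quartic_char_norm:
  assumes "x ^ (1 + CARD('a) + CARD('a)\<^sup>2) = emb y"
  shows "quartic_char (emb \<iota>) x = quartic_char \<iota> y"
proof -
  have "x ^ \<mu>3 = (x ^ (1 + CARD('a) + CARD('a)\<^sup>2)) ^ n"
    unfolding \<mu>3_def by (simp only: power_mult[symmetric] mult.commute)
  also have "\<dots> = emb (y ^ n)" unfolding assms by simp
  finally have x: "x ^ \<mu>3 = emb (y ^ n)" .
  have "emb z = - 1 \<longleftrightarrow> z = -1" "emb z = - emb \<iota> \<longleftrightarrow> z = - \<iota>" for z
    using emb_eq_iff[of z "-1"] emb_eq_iff[of z "-\<iota>"] by (simp_all del: emb_eq_iff)
  thus ?thesis unfolding K.\<psi>_unfold a.\<psi>_unfold x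
    by (simp only: emb_eq_iff emb_eq_1_iff)
qed

text \<open>With \<open>\<theta> = x / d\<close>, the norm of \<open>\<theta> + emb t\<close> is a
  monic cubic in \<open>t\<close>, whose coefficients are the symmetric functions of the conjugates
  of \<open>\<theta>\<close>. A root would put 0 on the line.\<close>

lemma line_sum_cubic_sum:
  assumes "K.indep x d"
  shows "\<exists>u v w. (\<forall>t. t ^ 3 + u * t * t + v * t + w \<noteq> 0) \<and>
    K.line_sum x d = quartic_char (emb \<iota>) d * (\<Sum>t\<in>UNIV. quartic_char \<iota> (t ^ 3 + u * t * t + v * t + w))"
proof -
  let ?q = "CARD('a)"
  define \<theta> where "\<theta> = x / d"
  have d: "d \<noteq> 0" using assms by (simp add: K.indep_def)
  define \<theta>1 where "\<theta>1 = \<theta> ^ ?q"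
  define \<theta>2 where "\<theta>2 = \<theta>1 ^ ?q"
  have q2: "y ^ ?q\<^sup>2 = (y ^ ?q) ^ ?q" for y :: "'a cubic" by (rule K.power_q2)
  have \<theta>3: "\<theta>2 ^ ?q = \<theta>"
    using K.power_q3[of \<theta>] by (simp add: \<theta>1_def \<theta>2_def power_mult[symmetric] power3_eq_cube)
  have pow: "\<theta> ^ ?q = \<theta>1" "\<theta>1 ^ ?q = \<theta>2" by (simp_all add: \<theta>1_def \<theta>2_def)
  have "\<theta> + \<theta>1 + \<theta>2 \<in> K.F" "\<theta> * \<theta>1 + \<theta> * \<theta>2 + \<theta>1 * \<theta>2 \<in> K.F" "\<theta> * \<theta>1 * \<theta>2 \<in> K.F"
    by (simp_all add: K.F_def K.frobenius_add power_mult_distrib pow \<theta>3)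
  then obtain u v w where uvw: "\<theta> + \<theta>1 + \<theta>2 = emb u" "\<theta> * \<theta>1 + \<theta> * \<theta>2 + \<theta>1 * \<theta>2 = emb v" "\<theta> * \<theta>1 * \<theta>2 = emb w"
    unfolding F_eq by auto
  have nrm: "(\<theta> + emb t) ^ (1 + ?q + ?q\<^sup>2) = emb (t ^ 3 + u * t * t + v * t + w)" for t
  proof -
    have e: "emb t ^ ?q = emb t" using emb_power[of t ?q] finite_field_power_card[of t] by simp
    have "(\<theta> + emb t) ^ (1 + ?q + ?q\<^sup>2) = (\<theta> + emb t) * (\<theta>1 + emb t) * (\<theta>2 + emb t)"
      by (simp only: power_add power_one_right q2 K.frobenius_add e pow)
    also have "\<dots> = emb t ^ 3 + (\<theta> + \<theta>1 + \<theta>2) * emb t * emb t + (\<theta> * \<theta>1 + \<theta> * \<theta>2 + \<theta>1 * \<theta>2) * emb t + \<theta> * \<theta>1 * \<theta>2"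
      by (simp add: power3_eq_cube algebra_simps)
    finally show ?thesis unfolding uvw by simp
  qed
  have "t ^ 3 + u * t * t + v * t + w \<noteq> 0" for t
  proof
    assume "t ^ 3 + u * t * t + v * t + w = 0"
    hence "(\<theta> + emb t) ^ (1 + ?q + ?q\<^sup>2) = 0" unfolding nrm by (simp only: emb_simps)
    hence "\<theta> + emb t = 0" by simp
    hence "x + emb t * d = 0" using d by (simp add: \<theta>_def field_simps)
    moreover have "emb t \<in> K.F" unfolding F_eq by blast
    ultimately show False using K.indep_nonzero[OF assms] by blast
  qed
  moreover have "K.line_sum x d = quartic_char (emb \<iota>) d * (\<Sum>t\<in>UNIV. quartic_char \<iota> (t ^ 3 + u * t * t + v * t + w))"
  proof -
    have "K.line_sum x d = (\<Sum>t\<in>UNIV. quartic_char (emb \<iota>) (x + emb t * d))"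
      unfolding K.line_sum_def F_eq by (subst sum.reindex) (auto intro: inj_emb)
    also have "\<dots> = (\<Sum>t\<in>UNIV. quartic_char (emb \<iota>) d * quartic_char (emb \<iota>) (\<theta> + emb t))"
      using d by (simp add: K.\<psi>_mult[symmetric] \<theta>_def distrib_left mult.commute)
    also have "\<dots> = (\<Sum>t\<in>UNIV. quartic_char (emb \<iota>) d * quartic_char \<iota> (t ^ 3 + u * t * t + v * t + w))"
      by (simp only: quartic_char_norm[OF nrm])
    finally show ?thesis by (simp only: sum_distrib_left)
  qed
  ultimately show ?thesis by blast
qed

text \<open>For \<open>p\<close> not 1 modulo 4 each single line sum is a multiple of
  \<open>3 ^ k\<close>, and \<open>3 ^ k * 3 ^ k\<close> is the size of the base field.\<close>

lemma line_sums_divisible: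
  assumes "p mod 4 = 1 \<or> (\<exists>k. CARD('a) = 9 ^ k)" "K.indep x d" "K.indep x' d'"
  shows "\<exists>z. gauss_int z \<and> K.line_sum x d * cnj (K.line_sum x' d') = of_nat (CARD('a)) * z"
proof (cases "p mod 4 = 1")
  case True
  thus ?thesis using K.line_sums_divisible_1_mod_4 assms by blast
next
  case False
  then obtain k where k: "CARD('a) = 9 ^ k" using assms by blast
  interpret c: char3_field \<iota> n k by unfold_locales (rule k)
  have *: "\<exists>z. gauss_int z \<and> K.line_sum x d = 3 ^ k * z" if ind: "K.indep x d" for x d
  proof -
    obtain u v w where uvw: "\<And>t. t ^ 3 + u * t * t + v * t + w \<noteq> 0"
      "K.line_sum x d = quartic_char (emb \<iota>) d * c.cubic_sum u v w"
      using line_sum_cubic_sum[OF ind] unfolding c.cubic_sum_def by blast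
    obtain z where z: "gauss_int z" "c.cubic_sum u v w = 3 ^ k * z" using c.cubic_sum_divisible[OF uvw(1)] by blast
    have "K.line_sum x d = 3 ^ k * (quartic_char (emb \<iota>) d * z)" unfolding uvw(2) z(2) by simp
    thus ?thesis using gauss_int_ops(3)[OF K.gauss_int_\<psi> z(1)] by blast
  qed
  obtain z z' where z: "gauss_int z" "K.line_sum x d = 3 ^ k * z" "gauss_int z'" "K.line_sum x' d' = 3 ^ k * z'"
    using * assms by meson
  have "of_nat (CARD('a)) = (3 ^ k * 3 ^ k :: complex)" by (simp add: k power_mult_distrib[symmetric])
  moreover have "K.line_sum x d * cnj (K.line_sum x' d') = 3 ^ k * 3 ^ k * (z * cnj z')"
    unfolding z(2,4) by simp
  ultimately have "K.line_sum x d * cnj (K.line_sum x' d') = of_nat (CARD('a)) * (z * cnj z')" by simp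
  thus ?thesis using gauss_int_ops(3)[OF z(1) gauss_int_unary(2)[OF z(3)]] by blast
qed

lemma exists_weight_cubic:
  assumes "p mod 4 = 1 \<or> (\<exists>k. CARD('a) = 9 ^ k)"
  shows "\<exists>g::'a cubic \<Rightarrow> real. (\<forall>x d. d \<noteq> 0 \<longrightarrow> (\<Sum>t\<in>UNIV. g (x + emb t * d)) \<in> {0, 1})
    \<and> (\<Sum>x\<in>UNIV. g x) = (real (CARD('a)) ^ 2 - 1) / 2"
proof -
  have "(\<Sum>t\<in>K.F. g (x + t * d)) = (\<Sum>t\<in>UNIV. g (x + emb t * d))" for g :: "'a cubic \<Rightarrow> real" and x d
    unfolding F_eq by (subst sum.reindex) (auto intro: inj_emb)
  thus ?thesis using K.exists_weight[OF line_sums_divisible[OF assms]] by simp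
qed

end

subsection \<open>Cameron--Liebler line classes from weights\<close>

lemma cameron_liebler_of_weight:
  fixes g :: "('a::{field,finite}) ^ 3 \<Rightarrow> real"
  assumes line: "\<And>l. l \<in> ag3_lines \<Longrightarrow> sum g l \<in> {0, 1}"
    and total: "sum g UNIV = real x"
  shows "cameron_liebler_line_class {l \<in> ag3_lines. sum g l = 1} x"
  unfolding cameron_liebler_line_class_def
proof (intro conjI allI impI)
  fix S :: "('a ^ 3) set set"
  assume "line_spread S"
  hence S: "S \<subseteq> ag3_lines" "\<Union>S = UNIV" "disjoint S"
    by (auto simp: line_spread_def partition_on_def)
  have "real x = sum g (\<Union>S)" using total S by simp
  also have "\<dots> = (\<Sum>l\<in>S. sum g l)"
    using S(3) by (subst sum.Union_disjoint) (auto simp: disjoint_def)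
  also have "\<dots> = (\<Sum>l\<in>S. if l \<in> {l \<in> ag3_lines. sum g l = 1} then 1 else 0)"
    using line S(1) by (intro sum.cong) auto
  also have "\<dots> = real (card ({l \<in> ag3_lines. sum g l = 1} \<inter> S))"
    by (simp add: sum.If_cases Int_commute)
  finally show "card ({l \<in> ag3_lines. sum g l = 1} \<inter> S) = x" by simp
qed auto

section \<open>Transfer from the cubic extension to the affine space\<close>

definition cubic_of_vec :: "('a::{field,finite}) ^ 3 \<Rightarrow> 'a cubic" where
  "cubic_of_vec v = Cubic (v $ 1) (v $ 2) (v $ 3)"

lemma bij_cubic_of_vec: "bij cubic_of_vec"
  by (rule bij_betwI[of _ _ _ "\<lambda>x. vector [c0 x, c1 x, c2 x]"])
     (auto simp: cubic_of_vec_def vector_3 vec_eq_iff forall_3)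

lemma cubic_of_vec_affine: "cubic_of_vec (v + c *s d) = cubic_of_vec v + emb c * cubic_of_vec d"
  by (simp add: cubic_of_vec_def emb_def cubic_defs)

lemma cubic_of_vec_eq_0: "cubic_of_vec v = 0 \<longleftrightarrow> v = 0"
  by (simp add: cubic_of_vec_def zero_cubic_def vec_eq_iff forall_3)

text \<open>The prime power is 1 modulo 4. If \<open>p\<close> were 3 modulo 4, the exponent would
  be even; then either \<open>p = 3\<close> gives a power of 9, or the prime power is 1 modulo 3,
  which both residues modulo 12 exclude.\<close>

lemma power_5_9_mod_12_cases:
  fixes p r :: nat
  assumes "prime p" and "[p ^ r = 5] (mod 12) \<or> [p ^ r = 9] (mod 12)"
  shows "p mod 4 = 1 \<or> (\<exists>k. p ^ r = 9 ^ k)"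
proof (rule disjCI)
  assume no9: "\<nexists>k. p ^ r = 9 ^ k"
  have q12: "p ^ r mod 12 = 5 \<or> p ^ r mod 12 = 9" using assms(2) by (auto simp: cong_def)
  hence q4: "p ^ r mod 4 = 1" using mod_mod_cancel[of 4 12 "p ^ r"] by auto
  have "p mod 4 = 0 \<or> p mod 4 = 1 \<or> p mod 4 = 2 \<or> p mod 4 = 3" by presburger
  moreover have "odd p"
  proof
    assume "even p"
    have "r \<noteq> 0" using q12 by (intro notI) simp
    hence "even (p ^ r)" using \<open>even p\<close> by simp
    thus False using q4 mod_mod_cancel[of 2 4 "p ^ r"] by (simp add: even_iff_mod_2_eq_zero)
  qed
  hence "p mod 4 \<noteq> 0" "p mod 4 \<noteq> 2" by presburger+
  moreover have "p mod 4 \<noteq> 3"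
  proof
    assume p3: "p mod 4 = 3"
    have sq: "p\<^sup>2 mod 4 = 1" using power_mod[of p 4 2] unfolding p3 by simp
    have even: "even r"
    proof (rule ccontr)
      assume "odd r"
      then obtain j where r: "r = Suc (2 * j)" by (metis oddE Suc_eq_plus1)
      have "p ^ r mod 4 = ((p mod 4) * ((p\<^sup>2) ^ j mod 4)) mod 4"
        unfolding r power_Suc power_mult by (rule mod_mult_eq[symmetric])
      also have "(p\<^sup>2) ^ j mod 4 = (p\<^sup>2 mod 4) ^ j mod 4" by (rule power_mod[symmetric])
      finally have "p ^ r mod 4 = 3" unfolding p3 sq by simp
      thus False using q4 by simp
    qed
    then obtain k where r: "r = 2 * k" by blast
    have "p \<noteq> 3" using no9 r by (auto simp: power_mult)
    hence "\<not> 3 dvd p" using primes_dvd_imp_eq[of 3 p] assms(1) by auto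
    hence "p mod 3 = 1 \<or> p mod 3 = 2" by (auto simp: dvd_eq_mod_eq_0)
    hence p2: "p\<^sup>2 mod 3 = 1" using power_mod[of p 3 2] by (elim disjE) simp_all
    have "p ^ r mod 3 = (p\<^sup>2 mod 3) ^ k mod 3" unfolding r power_mult by (rule power_mod[symmetric])
    hence "p ^ r mod 3 = 1" unfolding p2 by simp
    thus False using q12 mod_mod_cancel[of 3 12 "p ^ r"] by auto
  qed
  ultimately show "p mod 4 = 1" by blast
qed

theorem corollary7p2:
  fixes q :: nat
  assumes "primepow q"
    and "[q = 5] (mod 12) \<or> [q = 9] (mod 12)"
    and "CARD('a::{field,finite}) = q"
  shows "\<exists>L :: ('a^3) set set. cameron_liebler_line_class L ((q^2 - 1) div 2)"
proof -
  obtain p r where p: "prime p" "q = p ^ r" using assms(1) by (auto simp: primepow_def)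
  have "q mod 12 = 5 \<or> q mod 12 = 9" using assms(2) by (auto simp: cong_def)
  hence q4: "q mod 4 = 1" using mod_mod_cancel[of 4 12 q] by auto
  define n where "n = q div 4"
  have n: "q = 4 * n + 1" using q4 mult_div_mod_eq[of 4 q] by (simp add: n_def)
  hence "CARD('a) = 4 * n + 1" using assms(3) by simp
  from exists_quartic_field[OF this] obtain \<iota> :: 'a where \<iota>: "quartic_field \<iota> n" by blast
  have card: "CARD('a) = p ^ r" using assms(3) p(2) by simp
  have "p mod 4 = 1 \<or> (\<exists>k. CARD('a) = 9 ^ k)"
    using power_5_9_mod_12_cases[OF p(1), of r] assms(2) p(2) card by simp
  from exists_weight_cubic[OF \<iota> p(1) card this] obtain g :: "'a cubic \<Rightarrow> real" where
    g: "\<And>x d. d \<noteq> 0 \<Longrightarrow> (\<Sum>t\<in>UNIV. g (x + emb t * d)) \<in> {0, 1}"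
      "(\<Sum>x\<in>UNIV. g x) = (real (CARD('a)) ^ 2 - 1) / 2"
    by blast
  let ?g = "\<lambda>v. g (cubic_of_vec v)"
  have "sum ?g l \<in> {0, 1}" if line: "l \<in> ag3_lines" for l :: "('a ^ 3) set"
  proof -
    obtain v d where l: "l = {v + c *s d | c. True}" and d: "d \<noteq> 0"
      using line unfolding ag3_lines_def by blast
    have "l = range (\<lambda>c. v + c *s d)" unfolding l by auto
    moreover have "inj (\<lambda>c. v + c *s d)" using d by (auto simp: inj_def)
    ultimately have "sum ?g l = (\<Sum>c\<in>UNIV. g (cubic_of_vec v + emb c * cubic_of_vec d))"
      by (simp add: sum.reindex cubic_of_vec_affine)
    moreover have "cubic_of_vec d \<noteq> 0" using d by (simp add: cubic_of_vec_eq_0)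
    ultimately show ?thesis using g(1) by simp
  qed
  moreover have "sum ?g UNIV = real ((q^2 - 1) div 2)"
  proof -
    have "sum ?g UNIV = (real q ^ 2 - 1) / 2"
      using g(2) sum.reindex_bij_betw[OF bij_cubic_of_vec, of g] assms(3) by simp
    \<comment> \<open>Evenness and \<open>1 \<le> q^2\<close> make the truncating division and
      subtraction of the parameter exact.\<close>
    moreover have "even (q^2 - 1)" using n by simp
    moreover have "1 \<le> q^2" using n by simp
    ultimately show ?thesis by (simp add: real_of_nat_div of_nat_diff)
  qed
  ultimately show ?thesis using cameron_liebler_of_weight[of ?g] by blast
qed

end
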